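(* Let $O=(p\colon X^*\to E^* )$ be an origami of genus $g\ge 2$ and $\alpha\colon\pi_1(X,x_0)\to F_g$ a symplectic homomorphism. Then the group $\Gamma:=\operatorname{der}(\operatorname{Aff}^+(X)\cap\operatorname{Mod}_g(\alpha))$ has no hyperbolic elements, and $\operatorname{Aff}^+(X)\cap\operatorname{Mod}_g(\alpha)$ consists of the identity only or is isomorphic to $\mathbb{Z}$.
   Context: An origami $O$ is given by finitely many Euclidean unit squares such that every right side is glued by a translation to a left side, every upper side is glued by a translation to a lower side, and the resulting closed surface $X$ is connected; its genus is the genus of $X$. Sending each square to the torus $E=\mathbb{C}/(\mathbb{Z}+i\mathbb{Z})$ gives a finite covering $p\colon X\to E$ ramified at most over the point $\infty\in E$ that is the image of the vertices. Put $E^*=E\setminus\{\infty\}$, $X^*=X\setminus p^{-1}(\infty)$; the origami is denoted $O=(p\colon X^*\to E^* )$. $X^*$ carries the translation structure pulled back from $E$. $\operatorname{Aff}^+(X)$ is the group of orientation preserving homeomorphisms of $X$ that preserve $X^*$ and are of the form $z\mapsto Az+t$ in charts of this translation structure with $A\in\mathrm{SL}_2(\mathbb{R})$ (independent of the chart); $\operatorname{der}(f):=A$. Hyperbolic means $|\operatorname{tr}A|>2$. $F_g$ is the free group of rank $g$. A surjective homomorphism $\alpha\colon\pi_1(X,x_0)\to F_g$ is symplectic if there is a symplectic set of generators $(a_1,b_1,\dots,a_g,b_g)$, i.e. $\pi_1(X,x_0)=\langle a_1,b_1,\dots,a_g,b_g\mid\prod_{i=1}^g[a_i,b_i]\rangle$,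 with $\alpha(a_i)=1$ for all $i$. $\operatorname{Mod}_g$ is the mapping class group of $X$, identified with $\operatorname{Out}^+(\pi_1(X,x_0))$ by Dehn–Nielsen–Baer. $\operatorname{Mod}_g(\alpha)$ is the subgroup of all $\varphi\in\operatorname{Mod}_g$ for which a (equivalently any) representative $\tilde\varphi\in\operatorname{Aut}^+(\pi_1(X,x_0))$ satisfies $\alpha\circ\tilde\varphi=c\circ\alpha$ for some inner automorphism $c$ of $F_g$. $\operatorname{Aff}^+(X)$ is regarded as a subgroup of $\operatorname{Mod}_g$ by sending a map to its mapping class (injective for $g\ge2$). *)

theory Defs
  imports
    "HOL-Analysis.Analysis"
    "HOL-Algebra.Bij"
    "HOL-Algebra.Elementary_Groups"
    "HOL-Algebra.Free_Abelian_Groups"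
    "HOL-Homology.Homology"
begin

section \<open>Quotient topology\<close>

definition quotient_topology :: "'a topology \<Rightarrow> ('a \<Rightarrow> 'b) \<Rightarrow> 'b topology" where
  "quotient_topology T q =
     topology (\<lambda>U. U \<subseteq> q ` topspace T \<and> openin T {x \<in> topspace T. q x \<in> U})"

lemma openin_quotient_topology:
  "openin (quotient_topology T q) U \<longleftrightarrow>
     U \<subseteq> q ` topspace T \<and> openin T {x \<in> topspace T. q x \<in> U}"
proof -
  have "istopology (\<lambda>U. U \<subseteq> q ` topspace T \<and> openin T {x \<in> topspace T. q x \<in> U})"
    unfolding istopology_def
  proof (rule conjI; clarify)
    fix U V
    assume "openin T {x \<in> topspace T. q x \<in> U}" "openin T {x \<in> topspace T. q x \<in> V}"
      and "U \<subseteq> q ` topspace T"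
    moreover have "{x \<in> topspace T. q x \<in> U \<inter> V} =
        {x \<in> topspace T. q x \<in> U} \<inter> {x \<in> topspace T. q x \<in> V}" by auto
    ultimately show "U \<inter> V \<subseteq> q ` topspace T \<and> openin T {x \<in> topspace T. q x \<in> U \<inter> V}"
      by auto
  next
    fix \<U>
    assume *: "\<forall>U\<in>\<U>. U \<subseteq> q ` topspace T \<and> openin T {x \<in> topspace T. q x \<in> U}"
    have "{x \<in> topspace T. q x \<in> \<Union>\<U>} = (\<Union>U\<in>\<U>. {x \<in> topspace T. q x \<in> U})" by auto
    moreover have "openin T (\<Union>U\<in>\<U>. {x \<in> topspace T. q x \<in> U})"
      using * by (intro openin_Union) auto
    ultimately show "\<Union>\<U> \<subseteq> q ` topspace T \<and> openin T {x \<in> topspace T. q x \<in> \<Union>\<U>}"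
      using * by auto
  qed
  then show ?thesis
    by (simp add: quotient_topology_def)
qed

lemma topspace_quotient_topology [simp]:
  "topspace (quotient_topology T q) = q ` topspace T"
proof
  show "topspace (quotient_topology T q) \<subseteq> q ` topspace T"
    using openin_topspace[of "quotient_topology T q"] unfolding openin_quotient_topology
    by (rule conjunct1)
  have "{x \<in> topspace T. q x \<in> q ` topspace T} = topspace T"
    by blast
  then have "openin (quotient_topology T q) (q ` topspace T)"
    by (simp add: openin_quotient_topology)
  then show "q ` topspace T \<subseteq> topspace (quotient_topology T q)"
    by (rule openin_subset)
qed

lemma quotient_map_quotient_topology: "quotient_map T (quotient_topology T q) q"
  by (auto simp: quotient_map_def openin_quotient_topology)


section \<open>Fundamental group of an abstract topological space\<close>

definition path_homotopic :: "'a topology \<Rightarrow> (real \<Rightarrow> 'a) \<Rightarrow> (real \<Rightarrow> 'a) \<Rightarrow> bool" where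
  "path_homotopic X c d \<longleftrightarrow>
     homotopic_with (\<lambda>e. e 0 = c 0 \<and> e 1 = c 1) (top_of_set {0..1}) X c d"

definition path_class :: "'a topology \<Rightarrow> (real \<Rightarrow> 'a) \<Rightarrow> (real \<Rightarrow> 'a) set" where
  "path_class X c = {d. path_homotopic X c d}"

text \<open>The library's path concatenation and reversal are restricted to points in a type of
  class \<^class>\<open>topological_space\<close>, so we need versions for arbitrary types.\<close>

definition path_join :: "(real \<Rightarrow> 'a) \<Rightarrow> (real \<Rightarrow> 'a) \<Rightarrow> real \<Rightarrow> 'a" where
  "path_join c d = (\<lambda>t. if t \<le> 1/2 then c (2 * t) else d (2 * t - 1))"

definition path_reverse :: "(real \<Rightarrow> 'a) \<Rightarrow> real \<Rightarrow> 'a" where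
  "path_reverse c = (\<lambda>t. c (1 - t))"

definition paths_between :: "'a topology \<Rightarrow> 'a \<Rightarrow> 'a \<Rightarrow> (real \<Rightarrow> 'a) set" where
  "paths_between X x y = {c. pathin X c \<and> c 0 = x \<and> c 1 = y}"

definition fundamental_group :: "'a topology \<Rightarrow> 'a \<Rightarrow> (real \<Rightarrow> 'a) set monoid" where
  "fundamental_group X x0 =
     \<lparr>carrier = path_class X ` paths_between X x0 x0,
      monoid.mult = (\<lambda>C D. \<Union>c\<in>C. \<Union>d\<in>D. path_class X (path_join c d)),
      one = path_class X (\<lambda>_. x0)\<rparr>"


section \<open>Free groups and presentations\<close>

text \<open>The letter \<open>(i, True)\<close> stands for the generator \<open>x\<^sub>i\<close>, the letter \<open>(i, False)\<close> for its
  inverse.  The free group consists of the freely reduced words.\<close>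

type_synonym 'i word = "('i \<times> bool) list"

definition inv_letter :: "'i \<times> bool \<Rightarrow> 'i \<times> bool" where
  "inv_letter l = (fst l, \<not> snd l)"

fun push :: "'i \<times> bool \<Rightarrow> 'i word \<Rightarrow> 'i word" where
  "push l [] = [l]"
| "push l (k # w) = (if k = inv_letter l then w else l # k # w)"

definition free_reduce :: "'i word \<Rightarrow> 'i word" where
  "free_reduce w = foldr push w []"

definition free_group :: "'i set \<Rightarrow> 'i word monoid" where
  "free_group I =
     \<lparr>carrier = {w. free_reduce w = w \<and> fst ` set w \<subseteq> I},
      monoid.mult = (\<lambda>v w. free_reduce (v @ w)),
      one = []\<rparr>"

lemma inv_letter_involution [simp]: "inv_letter (inv_letter l) = l"
  by (simp add: inv_letter_def)

inductive reduced_word :: "'i word \<Rightarrow> bool" where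
  "reduced_word []"
| "reduced_word [l]"
| "reduced_word (k # w) \<Longrightarrow> k \<noteq> inv_letter l \<Longrightarrow> reduced_word (l # k # w)"

inductive_cases reduced_word_ConsE: "reduced_word (l # w)"

lemma reduced_word_tl: "reduced_word (l # w) \<Longrightarrow> reduced_word w"
  by (erule reduced_word_ConsE) (auto intro: reduced_word.intros)

lemma reduced_word_hd: "reduced_word (l # k # w) \<Longrightarrow> k \<noteq> inv_letter l"
  by (erule reduced_word_ConsE) auto

lemma reduced_word_push: "reduced_word w \<Longrightarrow> reduced_word (push l w)"
  by (cases w) (auto intro: reduced_word.intros dest: reduced_word_tl)

lemma reduced_word_foldr_push: "reduced_word w \<Longrightarrow> reduced_word (foldr push v w)"
  by (induction v) (auto intro: reduced_word_push)

lemma reduced_word_free_reduce: "reduced_word (free_reduce w)"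
  by (simp add: free_reduce_def reduced_word_foldr_push reduced_word.intros)

lemma free_reduce_reduced: "reduced_word w \<Longrightarrow> free_reduce w = w"
  by (induction rule: reduced_word.induct) (auto simp: free_reduce_def)

lemma free_reduce_fixed_iff: "free_reduce w = w \<longleftrightarrow> reduced_word w"
  using free_reduce_reduced reduced_word_free_reduce by metis

lemma push_inv_push: "reduced_word w \<Longrightarrow> push l (push (inv_letter l) w) = w"
proof (cases w)
  case (Cons k v)
  assume "reduced_word w"
  then show ?thesis
    by (cases v) (auto simp: Cons dest: reduced_word_hd)
qed simp

lemma foldr_push_push:
  "reduced_word w \<Longrightarrow> foldr push (push l u) w = push l (foldr push u w)"
  by (cases u) (auto simp: push_inv_push reduced_word_foldr_push)

lemma foldr_push_free_reduce:
  "reduced_word w \<Longrightarrow> foldr push (free_reduce v) w = foldr push v w"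
  by (induction v) (auto simp: free_reduce_def foldr_push_push)

lemma free_reduce_append_left: "free_reduce (free_reduce v @ w) = free_reduce (v @ w)"
proof -
  have "free_reduce (v @ w) = foldr push v (free_reduce w)" for v w :: "'a word"
    by (simp add: free_reduce_def)
  then show ?thesis
    by (simp add: foldr_push_free_reduce reduced_word_free_reduce)
qed

lemma free_reduce_append_right: "free_reduce (v @ free_reduce w) = free_reduce (v @ w)"
proof -
  have "free_reduce (v @ w) = foldr push v (free_reduce w)" for v w :: "'a word"
    by (simp add: free_reduce_def)
  then show ?thesis
    by (simp add: free_reduce_reduced reduced_word_free_reduce)
qed

lemma set_push: "set (push l w) \<subseteq> insert l (set w)"
  by (cases w) auto

lemma set_free_reduce: "set (free_reduce w) \<subseteq> set w"
proof (induction w)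
  case (Cons l w)
  then show ?case using set_push[of l "free_reduce w"] by (auto simp: free_reduce_def)
qed (simp add: free_reduce_def)

lemma free_reduce_inverse: "free_reduce (map inv_letter (rev w) @ w) = []"
proof (induction w)
  case (Cons l w)
  have "free_reduce (map inv_letter (rev (l # w)) @ l # w)
      = free_reduce (map inv_letter (rev w) @ free_reduce (inv_letter l # l # w))"
    by (simp add: free_reduce_append_right)
  also have "free_reduce (inv_letter l # l # w) = free_reduce w"
    using push_inv_push[OF reduced_word_free_reduce, of "inv_letter l" w]
    by (simp add: free_reduce_def)
  finally show ?case
    using Cons by (simp add: free_reduce_append_right)
qed (simp add: free_reduce_def)

lemma group_free_group: "group (free_group I)"
proof (rule groupI)
  fix v w assume "v \<in> carrier (free_group I)" "w \<in> carrier (free_group I)"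
  then show "v \<otimes>\<^bsub>free_group I\<^esub> w \<in> carrier (free_group I)"
    using set_free_reduce[of "v @ w"]
    by (fastforce simp: free_group_def free_reduce_fixed_iff reduced_word_free_reduce)
next
  fix w assume w: "w \<in> carrier (free_group I)"
  let ?w' = "free_reduce (map inv_letter (rev w))"
  have "fst ` set ?w' \<subseteq> I"
    using w set_free_reduce[of "map inv_letter (rev w)"]
    by (fastforce simp: free_group_def inv_letter_def)
  then show "\<exists>v\<in>carrier (free_group I). v \<otimes>\<^bsub>free_group I\<^esub> w = \<one>\<^bsub>free_group I\<^esub>"
    using free_reduce_inverse[of w]
    by (intro bexI[of _ ?w'])
      (auto simp: free_group_def free_reduce_fixed_iff reduced_word_free_reduce
        free_reduce_append_left)
qed (auto simp: free_group_def free_reduce_append_left free_reduce_append_right,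
     simp add: free_reduce_def)

definition eval_word :: "('a, 'm) monoid_scheme \<Rightarrow> ('i \<Rightarrow> 'a) \<Rightarrow> 'i word \<Rightarrow> 'a" where
  "eval_word G x w =
     foldr (\<lambda>(i, b) y. (if b then x i else inv\<^bsub>G\<^esub> (x i)) \<otimes>\<^bsub>G\<^esub> y) w \<one>\<^bsub>G\<^esub>"

definition normal_closure :: "('a, 'm) monoid_scheme \<Rightarrow> 'a set \<Rightarrow> 'a set" where
  "normal_closure G R = \<Inter> {N. N \<lhd> G \<and> R \<subseteq> N}"

definition has_presentation ::
  "('a, 'm) monoid_scheme \<Rightarrow> 'i set \<Rightarrow> ('i \<Rightarrow> 'a) \<Rightarrow> 'i word set \<Rightarrow> bool" where
  "has_presentation G I x R \<longleftrightarrow>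
     x ` I \<subseteq> carrier G \<and>
     eval_word G x \<in> epi (free_group I) G \<and>
     kernel (free_group I) G (eval_word G x) = normal_closure (free_group I) R"


section \<open>Symplectic homomorphisms\<close>

text \<open>Generators \<open>a\<^sub>i\<close> are indexed by \<open>Inl i\<close>, generators \<open>b\<^sub>i\<close> by \<open>Inr i\<close>, with \<open>i < g\<close>;
  the relator is \<open>\<Prod>\<^sub>i a\<^sub>i b\<^sub>i a\<^sub>i\<^sup>-\<^sup>1 b\<^sub>i\<^sup>-\<^sup>1\<close>.\<close>

definition surface_relator :: "nat \<Rightarrow> (nat + nat) word" where
  "surface_relator g =
     concat (map (\<lambda>i. [(Inl i, True), (Inr i, True), (Inl i, False), (Inr i, False)]) [0..<g])"

definition symplectic_generators ::
  "('a, 'm) monoid_scheme \<Rightarrow> nat \<Rightarrow> (nat \<Rightarrow> 'a) \<Rightarrow> (nat \<Rightarrow> 'a) \<Rightarrow> bool" where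
  "symplectic_generators G g a b \<longleftrightarrow>
     has_presentation G (Inl ` {..<g} \<union> Inr ` {..<g}) (case_sum a b) {surface_relator g}"

definition symplectic_hom ::
  "'a topology \<Rightarrow> 'a \<Rightarrow> nat \<Rightarrow> ((real \<Rightarrow> 'a) set \<Rightarrow> nat word) \<Rightarrow> bool" where
  "symplectic_hom X x0 g \<alpha> \<longleftrightarrow>
     \<alpha> \<in> epi (fundamental_group X x0) (free_group {..<g}) \<and>
     (\<exists>a b. symplectic_generators (fundamental_group X x0) g a b \<and>
            (\<forall>i<g. \<alpha> (a i) = \<one>\<^bsub>free_group {..<g}\<^esub>))"


section \<open>Genus, orientation and mapping classes of a closed oriented surface\<close>

definition genus :: "'a topology \<Rightarrow> nat" where
  "genus X = (THE g. homology_group 1 X \<cong> free_Abelian_group {..<2 * g})"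

text \<open>For a closed connected oriented surface, preserving the orientation means fixing the
  fundamental class, that is, acting trivially on \<open>H\<^sub>2\<close>.\<close>

definition orientation_preserving_homeo :: "'a topology \<Rightarrow> ('a \<Rightarrow> 'a) \<Rightarrow> bool" where
  "orientation_preserving_homeo X f \<longleftrightarrow>
     homeomorphic_map X X f \<and>
     (\<forall>c \<in> carrier (homology_group 2 X). hom_induced 2 X {} X {} f c = c)"

definition induced_auto ::
  "'a topology \<Rightarrow> 'a \<Rightarrow> ('a \<Rightarrow> 'a) \<Rightarrow> (real \<Rightarrow> 'a) \<Rightarrow> (real \<Rightarrow> 'a) set \<Rightarrow> (real \<Rightarrow> 'a) set" where
  "induced_auto X x0 f \<gamma> =
     (\<lambda>C \<in> carrier (fundamental_group X x0).
        \<Union>c\<in>C. path_class X (path_join \<gamma> (path_join (f \<circ> c) (path_reverse \<gamma>))))"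

text \<open>Changing the path from \<open>x0\<close> to \<open>f x0\<close> changes the induced automorphism by an inner one, and
  every inner automorphism arises in this way.  Hence \<open>outer_class X x0 f\<close> is an element of
  \<open>Out(\<pi>\<^sub>1(X,x0))\<close>, represented as a coset of the inner automorphisms.\<close>

definition outer_class ::
  "'a topology \<Rightarrow> 'a \<Rightarrow> ('a \<Rightarrow> 'a) \<Rightarrow> ((real \<Rightarrow> 'a) set \<Rightarrow> (real \<Rightarrow> 'a) set) set" where
  "outer_class X x0 f = induced_auto X x0 f ` paths_between X x0 (f x0)"

text \<open>The mapping class group in its Dehn--Nielsen--Baer incarnation \<open>Out\<^sup>+(\<pi>\<^sub>1(X,x0))\<close>:
  the outer automorphisms induced by orientation preserving homeomorphisms.\<close>

definition mod_group ::
  "'a topology \<Rightarrow> 'a \<Rightarrow> ((real \<Rightarrow> 'a) set \<Rightarrow> (real \<Rightarrow> 'a) set) set set" where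
  "mod_group X x0 = outer_class X x0 ` {f. orientation_preserving_homeo X f}"

definition mod_subgroup ::
  "'a topology \<Rightarrow> 'a \<Rightarrow> nat \<Rightarrow> ((real \<Rightarrow> 'a) set \<Rightarrow> nat word)
     \<Rightarrow> ((real \<Rightarrow> 'a) set \<Rightarrow> (real \<Rightarrow> 'a) set) set set" where
  "mod_subgroup X x0 g \<alpha> =
     {\<Phi> \<in> mod_group X x0.
        \<exists>\<phi>\<in>\<Phi>. \<exists>w \<in> carrier (free_group {..<g}).
          \<forall>C \<in> carrier (fundamental_group X x0).
            \<alpha> (\<phi> C) = w \<otimes>\<^bsub>free_group {..<g}\<^esub> \<alpha> C \<otimes>\<^bsub>free_group {..<g}\<^esub> inv\<^bsub>free_group {..<g}\<^esub> w}"


section \<open>Origamis\<close>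

type_synonym plane = "real^2"

text \<open>Points of the glued surface are equivalence classes of points of squares.\<close>

type_synonym 's point = "('s \<times> plane) set"

text \<open>The right side of a square \<open>s\<close> is glued to the left side of \<open>right_of Q s\<close>, and its upper
  side to the lower side of \<open>above_of Q s\<close>.\<close>

record 's origami =
  squares :: "'s set"
  right_of :: "'s \<Rightarrow> 's"
  above_of :: "'s \<Rightarrow> 's"

definition squares_topology :: "('s, 'm) origami_scheme \<Rightarrow> ('s \<times> plane) topology" where
  "squares_topology Q = prod_topology (discrete_topology (squares Q)) (top_of_set (cbox 0 1))"

definition gluing :: "('s, 'm) origami_scheme \<Rightarrow> (('s \<times> plane) \<times> ('s \<times> plane)) set" where
  "gluing Q =
     {((s, z), (right_of Q s, z - axis 1 1)) | s z. s \<in> squares Q \<and> z \<in> cbox 0 1 \<and> z $ 1 = 1} \<union>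
     {((s, z), (above_of Q s, z - axis 2 1)) | s z. s \<in> squares Q \<and> z \<in> cbox 0 1 \<and> z $ 2 = 1}"

definition glued_point :: "('s, 'm) origami_scheme \<Rightarrow> 's \<times> plane \<Rightarrow> 's point" where
  "glued_point Q y = (gluing Q \<union> (gluing Q)\<inverse>)\<^sup>* `` {y}"

definition surface :: "('s, 'm) origami_scheme \<Rightarrow> 's point topology" where
  "surface Q = quotient_topology (squares_topology Q) (glued_point Q)"

definition is_origami :: "('s, 'm) origami_scheme \<Rightarrow> bool" where
  "is_origami Q \<longleftrightarrow>
     finite (squares Q) \<and> squares Q \<noteq> {} \<and>
     bij_betw (right_of Q) (squares Q) (squares Q) \<and>
     bij_betw (above_of Q) (squares Q) (squares Q) \<and>
     connected_space (surface Q)"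

text \<open>The projection \<open>\<real>\<^sup>2 \<rightarrow> E = \<real>\<^sup>2/\<int>\<^sup>2\<close>, and the covering \<open>p: X \<rightarrow> E\<close>.  All representatives of a
  point of \<open>X\<close> project to the same coset, so the union below is that coset.\<close>

definition torus_proj :: "plane \<Rightarrow> plane set" where
  "torus_proj z = {w. \<forall>i. (w - z) $ i \<in> \<int>}"

definition covering :: "'s point \<Rightarrow> plane set" where
  "covering x = (\<Union>(s, z)\<in>x. torus_proj z)"

definition punctured_surface :: "('s, 'm) origami_scheme \<Rightarrow> 's point set" where
  "punctured_surface Q = {x \<in> topspace (surface Q). covering x \<noteq> torus_proj 0}"

text \<open>The charts of the translation structure on \<open>X\<^sup>*\<close> pulled back from \<open>E\<close>: they are the
  homeomorphisms onto open subsets of the plane which lift \<open>p\<close>.\<close>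

definition translation_chart ::
  "('s, 'm) origami_scheme \<Rightarrow> 's point set \<Rightarrow> ('s point \<Rightarrow> plane) \<Rightarrow> bool" where
  "translation_chart Q U \<phi> \<longleftrightarrow>
     openin (surface Q) U \<and> U \<subseteq> punctured_surface Q \<and> open (\<phi> ` U) \<and>
     homeomorphic_map (subtopology (surface Q) U) (top_of_set (\<phi> ` U)) \<phi> \<and>
     (\<forall>x\<in>U. torus_proj (\<phi> x) = covering x)"

text \<open>The map \<open>f\<close> is \<open>z \<mapsto> A z + t\<close> in charts.  Since the intersection of \<open>U\<close> with the preimage of
  \<open>V\<close> may be disconnected, \<open>t\<close> is constant only locally.\<close>

definition affine_with ::
  "('s, 'm) origami_scheme \<Rightarrow> ('s point \<Rightarrow> 's point) \<Rightarrow> real^2^2 \<Rightarrow> bool" where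
  "affine_with Q f A \<longleftrightarrow>
     (\<forall>U \<phi> V \<psi>. translation_chart Q U \<phi> \<and> translation_chart Q V \<psi> \<longrightarrow>
        (\<forall>x\<in>U. f x \<in> V \<longrightarrow>
           (\<exists>W t. openin (surface Q) W \<and> x \<in> W \<and> W \<subseteq> U \<and> f ` W \<subseteq> V \<and>
                  (\<forall>y\<in>W. \<psi> (f y) = A *v \<phi> y + t))))"

definition aff_group ::
  "('s, 'm) origami_scheme \<Rightarrow> ('s point \<Rightarrow> 's point) monoid" where
  "aff_group Q = (BijGroup (topspace (surface Q)))
     \<lparr>carrier := {f \<in> extensional (topspace (surface Q)).
        orientation_preserving_homeo (surface Q) f \<and>
        f ` punctured_surface Q = punctured_surface Q \<and>
        (\<exists>A. det A = 1 \<and> affine_with Q f A)}\<rparr>"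

definition der ::
  "('s, 'm) origami_scheme \<Rightarrow> ('s point \<Rightarrow> 's point) \<Rightarrow> real^2^2" where
  "der Q f = (THE A. affine_with Q f A)"

definition hyperbolic :: "real^2^2 \<Rightarrow> bool" where
  "hyperbolic A \<longleftrightarrow> \<bar>trace A\<bar> > 2"

text \<open>The intersection of \<open>Aff\<^sup>+(X)\<close> with \<open>Mod\<^sub>g(\<alpha>)\<close>, realised inside \<open>Aff\<^sup>+(X)\<close>: the affine maps
  whose mapping class lies in \<open>Mod\<^sub>g(\<alpha>)\<close>.\<close>

definition aff_mod_group ::
  "('s, 'm) origami_scheme \<Rightarrow> 's point \<Rightarrow> nat
     \<Rightarrow> ((real \<Rightarrow> 's point) set \<Rightarrow> nat word)
     \<Rightarrow> ('s point \<Rightarrow> 's point) monoid" where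
  "aff_mod_group Q x0 g \<alpha> = (aff_group Q)
     \<lparr>carrier := {f \<in> carrier (aff_group Q).
        outer_class (surface Q) x0 f \<in> mod_subgroup (surface Q) x0 g \<alpha>}\<rparr>"

end

theory Submission
  imports Defs
begin

text \<open>
Let \<open>\<pi>\<close> be the fundamental group of the surface and \<open>H = Hom(\<pi>, \<real>)\<close> its first cohomology.  A
symplectic set of generators defines the intersection pairing on \<open>H\<close>, for which the classes killing
all \<open>a\<^sub>i\<close> form a Lagrangian subspace \<open>U\<close>.  Holonomy, the displacement of a path developed into the
plane, is a pair of classes in \<open>H\<close>, and an affine map \<open>f\<close> with linear part \<open>A\<close> acts on this pair by
\<open>A\<close> (\<open>hol_affine\<close>).

Let \<open>f\<close> be an affine map in the stabiliser of \<open>\<alpha>\<close>.  The classes in \<open>U\<close> are those that factor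
through \<open>\<alpha>\<close>, so \<open>f\<close> fixes them (\<open>real_hom_factors\<close>).  Since \<open>f\<close> preserves the pairing, it then acts
trivially on \<open>H / U\<close>, that is, no class changes its value on an \<open>a\<^sub>i\<close> (\<open>lagrangian_duality\<close>).  For
holonomy this says that \<open>A\<close> fixes the period of every \<open>a\<^sub>i\<close>.  If one of these periods is nonzero,
then \<open>A\<close> is a shear in its direction; otherwise holonomy lies in \<open>U\<close> and \<open>A\<close> is the identity.  In
both cases the trace is 2, so \<open>A\<close> is not hyperbolic.

That \<open>f\<close> preserves the pairing is seen as follows.  A cup product of classes on \<open>\<pi>\<close> is a coboundary
exactly if its pairing vanishes (\<open>primitive_exists\<close>), and coboundaries pull back under endomorphisms;
hence \<open>f\<close> multiplies the pairing by a constant.  On the two coordinates of holonomy this constant is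
the determinant of \<open>A\<close>, which is 1, provided that the pairing of these coordinates is not zero.  To
see this, classes are restricted to the sides of the squares.  There the cup product becomes a finite
sum over the squares, which is proportional to the pairing (\<open>cup_proportional\<close>), and whose value on
the coordinates of holonomy is the number of squares.

It remains to show that a translation \<open>f\<close> in the stabiliser is the identity
(\<open>translation_trivial\<close>).  It permutes the squares freely, with some order \<open>m\<close>, and acts on \<open>H\<close>
unipotently with finite order, hence trivially.  In genus at least 2 there are integral classes \<open>u\<close>
and \<open>v\<close> with pairing 1 which both vanish on a prescribed element of \<open>\<pi>\<close>; for a suitable element they
are represented by integral cocycles on the squares that are invariant under \<open>f\<close>
(\<open>invariant_cocycle\<close>).  Their cup product is a sum over free orbits of length \<open>m\<close>, so it is divisible
by \<open>m\<close>.  But it divides 1, because two curves on the surface that cross once show that the cup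
product differs from the pairing by an integral factor (\<open>fundamental_class\<close>).  So \<open>m = 1\<close>.

Thus a map in the stabiliser is determined by its linear part.  The linear parts are shears in one
direction, and such a shear is determined by the integral vector by which it displaces one suitable
period.  This embeds the stabiliser into \<open>\<int>\<close> (\<open>stabiliser_cyclic\<close>).
\<close>

section \<open>Homotopies of paths in abstract spaces\<close>

lemma path_homotopic_refl: "pathin X c \<Longrightarrow> path_homotopic X c c"
  by (simp add: path_homotopic_def pathin_def)

lemma path_homotopic_ends: "path_homotopic X c d \<Longrightarrow> d 0 = c 0 \<and> d 1 = c 1"
  unfolding path_homotopic_def by (drule homotopic_with_imp_property) simp

lemma path_homotopic_pathin: "path_homotopic X c d \<Longrightarrow> pathin X c \<and> pathin X d"
  unfolding path_homotopic_def pathin_def by (drule homotopic_with_imp_continuous_maps) simp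

lemma path_homotopic_sym: "path_homotopic X c d \<Longrightarrow> path_homotopic X d c"
  using path_homotopic_ends[of X c d] unfolding path_homotopic_def
  by (simp add: homotopic_with_sym)

lemma path_homotopic_trans [trans]:
  "path_homotopic X c d \<Longrightarrow> path_homotopic X d e \<Longrightarrow> path_homotopic X c e"
  using path_homotopic_ends[of X c d] unfolding path_homotopic_def
  by (auto intro: homotopic_with_trans)

lemma path_homotopic_eq:
  assumes "pathin X c" "\<And>t. t \<in> {0..1} \<Longrightarrow> c t = d t"
  shows "path_homotopic X c d"
  using assms unfolding path_homotopic_def pathin_def
  by (intro homotopic_with_equal) (auto simp: assms(2)[symmetric])

lemma path_class_eq_iff:
  assumes "pathin X c"
  shows "path_class X c = path_class X d \<longleftrightarrow> path_homotopic X c d"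
proof
  assume "path_class X c = path_class X d"
  moreover have "c \<in> path_class X c"
    by (simp add: path_class_def path_homotopic_refl assms)
  ultimately have "c \<in> path_class X d"
    by simp
  then show "path_homotopic X c d"
    by (simp add: path_class_def path_homotopic_sym)
next
  assume "path_homotopic X c d"
  then show "path_class X c = path_class X d"
    unfolding path_class_def by (blast intro: path_homotopic_sym path_homotopic_trans)
qed

lemma path_homotopic_compose:
  assumes "path_homotopic X c d" "continuous_map X Y f"
  shows "path_homotopic Y (f \<circ> c) (f \<circ> d)"
  unfolding path_homotopic_def
  by (rule homotopic_with_compose_continuous_map_left[OF assms(1)[unfolded path_homotopic_def] assms(2)])
     auto

text \<open>Straight-line homotopies.  The associativity, unit and inverse laws below are instances: both
  sides are reparametrised versions of one and the same map on an interval.\<close>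

lemma path_homotopic_convex:
  fixes K :: "'b::real_normed_vector set"
  assumes "convex K" and k: "continuous_map (top_of_set K) X k"
    and r: "continuous_on {0..1} r" "r ` {0..1} \<subseteq> K"
    and s: "continuous_on {0..1} s" "s ` {0..1} \<subseteq> K"
    and ends: "r 0 = s 0" "r 1 = s 1"
  shows "path_homotopic X (k \<circ> r) (k \<circ> s)"
proof -
  let ?h = "\<lambda>y. (1 - fst y) *\<^sub>R r (snd y) + fst y *\<^sub>R s (snd y)"
  have "continuous_on ({0..1} \<times> {0..1}) ?h"
    by (intro continuous_intros continuous_on_compose2[OF r(1)] continuous_on_compose2[OF s(1)]) auto
  moreover have "?h ` ({0..1} \<times> {0..1}) \<subseteq> K"
  proof clarsimp
    fix a b :: real assume "0 \<le> a" "a \<le> 1" "0 \<le> b" "b \<le> 1"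
    then have "r b \<in> K" "s b \<in> K" using r(2) s(2) by auto
    with \<open>convex K\<close> \<open>0 \<le> a\<close> \<open>a \<le> 1\<close> show "(1 - a) *\<^sub>R r b + a *\<^sub>R s b \<in> K"
      by (intro convexD) auto
  qed
  ultimately have "continuous_map (prod_topology (top_of_set {0..1}) (top_of_set {0..1})) (top_of_set K) ?h"
    by (simp add: continuous_map_in_subtopology prod_topology_subtopology subtopology_subtopology
        euclidean_product_topology[symmetric] Times_Int_Times image_subset_iff Pi_iff)
  then have "continuous_map (prod_topology (top_of_set {0..1}) (top_of_set {0..1})) X (k \<circ> ?h)"
    by (rule continuous_map_compose[OF _ k])
  then show ?thesis
    unfolding path_homotopic_def homotopic_with_def
    by (intro exI[of _ "k \<circ> ?h"]) (auto simp: ends algebra_simps simp flip: scaleR_add_left)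
qed

lemma continuous_map_interval_glue:
  fixes a b e :: real
  assumes "continuous_map (top_of_set {a..b}) X f" "continuous_map (top_of_set {b..e}) X g" "f b = g b"
    "a \<le> b" "b \<le> e"
  shows "continuous_map (top_of_set {a..e}) X (\<lambda>t. if t \<le> b then f t else g t)"
proof (rule continuous_map_cases_le)
  have 1: "subtopology (top_of_set {a..e}) {x \<in> topspace (top_of_set {a..e}). x \<le> b} = top_of_set {a..b}"
    using assms(4,5) by (simp add: subtopology_subtopology) (rule arg_cong[where f = top_of_set], auto)
  have 2: "subtopology (top_of_set {a..e}) {x \<in> topspace (top_of_set {a..e}). b \<le> x} = top_of_set {b..e}"
    using assms(4,5) by (simp add: subtopology_subtopology) (rule arg_cong[where f = top_of_set], auto)
  show "continuous_map (subtopology (top_of_set {a..e}) {x \<in> topspace (top_of_set {a..e}). x \<le> b}) X f"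
    using assms(1) 1 by simp
  show "continuous_map (subtopology (top_of_set {a..e}) {x \<in> topspace (top_of_set {a..e}). b \<le> x}) X g"
    using assms(2) 2 by simp
qed (auto simp: assms)

lemma continuous_map_affine_reparam:
  fixes f :: "real \<Rightarrow> 'a"
  assumes "pathin X f" "continuous_on S r" "r ` S \<subseteq> {0..1}"
  shows "continuous_map (top_of_set S) X (\<lambda>t. f (r t))"
proof -
  have "continuous_map (top_of_set S) (top_of_set {0..1}) r"
    using assms(2,3) by (simp add: continuous_map_in_subtopology image_subset_iff Pi_iff)
  from continuous_map_compose[OF this assms(1)[unfolded pathin_def]] show ?thesis
    by (simp add: o_def)
qed

lemma pathin_path_join:
  assumes "pathin X c" "pathin X d" "c 1 = d 0"
  shows "pathin X (path_join c d)"
  unfolding pathin_def path_join_def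
  by (rule continuous_map_interval_glue)
     (auto intro!: continuous_map_affine_reparam assms continuous_intros simp: assms(3))

lemma pathin_path_reverse: "pathin X c \<Longrightarrow> pathin X (path_reverse c)"
  unfolding path_reverse_def
  by (subst pathin_def) (auto intro!: continuous_map_affine_reparam continuous_intros)

lemma path_join_ends [simp]: "path_join c d 0 = c 0" "path_join c d 1 = d 1"
  by (auto simp: path_join_def)

lemma path_reverse_ends [simp]: "path_reverse c 0 = c 1" "path_reverse c 1 = c 0"
  by (auto simp: path_reverse_def)

lemma path_reverse_reverse [simp]: "path_reverse (path_reverse c) = c"
  by (auto simp: path_reverse_def)

lemma compose_path_join: "f \<circ> path_join c d = path_join (f \<circ> c) (f \<circ> d)"
  by (auto simp: path_join_def)

lemma compose_path_reverse: "f \<circ> path_reverse c = path_reverse (f \<circ> c)"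
  by (auto simp: path_reverse_def)

lemma path_join_cong:
  assumes "path_homotopic X c c'" "path_homotopic X d d'" "c 1 = d 0"
  shows "path_homotopic X (path_join c d) (path_join c' d')"
proof -
  let ?I = "top_of_set {0..1::real}"
  obtain h where h: "continuous_map (prod_topology ?I ?I) X h" "\<And>x. h (0, x) = c x" "\<And>x. h (1, x) = c' x"
    "\<And>t. t \<in> {0..1} \<Longrightarrow> h (t, 0) = c 0 \<and> h (t, 1) = c 1"
    using assms(1) unfolding path_homotopic_def homotopic_with_def by auto
  obtain k where k: "continuous_map (prod_topology ?I ?I) X k" "\<And>x. k (0, x) = d x" "\<And>x. k (1, x) = d' x"
    "\<And>t. t \<in> {0..1} \<Longrightarrow> k (t, 0) = d 0 \<and> k (t, 1) = d 1"
    using assms(2) unfolding path_homotopic_def homotopic_with_def by auto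
  let ?H = "\<lambda>y. if snd y \<le> 1/2 then h (fst y, 2 * snd y) else k (fst y, 2 * snd y - 1)"
  have I2: "prod_topology ?I ?I = top_of_set ({0..1} \<times> {0..1})"
    by (simp add: prod_topology_subtopology subtopology_subtopology
        euclidean_product_topology[symmetric] Times_Int_Times)
  have "continuous_map (prod_topology ?I ?I) X ?H"
  proof (rule continuous_map_cases_le)
    show "continuous_map (prod_topology ?I ?I) euclideanreal snd"
      unfolding I2 by (auto intro: continuous_intros)
    have "continuous_map (subtopology (prod_topology ?I ?I) {x \<in> topspace (prod_topology ?I ?I). snd x \<le> 1/2})
        (prod_topology ?I ?I) (\<lambda>y. (fst y, 2 * snd y))"
      unfolding I2 subtopology_subtopology
      by (auto simp: continuous_map_in_subtopology intro!: continuous_intros)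
    from continuous_map_compose[OF this h(1)]
    show "continuous_map (subtopology (prod_topology ?I ?I) {x \<in> topspace (prod_topology ?I ?I). snd x \<le> 1/2})
        X (\<lambda>y. h (fst y, 2 * snd y))" by (simp add: o_def)
    have "continuous_map (subtopology (prod_topology ?I ?I) {x \<in> topspace (prod_topology ?I ?I). 1/2 \<le> snd x})
        (prod_topology ?I ?I) (\<lambda>y. (fst y, 2 * snd y - 1))"
      unfolding I2 subtopology_subtopology
      by (auto simp: continuous_map_in_subtopology intro!: continuous_intros)
    from continuous_map_compose[OF this k(1)]
    show "continuous_map (subtopology (prod_topology ?I ?I) {x \<in> topspace (prod_topology ?I ?I). 1/2 \<le> snd x})
        X (\<lambda>y. k (fst y, 2 * snd y - 1))" by (simp add: o_def)
    show "h (fst y, 2 * snd y) = k (fst y, 2 * snd y - 1)"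
      if "y \<in> topspace (prod_topology ?I ?I)" "snd y = 1/2" for y
    proof -
      have y: "2 * snd y = 1" "fst y \<in> {0..1}"
        using that by (auto simp: mem_Times_iff)
      show ?thesis
        unfolding y(1) using h(4)[OF y(2)] k(4)[OF y(2)] assms(3) by simp
    qed
  qed auto
  then show ?thesis
    unfolding path_homotopic_def homotopic_with_def
    by (intro exI[of _ ?H]) (auto simp: path_join_def h k)
qed

lemma path_reverse_cong:
  assumes "path_homotopic X c d"
  shows "path_homotopic X (path_reverse c) (path_reverse d)"
proof -
  have "homotopic_with (\<lambda>e. e 0 = c 1 \<and> e 1 = c 0) (top_of_set {0..1}) X (c \<circ> (\<lambda>t. 1 - t)) (d \<circ> (\<lambda>t. 1 - t))"
    by (rule homotopic_with_compose_continuous_map_right[OF assms[unfolded path_homotopic_def]])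
       (auto simp: continuous_map_in_subtopology intro!: continuous_intros)
  then show ?thesis
    by (simp add: path_homotopic_def path_reverse_def o_def)
qed

lemma path_join_assoc:
  assumes "pathin X c" "pathin X d" "pathin X e" "c 1 = d 0" "d 1 = e 0"
  shows "path_homotopic X (path_join (path_join c d) e) (path_join c (path_join d e))"
proof -
  let ?k = "\<lambda>t. if t \<le> 1 then c t else if t \<le> 2 then d (t - 1) else e (t - 2)"
  let ?r = "\<lambda>t::real. if t \<le> 1/2 then 4 * t else 2 * t + 1"
  let ?s = "\<lambda>t::real. if t \<le> 1/2 then 2 * t else 4 * t - 1"
  have k: "continuous_map (top_of_set {0..3}) X ?k"
    by (intro continuous_map_interval_glue[where b = 1] continuous_map_interval_glue[where b = 2])
       (use assms in \<open>auto intro!: continuous_map_affine_reparam continuous_intros simp: pathin_def[symmetric]\<close>)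
  have "continuous_on {0..1} ?r" "continuous_on {0..1} ?s"
    by (rule continuous_on_cases_le; auto intro!: continuous_intros)+
  then have "path_homotopic X (?k \<circ> ?r) (?k \<circ> ?s)"
    by (intro path_homotopic_convex[OF _ k]) auto
  moreover have "?k \<circ> ?r = path_join (path_join c d) e"
    by (auto simp: path_join_def fun_eq_iff assms field_simps)
  moreover have "?k \<circ> ?s = path_join c (path_join d e)"
    by (auto simp: path_join_def fun_eq_iff assms field_simps)
  ultimately show ?thesis
    by simp
qed

lemma path_join_const_left:
  assumes "pathin X c" "c 0 = x"
  shows "path_homotopic X (path_join (\<lambda>_. x) c) c"
proof -
  have "path_homotopic X (c \<circ> (\<lambda>t. if t \<le> 1/2 then 0 else 2 * t - 1)) (c \<circ> (\<lambda>t. t))"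
    by (rule path_homotopic_convex[OF _ assms(1)[unfolded pathin_def]])
       (auto intro!: continuous_on_cases_le continuous_intros)
  moreover have "c \<circ> (\<lambda>t. if t \<le> 1/2 then 0 else 2 * t - 1) = path_join (\<lambda>_. x) c"
    by (auto simp: path_join_def assms)
  ultimately show ?thesis
    by (simp add: o_def)
qed

lemma path_join_const_right:
  assumes "pathin X c" "c 1 = x"
  shows "path_homotopic X (path_join c (\<lambda>_. x)) c"
proof -
  have "path_homotopic X (c \<circ> (\<lambda>t. if t \<le> 1/2 then 2 * t else 1)) (c \<circ> (\<lambda>t. t))"
    by (rule path_homotopic_convex[OF _ assms(1)[unfolded pathin_def]])
       (auto intro!: continuous_on_cases_le continuous_intros)
  moreover have "c \<circ> (\<lambda>t. if t \<le> 1/2 then 2 * t else 1) = path_join c (\<lambda>_. x)"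
    by (auto simp: path_join_def assms)
  ultimately show ?thesis
    by (simp add: o_def)
qed

lemma path_join_reverse_right:
  assumes "pathin X c"
  shows "path_homotopic X (path_join c (path_reverse c)) (\<lambda>_. c 0)"
proof -
  have "path_homotopic X (c \<circ> (\<lambda>t. if t \<le> 1/2 then 2 * t else 2 - 2 * t)) (c \<circ> (\<lambda>t. 0))"
    by (rule path_homotopic_convex[OF _ assms(1)[unfolded pathin_def]])
       (auto intro!: continuous_on_cases_le continuous_intros)
  moreover have "c \<circ> (\<lambda>t. if t \<le> 1/2 then 2 * t else 2 - 2 * t) = path_join c (path_reverse c)"
    by (auto simp: path_join_def path_reverse_def fun_eq_iff algebra_simps)
  ultimately show ?thesis
    by (simp add: o_def)
qed

lemma path_join_reverse_left:
  assumes "pathin X c"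
  shows "path_homotopic X (path_join (path_reverse c) c) (\<lambda>_. c 1)"
  using path_join_reverse_right[OF pathin_path_reverse[OF assms]] by simp

section \<open>The fundamental group\<close>

lemma paths_between_join:
  "c \<in> paths_between X x y \<Longrightarrow> d \<in> paths_between X y z \<Longrightarrow> path_join c d \<in> paths_between X x z"
  by (auto simp: paths_between_def intro: pathin_path_join)

lemma paths_between_reverse:
  "c \<in> paths_between X x y \<Longrightarrow> path_reverse c \<in> paths_between X y x"
  by (auto simp: paths_between_def intro: pathin_path_reverse)

lemma paths_between_const: "x \<in> topspace X \<Longrightarrow> (\<lambda>_. x) \<in> paths_between X x x"
  by (auto simp: paths_between_def)

lemma paths_between_compose:
  "c \<in> paths_between X x y \<Longrightarrow> continuous_map X Y f \<Longrightarrow> f \<circ> c \<in> paths_between Y (f x) (f y)"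
  unfolding paths_between_def by (auto intro: pathin_compose)

lemma path_class_cong: "path_homotopic X c d \<Longrightarrow> path_class X c = path_class X d"
  using path_class_eq_iff path_homotopic_pathin by blast

lemma path_class_in_carrier:
  "c \<in> paths_between X x0 x0 \<Longrightarrow> path_class X c \<in> carrier (fundamental_group X x0)"
  by (simp add: fundamental_group_def)

lemma path_class_self: "pathin X c \<Longrightarrow> c \<in> path_class X c"
  by (simp add: path_class_def path_homotopic_refl)

lemma in_path_class_iff: "d \<in> path_class X c \<longleftrightarrow> path_homotopic X c d"
  by (simp add: path_class_def)

lemma fundamental_group_carrierE:
  assumes "C \<in> carrier (fundamental_group X x0)"
  obtains c where "c \<in> paths_between X x0 x0" "C = path_class X c"
  using assms by (auto simp: fundamental_group_def)

lemma fundamental_group_mult: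
  assumes "c \<in> paths_between X x0 x0" "d \<in> paths_between X x0 x0"
  shows "path_class X c \<otimes>\<^bsub>fundamental_group X x0\<^esub> path_class X d = path_class X (path_join c d)"
proof -
  have *: "path_class X (path_join c' d') = path_class X (path_join c d)"
    if "c' \<in> path_class X c" "d' \<in> path_class X d" for c' d'
    using that assms
    by (intro path_class_cong path_homotopic_sym[OF path_join_cong])
       (auto simp: in_path_class_iff paths_between_def)
  have "c \<in> path_class X c" "d \<in> path_class X d"
    using assms by (auto simp: paths_between_def intro: path_class_self)
  then have ne: "path_class X c \<noteq> {}" "path_class X d \<noteq> {}"
    by (metis empty_iff)+
  have inner: "(\<Union>d'\<in>path_class X d. path_class X (path_join c' d')) = path_class X (path_join c d)"
    if "c' \<in> path_class X c" for c'
    by (rule SUP_eq_const[OF ne(2) *[OF that]])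
  have "(\<Union>c'\<in>path_class X c. \<Union>d'\<in>path_class X d. path_class X (path_join c' d'))
      = path_class X (path_join c d)"
    by (rule SUP_eq_const[OF ne(1) inner])
  then show ?thesis
    by (simp add: fundamental_group_def)
qed

lemma fundamental_group_one: "\<one>\<^bsub>fundamental_group X x0\<^esub> = path_class X (\<lambda>_. x0)"
  by (simp add: fundamental_group_def)

lemma group_fundamental_group:
  assumes x0: "x0 \<in> topspace X"
  shows "group (fundamental_group X x0)"
proof (rule groupI)
  fix C D assume "C \<in> carrier (fundamental_group X x0)" "D \<in> carrier (fundamental_group X x0)"
  then show "C \<otimes>\<^bsub>fundamental_group X x0\<^esub> D \<in> carrier (fundamental_group X x0)"
    by (elim fundamental_group_carrierE)
       (auto simp: fundamental_group_mult intro!: path_class_in_carrier paths_between_join)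
next
  show "\<one>\<^bsub>fundamental_group X x0\<^esub> \<in> carrier (fundamental_group X x0)"
    by (simp add: fundamental_group_one path_class_in_carrier paths_between_const x0)
next
  fix C D E assume "C \<in> carrier (fundamental_group X x0)" "D \<in> carrier (fundamental_group X x0)"
    "E \<in> carrier (fundamental_group X x0)"
  then obtain c d e where cde: "c \<in> paths_between X x0 x0" "C = path_class X c"
    "d \<in> paths_between X x0 x0" "D = path_class X d"
    "e \<in> paths_between X x0 x0" "E = path_class X e"
    by (elim fundamental_group_carrierE) blast
  then show "C \<otimes>\<^bsub>fundamental_group X x0\<^esub> D \<otimes>\<^bsub>fundamental_group X x0\<^esub> E
      = C \<otimes>\<^bsub>fundamental_group X x0\<^esub> (D \<otimes>\<^bsub>fundamental_group X x0\<^esub> E)"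
    by (simp add: fundamental_group_mult paths_between_join)
       (rule path_class_cong, rule path_join_assoc, auto simp: paths_between_def)
next
  fix C assume "C \<in> carrier (fundamental_group X x0)"
  then obtain c where c: "c \<in> paths_between X x0 x0" "C = path_class X c"
    by (elim fundamental_group_carrierE) blast
  then show "\<one>\<^bsub>fundamental_group X x0\<^esub> \<otimes>\<^bsub>fundamental_group X x0\<^esub> C = C"
    by (simp add: fundamental_group_mult fundamental_group_one paths_between_const x0)
       (rule path_class_cong, rule path_join_const_left, auto simp: paths_between_def)
  have "path_class X (path_reverse c) \<otimes>\<^bsub>fundamental_group X x0\<^esub> C = \<one>\<^bsub>fundamental_group X x0\<^esub>"
    using c path_class_cong[OF path_join_reverse_left[of X c]]
    by (simp add: fundamental_group_mult fundamental_group_one paths_between_reverse)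
       (simp add: paths_between_def)
  then show "\<exists>D\<in>carrier (fundamental_group X x0).
      D \<otimes>\<^bsub>fundamental_group X x0\<^esub> C = \<one>\<^bsub>fundamental_group X x0\<^esub>"
    using c by (intro bexI[of _ "path_class X (path_reverse c)"])
      (auto intro: path_class_in_carrier paths_between_reverse)
qed

section \<open>Words, presentations and homomorphisms\<close>

lemma eval_word_Nil [simp]: "eval_word G x [] = \<one>\<^bsub>G\<^esub>"
  by (simp add: eval_word_def)

lemma eval_word_Cons [simp]:
  "eval_word G x (l # w) =
     (if snd l then x (fst l) else inv\<^bsub>G\<^esub> (x (fst l))) \<otimes>\<^bsub>G\<^esub> eval_word G x w"
  by (simp add: eval_word_def case_prod_unfold)

context group
begin

lemma eval_word_closed [simp]: "x ` fst ` set w \<subseteq> carrier G \<Longrightarrow> eval_word G x w \<in> carrier G"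
  by (induction w) auto

lemma eval_word_append:
  "x ` fst ` set v \<subseteq> carrier G \<Longrightarrow> x ` fst ` set w \<subseteq> carrier G \<Longrightarrow>
     eval_word G x (v @ w) = eval_word G x v \<otimes> eval_word G x w"
  by (induction v) (auto simp: m_assoc)

lemma eval_word_push:
  "x ` fst ` set (l # w) \<subseteq> carrier G \<Longrightarrow> eval_word G x (push l w) = eval_word G x (l # w)"
  by (cases w) (auto simp: inv_letter_def m_assoc[symmetric])

lemma eval_word_free_reduce:
  "x ` fst ` set w \<subseteq> carrier G \<Longrightarrow> eval_word G x (free_reduce w) = eval_word G x w"
proof (induction w)
  case (Cons l w)
  have "x ` fst ` set (l # free_reduce w) \<subseteq> carrier G"
    using Cons.prems set_free_reduce[of w] by fastforce
  with Cons show ?case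
    by (simp add: free_reduce_def[of "l # w"] free_reduce_def[of w, symmetric] eval_word_push)
qed (simp add: free_reduce_def)

lemma eval_word_hom:
  assumes "x ` I \<subseteq> carrier G"
  shows "eval_word G x \<in> hom (free_group I) G"
proof (rule homI)
  fix v w assume vw: "v \<in> carrier (free_group I)" "w \<in> carrier (free_group I)"
  then have "fst ` set v \<subseteq> I" "fst ` set w \<subseteq> I"
    by (auto simp: free_group_def)
  then have *: "x ` fst ` set v \<subseteq> carrier G" "x ` fst ` set w \<subseteq> carrier G"
    using assms by (meson image_mono subset_trans)+
  then show "eval_word G x v \<in> carrier G"
    by simp
  have "x ` fst ` set (v @ w) \<subseteq> carrier G"
    using * by (simp only: set_append image_Un Un_subset_iff)
  with * show "eval_word G x (v \<otimes>\<^bsub>free_group I\<^esub> w) = eval_word G x v \<otimes> eval_word G x w"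
    by (simp add: free_group_def eval_word_free_reduce eval_word_append)
qed

end

lemma hom_eval_word:
  assumes "group G" "group H" "h \<in> hom G H" "x ` fst ` set w \<subseteq> carrier G"
  shows "h (eval_word G x w) = eval_word H (h \<circ> x) w"
proof -
  interpret group_hom G H h
    using assms by (simp add: group_hom_def group_hom_axioms_def)
  show ?thesis
    using assms(4) by (induction w) auto
qed

lemma eval_word_cong:
  "(\<And>i. i \<in> fst ` set w \<Longrightarrow> x i = y i) \<Longrightarrow> eval_word G x w = eval_word G y w"
  by (induction w) auto

lemma presentation_generators_closed:
  "has_presentation G I x R \<Longrightarrow> i \<in> I \<Longrightarrow> x i \<in> carrier G"
  by (auto simp: has_presentation_def)

lemma presentation_surj:
  assumes "has_presentation G I x R" "c \<in> carrier G"
  obtains w where "w \<in> carrier (free_group I)" "c = eval_word G x w"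
proof -
  have "c \<in> eval_word G x ` carrier (free_group I)"
    using assms by (simp add: has_presentation_def epi_def)
  then show thesis
    using that by blast
qed

lemma presentation_relator:
  assumes "has_presentation G I x R" "r \<in> R"
  shows "r \<in> carrier (free_group I)" "eval_word G x r = \<one>\<^bsub>G\<^esub>"
proof -
  have ker: "kernel (free_group I) G (eval_word G x) = normal_closure (free_group I) R"
    using assms by (simp add: has_presentation_def)
  \<comment> \<open>Were \<^term>\<open>R\<close> not contained in the free group, no normal subgroup would contain it and its normal
    closure would be the universe, which also contains words that are not reduced.\<close>
  have "R \<subseteq> carrier (free_group I)"
  proof (rule ccontr)
    assume "\<not> R \<subseteq> carrier (free_group I)"
    then have "{N. N \<lhd> free_group I \<and> R \<subseteq> N} = {}"
      using normal_imp_subgroup subgroup.subset by blast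
    then have "normal_closure (free_group I) R = UNIV"
      by (simp only: normal_closure_def Inter_empty)
    with ker have "[(i, True), (i, False)] \<in> carrier (free_group I)" for i
      by (auto simp: kernel_def)
    then show False
      by (auto simp: free_group_def free_reduce_def inv_letter_def)
  qed
  then show "r \<in> carrier (free_group I)"
    using assms(2) by blast
  have "r \<in> normal_closure (free_group I) R"
    using assms(2) by (auto simp: normal_closure_def)
  then show "eval_word G x r = \<one>\<^bsub>G\<^esub>"
    using ker by (auto simp: kernel_def)
qed

lemma presentation_hom_unique:
  assumes "has_presentation G I x R" "group G" "group H" "h \<in> hom G H" "k \<in> hom G H"
    "\<And>i. i \<in> I \<Longrightarrow> h (x i) = k (x i)" "c \<in> carrier G"
  shows "h c = k c"
proof -
  obtain w where w: "w \<in> carrier (free_group I)" "c = eval_word G x w"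
    using presentation_surj[OF assms(1,7)] .
  have I: "fst ` set w \<subseteq> I"
    using w(1) by (simp add: free_group_def)
  have "x ` fst ` set w \<subseteq> carrier G"
    using I assms(1) by (auto simp: has_presentation_def)
  then show ?thesis
    using w(2) I assms by (simp add: hom_eval_word) (rule eval_word_cong, auto)
qed

text \<open>The kernel of the evaluation in \<^term>\<open>H\<close> is a normal subgroup of the free group, so it contains the
  normal closure of the relators, which is the kernel of the evaluation in \<^term>\<open>G\<close>.\<close>

lemma presentation_hom:
  assumes pres: "has_presentation G I x R" and G: "group G" and H: "group H"
    and y: "y ` I \<subseteq> carrier H" and rel: "\<And>r. r \<in> R \<Longrightarrow> eval_word H y r = \<one>\<^bsub>H\<^esub>"
  shows "\<exists>h\<in>hom G H. \<forall>i\<in>I. h (x i) = y i"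
proof -
  let ?F = "free_group I"
  interpret F: group ?F by (rule group_free_group)
  interpret G: group_hom ?F G "eval_word G x"
    using pres G group.eval_word_hom[OF G, of x I]
    by (simp add: group_hom_def group_hom_axioms_def has_presentation_def F.is_group)
  interpret H: group_hom ?F H "eval_word H y"
    using H y group.eval_word_hom[OF H, of y I]
    by (simp add: group_hom_def group_hom_axioms_def F.is_group)
  have "normal_closure ?F R \<subseteq> kernel ?F H (eval_word H y)"
    unfolding normal_closure_def
    using H.normal_kernel rel presentation_relator(1)[OF pres]
    by (intro Inter_lower) (auto simp: kernel_def)
  then have ker: "kernel ?F G (eval_word G x) \<subseteq> kernel ?F H (eval_word H y)"
    using pres by (simp add: has_presentation_def)
  have eq: "eval_word H y v = eval_word H y w"
    if vw: "v \<in> carrier ?F" "w \<in> carrier ?F" "eval_word G x v = eval_word G x w" for v w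
  proof -
    have "v \<otimes>\<^bsub>?F\<^esub> inv\<^bsub>?F\<^esub> w \<in> kernel ?F G (eval_word G x)"
      using vw by (simp add: kernel_def)
    with ker have "v \<otimes>\<^bsub>?F\<^esub> inv\<^bsub>?F\<^esub> w \<in> kernel ?F H (eval_word H y)"
      by blast
    then have "eval_word H y v \<otimes>\<^bsub>H\<^esub> inv\<^bsub>H\<^esub> (eval_word H y w) = \<one>\<^bsub>H\<^esub>"
      using vw by (simp add: kernel_def)
    then show ?thesis
      using vw by (metis H.H.inv_equality H.H.inv_inv H.hom_closed H.H.inv_closed)
  qed
  define s where "s c = (SOME w. w \<in> carrier ?F \<and> eval_word G x w = c)" for c
  have s: "s c \<in> carrier ?F" "eval_word G x (s c) = c" if "c \<in> carrier G" for c
    using presentation_surj[OF pres that] someI_ex[of "\<lambda>w. w \<in> carrier ?F \<and> eval_word G x w = c"]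
    unfolding s_def by metis+
  show ?thesis
  proof (intro bexI[of _ "\<lambda>c. eval_word H y (s c)"] ballI)
    show "(\<lambda>c. eval_word H y (s c)) \<in> hom G H"
    proof (rule homI)
      fix c d assume cd: "c \<in> carrier G" "d \<in> carrier G"
      then show "eval_word H y (s c) \<in> carrier H"
        by (simp add: s)
      have "eval_word H y (s (c \<otimes>\<^bsub>G\<^esub> d)) = eval_word H y (s c \<otimes>\<^bsub>?F\<^esub> s d)"
        using cd by (intro eq) (simp_all add: s)
      then show "eval_word H y (s (c \<otimes>\<^bsub>G\<^esub> d)) = eval_word H y (s c) \<otimes>\<^bsub>H\<^esub> eval_word H y (s d)"
        using cd by (simp add: s)
    qed
    show "eval_word H y (s (x i)) = y i" if i: "i \<in> I" for i
    proof -
      have xi: "x i \<in> carrier G" and yi: "y i \<in> carrier H"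
        using pres y i by (auto simp: has_presentation_def)
      have "[(i, True)] \<in> carrier ?F"
        using i by (simp add: free_group_def free_reduce_def)
      moreover have "eval_word G x [(i, True)] = x i" "eval_word H y [(i, True)] = y i"
        using xi yi by simp_all
      ultimately show ?thesis
        using eq[of "s (x i)" "[(i, True)]"] s[OF xi] by simp
    qed
  qed
qed

section \<open>Linear algebra\<close>

text \<open>A square matrix with a right inverse has trivial kernel.  The size is not fixed by a type, so
  the columns are encoded as polynomials, and Steinitz' exchange lemma is applied to those.\<close>

lemma right_invertible_square_kernel:
  fixes M P :: "nat \<Rightarrow> nat \<Rightarrow> real"
  assumes MP: "\<And>k j. k < g \<Longrightarrow> j < g \<Longrightarrow> (\<Sum>i<g. M k i * P i j) = (if k = j then 1 else 0)"
    and x: "\<And>k. k < g \<Longrightarrow> (\<Sum>i<g. M k i * x i) = 0" and i: "i < g"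
  shows "x i = 0"
proof (rule ccontr)
  assume xi: "x i \<noteq> 0"
  interpret V: vector_space "Polynomial.smult :: real \<Rightarrow> real poly \<Rightarrow> real poly"
    by unfold_locales (auto simp: smult_add_left smult_add_right)
  define col where "col j = (\<Sum>k<g. Polynomial.monom (M k j) k)" for j
  let ?T = "col ` ({..<g} - {i})"
  let ?E = "(\<lambda>j. Polynomial.monom (1::real) j) ` {..<g}"
  have comb: "(\<Sum>j<g. Polynomial.smult (y j) (col j)) = (\<Sum>k<g. Polynomial.monom (\<Sum>j<g. M k j * y j) k)" for y
  proof -
    have "(\<Sum>j<g. Polynomial.smult (y j) (col j)) = (\<Sum>j<g. \<Sum>k<g. Polynomial.monom (M k j * y j) k)"
      unfolding col_def by (simp add: V.scale_sum_right smult_monom mult.commute)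
    also have "\<dots> = (\<Sum>k<g. \<Sum>j<g. Polynomial.monom (M k j * y j) k)"
      by (rule sum.swap)
    also have "\<dots> = (\<Sum>k<g. Polynomial.monom (\<Sum>j<g. M k j * y j) k)"
      by (simp add: monom_sum)
    finally show ?thesis .
  qed
  have "Polynomial.smult (x i) (col i) + (\<Sum>j\<in>{..<g} - {i}. Polynomial.smult (x j) (col j)) = 0"
    using comb[of x] x i by (simp add: sum.remove[of "{..<g}" i])
  then have "Polynomial.smult (x i) (col i) = - (\<Sum>j\<in>{..<g} - {i}. Polynomial.smult (x j) (col j))"
    by (simp add: eq_neg_iff_add_eq_0)
  moreover have "(\<Sum>j\<in>{..<g} - {i}. Polynomial.smult (x j) (col j)) \<in> V.span ?T"
    by (intro V.span_sum V.span_scale V.span_base) auto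
  ultimately have "Polynomial.smult (x i) (col i) \<in> V.span ?T"
    by (simp add: V.span_neg)
  then have "Polynomial.smult (inverse (x i)) (Polynomial.smult (x i) (col i)) \<in> V.span ?T"
    by (rule V.span_scale)
  then have "col i \<in> V.span ?T"
    using xi by simp
  then have col: "col j \<in> V.span ?T" if "j < g" for j
    using that by (cases "j = i") (auto intro: V.span_base)
  have "Polynomial.monom 1 j = (\<Sum>l<g. Polynomial.smult (P l j) (col l))" if "j < g" for j
    unfolding comb using MP that by (simp add: if_distrib[of "\<lambda>c. Polynomial.monom c _"] sum.delta cong: if_cong)
  then have "?E \<subseteq> V.span ?T"
    using col by (auto intro!: V.span_sum V.span_scale)
  moreover have inj: "inj_on (\<lambda>j. Polynomial.monom (1::real) j) {..<g}"
    by (auto simp: inj_on_def monom_eq_iff')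
  have "V.independent ?E"
  proof (rule V.independent_if_scalars_zero)
    fix f v assume f: "(\<Sum>v\<in>?E. Polynomial.smult (f v) v) = 0" and v: "v \<in> ?E"
    then obtain j where j: "j < g" "v = Polynomial.monom 1 j" by auto
    have "0 = Polynomial.coeff (\<Sum>v\<in>?E. Polynomial.smult (f v) v) j"
      by (simp add: f)
    also have "\<dots> = (\<Sum>l<g. if l = j then f (Polynomial.monom 1 l) else 0)"
      by (simp add: sum.reindex[OF inj] coeff_sum if_distrib cong: if_cong)
    also have "\<dots> = f v"
      using j by (simp add: sum.delta)
    finally show "f v = 0" by simp
  qed simp
  ultimately have "card ?E \<le> card ?T"
    using V.independent_span_bound[of ?T ?E] by simp
  also have "\<dots> \<le> card ({..<g} - {i})"
    by (rule card_image_le) simp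
  also have "\<dots> < g"
    using i by simp
  finally show False
    using card_image[OF inj] by simp
qed

text \<open>Complete the primitive covector that annihilates \<open>(x, y)\<close> to a basis by a Bezout identity.\<close>

lemma unimodular_annihilator:
  fixes x y :: int
  obtains p q r s where "p * s - q * r = 1" "p * x + q * y = 0"
proof (cases "x = 0 \<and> y = 0")
  case True
  then show thesis
    by (intro that[of 1 1 0 0]) auto
next
  case False
  then have d: "gcd x y \<noteq> 0" by simp
  obtain r s where rs: "r * x + s * y = gcd x y"
    using bezout_int by blast
  have dvd: "x = gcd x y * (x div gcd x y)" "y = gcd x y * (y div gcd x y)"
    by simp_all
  have "gcd x y * ((y div gcd x y) * s - (- (x div gcd x y)) * r) = gcd x y * 1"
    using rs dvd by (simp add: algebra_simps)
  then have "(y div gcd x y) * s - (- (x div gcd x y)) * r = 1"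
    using d by (metis mult_cancel_left)
  moreover have "(y div gcd x y) * x + (- (x div gcd x y)) * y = 0"
    using dvd by (metis (no_types, lifting) add.right_inverse mult.assoc mult.commute mult_minus_left)
  ultimately show thesis
    by (rule that)
qed

section \<open>The intersection pairing of a surface group\<close>

definition real_hom :: "('a, 'm) monoid_scheme \<Rightarrow> ('a \<Rightarrow> real) \<Rightarrow> bool" where
  "real_hom G u \<longleftrightarrow> (\<forall>c\<in>carrier G. \<forall>d\<in>carrier G. u (c \<otimes>\<^bsub>G\<^esub> d) = u c + u d)"

definition bihom :: "('a, 'm) monoid_scheme \<Rightarrow> ('a \<Rightarrow> 'a \<Rightarrow> real) \<Rightarrow> bool" where
  "bihom G \<beta> \<longleftrightarrow> (\<forall>c\<in>carrier G. real_hom G (\<beta> c)) \<and> (\<forall>d\<in>carrier G. real_hom G (\<lambda>c. \<beta> c d))"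

text \<open>A primitive of \<^term>\<open>\<beta>\<close>: in the language of group cohomology, the 2-cocycle \<^term>\<open>\<beta>\<close> is the
  coboundary of \<open>-q\<close>.\<close>

definition primitive :: "('a, 'm) monoid_scheme \<Rightarrow> ('a \<Rightarrow> 'a \<Rightarrow> real) \<Rightarrow> ('a \<Rightarrow> real) \<Rightarrow> bool" where
  "primitive G \<beta> q \<longleftrightarrow>
     (\<forall>c\<in>carrier G. \<forall>d\<in>carrier G. q (c \<otimes>\<^bsub>G\<^esub> d) = q c + q d + \<beta> c d)"

text \<open>The value of a 2-cocycle on the fundamental cycle of the surface.  On the cup product of two
  classes it is their intersection number.\<close>

definition surface_sum :: "nat \<Rightarrow> (nat \<Rightarrow> 'a) \<Rightarrow> (nat \<Rightarrow> 'a) \<Rightarrow> ('a \<Rightarrow> 'a \<Rightarrow> real) \<Rightarrow> real" where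
  "surface_sum g a b \<beta> = (\<Sum>i<g. \<beta> (a i) (b i) - \<beta> (b i) (a i))"

abbreviation pairing :: "nat \<Rightarrow> (nat \<Rightarrow> 'a) \<Rightarrow> (nat \<Rightarrow> 'a) \<Rightarrow> ('a \<Rightarrow> real) \<Rightarrow> ('a \<Rightarrow> real) \<Rightarrow> real" where
  "pairing g a b u v \<equiv> surface_sum g a b (\<lambda>c d. u c * v d)"

lemma real_homD: "real_hom G u \<Longrightarrow> c \<in> carrier G \<Longrightarrow> d \<in> carrier G \<Longrightarrow> u (c \<otimes>\<^bsub>G\<^esub> d) = u c + u d"
  by (simp add: real_hom_def)

lemma real_hom_compose: "real_hom H u \<Longrightarrow> h \<in> hom G H \<Longrightarrow> real_hom G (\<lambda>c. u (h c))"
  by (simp add: real_hom_def hom_def Pi_iff)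

lemma real_hom_add: "real_hom G u \<Longrightarrow> real_hom G v \<Longrightarrow> real_hom G (\<lambda>c. u c + v c)"
  by (simp add: real_hom_def)

lemma real_hom_diff: "real_hom G u \<Longrightarrow> real_hom G v \<Longrightarrow> real_hom G (\<lambda>c. u c - v c)"
  by (simp add: real_hom_def)

lemma real_hom_scale: "real_hom G u \<Longrightarrow> real_hom G (\<lambda>c. r * u c)"
  by (simp add: real_hom_def algebra_simps)

lemma real_hom_sum: "(\<And>i. i \<in> I \<Longrightarrow> real_hom G (u i)) \<Longrightarrow> real_hom G (\<lambda>c. \<Sum>i\<in>I. u i c)"
  by (simp add: real_hom_def sum.distrib)

lemma bihom_product: "real_hom G u \<Longrightarrow> real_hom G v \<Longrightarrow> bihom G (\<lambda>c d. u c * v d)"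
  by (simp add: bihom_def real_hom_def algebra_simps)

lemma bihom_diff: "bihom G \<beta> \<Longrightarrow> bihom G \<beta>' \<Longrightarrow> bihom G (\<lambda>c d. \<beta> c d - \<beta>' c d)"
  by (simp add: bihom_def real_hom_def)

lemma bihom_scale: "bihom G \<beta> \<Longrightarrow> bihom G (\<lambda>c d. r * \<beta> c d)"
  by (simp add: bihom_def real_hom_def algebra_simps)

lemma surface_sum_diff:
  "surface_sum g a b (\<lambda>c d. \<beta> c d - \<beta>' c d) = surface_sum g a b \<beta> - surface_sum g a b \<beta>'"
  by (simp add: surface_sum_def algebra_simps sum.distrib sum_subtractf)

lemma surface_sum_scale: "surface_sum g a b (\<lambda>c d. r * \<beta> c d) = r * surface_sum g a b \<beta>"
  by (simp add: surface_sum_def sum_distrib_left algebra_simps)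

lemma pairing_add_left:
  "pairing g a b (\<lambda>c. u c + u' c) v = pairing g a b u v + pairing g a b u' v"
  by (simp add: surface_sum_def algebra_simps sum.distrib sum_subtractf)

lemma pairing_scale_left: "pairing g a b (\<lambda>c. r * u c) v = r * pairing g a b u v"
  by (simp add: surface_sum_def sum_distrib_left algebra_simps)

lemma pairing_add_right:
  "pairing g a b u (\<lambda>c. v c + v' c) = pairing g a b u v + pairing g a b u v'"
  by (simp add: surface_sum_def algebra_simps sum.distrib sum_subtractf)

lemma pairing_diff_right:
  "pairing g a b u (\<lambda>c. v c - v' c) = pairing g a b u v - pairing g a b u v'"
  by (simp add: surface_sum_def algebra_simps sum.distrib sum_subtractf)

lemma pairing_scale_right: "pairing g a b u (\<lambda>c. r * v c) = r * pairing g a b u v"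
  by (simp add: surface_sum_def sum_distrib_left algebra_simps)

lemma pairing_self: "pairing g a b u u = 0"
  by (simp add: surface_sum_def)

lemma pairing_swap: "pairing g a b v u = - pairing g a b u v"
  by (simp add: surface_sum_def sum_negf[symmetric] algebra_simps)

lemma pairing_cong:
  "(\<And>i. i < g \<Longrightarrow> u (a i) = u' (a i) \<and> u (b i) = u' (b i) \<and> v (a i) = v' (a i) \<and> v (b i) = v' (b i)) \<Longrightarrow>
     pairing g a b u v = pairing g a b u' v'"
  by (simp add: surface_sum_def)

context group
begin

lemma real_hom_one: "real_hom G u \<Longrightarrow> u \<one> = 0"
  by (metis add_cancel_right_right one_closed r_one real_hom_def)

lemma real_hom_inv: "real_hom G u \<Longrightarrow> c \<in> carrier G \<Longrightarrow> u (inv c) = - u c"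
  by (metis add.commute add_eq_0_iff inv_closed r_inv real_hom_def real_hom_one)

lemma real_hom_conj:
  "real_hom G u \<Longrightarrow> c \<in> carrier G \<Longrightarrow> d \<in> carrier G \<Longrightarrow> u (d \<otimes> c \<otimes> inv d) = u c"
  by (simp add: real_homD real_hom_inv)

text \<open>A primitive turns the group operation into that of a central extension by \<open>\<real>\<close>, in which a
  commutator evaluates to the antisymmetrisation of \<^term>\<open>\<beta>\<close>.  Hence its value on the
  surface relator is determined by \<^term>\<open>\<beta>\<close> alone.\<close>

lemma primitive_surface_relator:
  assumes \<beta>: "bihom G \<beta>" and q: "primitive G \<beta> q"
    and ab: "\<And>i. i < g \<Longrightarrow> a i \<in> carrier G \<and> b i \<in> carrier G"
  shows "q (eval_word G (case_sum a b) (surface_relator g)) = surface_sum g a b \<beta>"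
proof -
  have L: "real_hom G (\<beta> c)" and R: "real_hom G (\<lambda>d. \<beta> d c)" if "c \<in> carrier G" for c
    using \<beta> that by (auto simp: bihom_def)
  have qm: "q (c \<otimes> d) = q c + q d + \<beta> c d" if "c \<in> carrier G" "d \<in> carrier G" for c d
    using q that by (simp add: primitive_def)
  have q1: "q \<one> = 0"
    using qm[of \<one> \<one>] real_hom_one[OF L[of \<one>]] by simp
  have qi: "q (inv c) = - q c + \<beta> c c" if "c \<in> carrier G" for c
    using qm[of c "inv c"] that q1 real_hom_inv[OF L, of c c] by simp
  let ?w = "\<lambda>i. [(Inl i, True), (Inr i, True), (Inl i, False), (Inr i, False)] :: (nat + nat) word"
  have "q (eval_word G (case_sum a b) (concat (map ?w [0..<n]))) = (\<Sum>i<n. \<beta> (a i) (b i) - \<beta> (b i) (a i))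
      \<and> (\<forall>d\<in>carrier G. \<beta> (eval_word G (case_sum a b) (concat (map ?w [0..<n]))) d = 0)
      \<and> eval_word G (case_sum a b) (concat (map ?w [0..<n])) \<in> carrier G"
    if "n \<le> g" for n
    using that
  proof (induction n)
    case 0
    then show ?case
      using real_hom_one[OF R] by (simp add: q1)
  next
    case (Suc n)
    define P where "P = eval_word G (case_sum a b) (concat (map ?w [0..<n]))"
    have P: "q P = (\<Sum>i<n. \<beta> (a i) (b i) - \<beta> (b i) (a i))" "P \<in> carrier G"
      "\<And>d. d \<in> carrier G \<Longrightarrow> \<beta> P d = 0"
      using Suc by (auto simp: P_def)
    have n: "a n \<in> carrier G" "b n \<in> carrier G"
      using ab Suc.prems by auto
    define K where "K = a n \<otimes> (b n \<otimes> (inv (a n) \<otimes> inv (b n)))"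
    have K: "K \<in> carrier G"
      using n by (simp add: K_def)
    have \<beta>K: "\<beta> K d = 0" if "d \<in> carrier G" for d
      using n that by (simp add: K_def real_homD[OF R] real_hom_inv[OF R])
    have qK: "q K = \<beta> (a n) (b n) - \<beta> (b n) (a n)"
      using n by (simp add: K_def qm qi real_homD[OF L] real_homD[OF R] real_hom_inv[OF R] real_hom_inv[OF L])
    have mem: "case_sum a b ` fst ` set (concat (map ?w [0..<n])) \<subseteq> carrier G"
      using ab Suc.prems by force
    have "eval_word G (case_sum a b) (concat (map ?w [0..<Suc n])) = P \<otimes> K"
      using mem n by (simp add: eval_word_append P_def K_def)
    then show ?case
      using P K \<beta>K by (simp add: qm qK real_homD[OF R])
  qed
  then show ?thesis
    by (simp add: surface_relator_def surface_sum_def)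
qed

end

definition real_group :: "real monoid" where
  "real_group = \<lparr>carrier = UNIV, monoid.mult = (+), one = 0\<rparr>"

lemma group_real_group: "group real_group"
  by (rule groupI) (auto simp: real_group_def intro: exI[of _ "- _"] add.left_inverse)

definition central_extension ::
  "('a, 'm) monoid_scheme \<Rightarrow> ('a \<Rightarrow> 'a \<Rightarrow> real) \<Rightarrow> ('a \<times> real) monoid" where
  "central_extension G \<beta> =
     \<lparr>carrier = carrier G \<times> UNIV,
      monoid.mult = (\<lambda>(c, r) (d, s). (c \<otimes>\<^bsub>G\<^esub> d, r + s + \<beta> c d)),
      one = (\<one>\<^bsub>G\<^esub>, 0)\<rparr>"

lemma (in group) group_central_extension:
  assumes \<beta>: "bihom G \<beta>"
  shows "group (central_extension G \<beta>)"
proof (rule groupI)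
  have L: "real_hom G (\<beta> c)" and R: "real_hom G (\<lambda>d. \<beta> d c)" if "c \<in> carrier G" for c
    using \<beta> that by (auto simp: bihom_def)
  fix x y z
  assume x: "x \<in> carrier (central_extension G \<beta>)"
  show "\<one>\<^bsub>central_extension G \<beta>\<^esub> \<otimes>\<^bsub>central_extension G \<beta>\<^esub> x = x"
    using x real_hom_one[OF R] by (auto simp: central_extension_def)
  show "\<exists>y\<in>carrier (central_extension G \<beta>).
      y \<otimes>\<^bsub>central_extension G \<beta>\<^esub> x = \<one>\<^bsub>central_extension G \<beta>\<^esub>"
    using x by (intro bexI[of _ "(inv (fst x), - snd x - \<beta> (inv (fst x)) (fst x))"])
      (auto simp: central_extension_def)
  assume y: "y \<in> carrier (central_extension G \<beta>)"
  show "x \<otimes>\<^bsub>central_extension G \<beta>\<^esub> y \<in> carrier (central_extension G \<beta>)"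
    using x y by (auto simp: central_extension_def)
  assume z: "z \<in> carrier (central_extension G \<beta>)"
  show "x \<otimes>\<^bsub>central_extension G \<beta>\<^esub> y \<otimes>\<^bsub>central_extension G \<beta>\<^esub> z
      = x \<otimes>\<^bsub>central_extension G \<beta>\<^esub> (y \<otimes>\<^bsub>central_extension G \<beta>\<^esub> z)"
    using x y z by (auto simp: central_extension_def m_assoc real_homD[OF L] real_homD[OF R])
qed (auto simp: central_extension_def)

text \<open>A group with a symplectic set of generators \<open>a\<^sub>i, b\<^sub>i\<close> is the fundamental group of a surface.\<close>

locale surface_group = group G for G :: "('a, 'm) monoid_scheme" (structure) +
  fixes g :: nat and a b :: "nat \<Rightarrow> 'a"
  assumes symplectic: "symplectic_generators G g a b"
begin

lemma pres: "has_presentation G (Inl ` {..<g} \<union> Inr ` {..<g}) (case_sum a b) {surface_relator g}"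
  using symplectic by (simp add: symplectic_generators_def)

lemma a_closed [simp]: "i < g \<Longrightarrow> a i \<in> carrier G"
  using presentation_generators_closed[OF pres, of "Inl i"] by auto

lemma b_closed [simp]: "i < g \<Longrightarrow> b i \<in> carrier G"
  using presentation_generators_closed[OF pres, of "Inr i"] by auto

lemma surface_sum_primitive:
  assumes "bihom G \<beta>" "primitive G \<beta> q"
  shows "surface_sum g a b \<beta> = 0"
proof -
  have "q \<one> = q \<one> + q \<one> + \<beta> \<one> \<one>"
    using assms(2) unfolding primitive_def by (metis one_closed r_one)
  moreover have "\<beta> \<one> \<one> = 0"
    using assms(1) real_hom_one[of "\<beta> \<one>"] by (auto simp: bihom_def)
  ultimately show ?thesis
    using primitive_surface_relator[OF assms, of g a b] presentation_relator(2)[OF pres] by simp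
qed

text \<open>Conversely, if \<^term>\<open>surface_sum g a b \<beta>\<close> vanishes then the surface relator lifts to the
  trivial element of the central extension defined by \<^term>\<open>\<beta>\<close>; so the extension splits, and a
  splitting is the same thing as a primitive.\<close>

lemma primitive_exists:
  assumes \<beta>: "bihom G \<beta>" and 0: "surface_sum g a b \<beta> = 0"
  obtains q where "primitive G \<beta> q"
proof -
  let ?E = "central_extension G \<beta>"
  interpret E: group ?E by (rule group_central_extension[OF \<beta>])
  have fst: "fst \<in> hom ?E G"
    by (auto simp: hom_def central_extension_def)
  let ?A = "\<lambda>i. (a i, 0::real)" and ?B = "\<lambda>i. (b i, 0::real)"
  have closed: "?A i \<in> carrier ?E" "?B i \<in> carrier ?E" if "i < g" for i
    using that by (auto simp: central_extension_def)
  have "bihom ?E (\<lambda>c d. \<beta> (fst c) (fst d))"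
    using \<beta> hom_in_carrier[OF fst] unfolding bihom_def
    by (auto intro!: real_hom_compose[OF _ fst])
  moreover have "primitive ?E (\<lambda>c d. \<beta> (fst c) (fst d)) snd"
    by (auto simp: primitive_def central_extension_def)
  ultimately have "snd (eval_word ?E (case_sum ?A ?B) (surface_relator g))
      = surface_sum g ?A ?B (\<lambda>c d. \<beta> (fst c) (fst d))"
    by (rule E.primitive_surface_relator) (simp add: closed)
  also have "\<dots> = 0"
    using 0 by (simp add: surface_sum_def)
  finally have snd: "snd (eval_word ?E (case_sum ?A ?B) (surface_relator g)) = 0" .
  have letters: "fst ` set (surface_relator g) \<subseteq> Inl ` {..<g} \<union> Inr ` {..<g}"
    using presentation_relator(1)[OF pres] by (simp add: free_group_def)
  have "fst (eval_word ?E (case_sum ?A ?B) (surface_relator g))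
      = eval_word G (fst \<circ> case_sum ?A ?B) (surface_relator g)"
  proof (rule hom_eval_word[OF E.is_group is_group fst])
    have "case_sum ?A ?B ` (Inl ` {..<g} \<union> Inr ` {..<g}) \<subseteq> carrier ?E"
      using closed by auto
    then show "case_sum ?A ?B ` fst ` set (surface_relator g) \<subseteq> carrier ?E"
      using image_mono[OF letters, of "case_sum ?A ?B"] by (rule subset_trans[rotated])
  qed
  also have "fst \<circ> case_sum ?A ?B = case_sum a b"
    by (auto simp: fun_eq_iff split: sum.splits)
  also have "eval_word G (case_sum a b) (surface_relator g) = \<one>"
    using presentation_relator(2)[OF pres] by simp
  finally have "eval_word ?E (case_sum ?A ?B) (surface_relator g) = \<one>\<^bsub>?E\<^esub>"
    using snd by (simp add: central_extension_def prod_eq_iff)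
  moreover have "case_sum ?A ?B ` (Inl ` {..<g} \<union> Inr ` {..<g}) \<subseteq> carrier ?E"
    using closed by auto
  ultimately obtain h where h: "h \<in> hom G ?E"
    "\<And>i. i \<in> Inl ` {..<g} \<union> Inr ` {..<g} \<Longrightarrow> h (case_sum a b i) = case_sum ?A ?B i"
    using presentation_hom[OF pres is_group E.is_group, of "case_sum ?A ?B"] by blast
  have "fst (h c) = c" if "c \<in> carrier G" for c
  proof (rule presentation_hom_unique[OF pres is_group is_group _ _ _ that])
    show "(\<lambda>c. fst (h c)) \<in> hom G G"
      using h(1) fst by (simp add: hom_def Pi_iff)
    show "(\<lambda>c. c) \<in> hom G G"
      by (auto simp: hom_def)
  qed (use h(2) in auto)
  then have "primitive G \<beta> (\<lambda>c. snd (h c))"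
    using h(1) by (auto simp: primitive_def hom_def central_extension_def case_prod_unfold)
  then show thesis ..
qed

text \<open>Naturality of the intersection pairing: an endomorphism pulls back primitives.\<close>

lemma surface_sum_endomorphism:
  assumes \<beta>: "bihom G \<beta>" and 0: "surface_sum g a b \<beta> = 0" and h: "h \<in> hom G G"
  shows "surface_sum g a b (\<lambda>c d. \<beta> (h c) (h d)) = 0"
proof -
  obtain q where "primitive G \<beta> q"
    using primitive_exists[OF \<beta> 0] .
  then have "primitive G (\<lambda>c d. \<beta> (h c) (h d)) (\<lambda>c. q (h c))"
    using h by (simp add: primitive_def hom_def Pi_iff)
  moreover have "bihom G (\<lambda>c d. \<beta> (h c) (h d))"
    using \<beta> h unfolding bihom_def
    by (auto intro!: real_hom_compose[OF _ h] simp: hom_in_carrier)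
  ultimately show ?thesis
    by (rule surface_sum_primitive[rotated])
qed

text \<open>An endomorphism rescales the pairing by one constant.  Combining two cup products with the values
  of each other's pairing gives a 2-cocycle with vanishing sum, and compares the two scalings without
  naming the constant.\<close>

lemma pairing_endomorphism:
  assumes h: "h \<in> hom G G" and hom: "real_hom G u" "real_hom G v" "real_hom G w" "real_hom G w'"
  shows "pairing g a b (\<lambda>c. u (h c)) (\<lambda>c. v (h c)) * pairing g a b w w'
       = pairing g a b u v * pairing g a b (\<lambda>c. w (h c)) (\<lambda>c. w' (h c))"
proof -
  let ?\<beta> = "\<lambda>c d. pairing g a b w w' * (u c * v d) - pairing g a b u v * (w c * w' d)"
  have "bihom G ?\<beta>"
    by (intro bihom_diff bihom_scale bihom_product hom)
  moreover have "surface_sum g a b ?\<beta> = 0"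
    by (simp add: surface_sum_diff surface_sum_scale)
  ultimately have "surface_sum g a b (\<lambda>c d. ?\<beta> (h c) (h d)) = 0"
    using h by (rule surface_sum_endomorphism)
  then have "pairing g a b w w' * pairing g a b (\<lambda>c. u (h c)) (\<lambda>c. v (h c))
      - pairing g a b u v * pairing g a b (\<lambda>c. w (h c)) (\<lambda>c. w' (h c)) = 0"
    by (simp only: surface_sum_diff surface_sum_scale)
  then show ?thesis
    by (simp only: mult.commute[of _ "pairing g a b w w'"])
qed

text \<open>The relator is a product of commutators, so it is trivial in every abelian group.\<close>

lemma real_hom_exists:
  fixes s t :: "nat \<Rightarrow> real"
  obtains u where "real_hom G u" "\<And>i. i < g \<Longrightarrow> u (a i) = s i" "\<And>i. i < g \<Longrightarrow> u (b i) = t i"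
proof -
  interpret R: group real_group by (rule group_real_group)
  have "primitive real_group (\<lambda>c d. 0) (\<lambda>r. r)" "bihom real_group (\<lambda>c d. 0)"
    by (auto simp: primitive_def bihom_def real_hom_def real_group_def)
  then have "eval_word real_group (case_sum s t) (surface_relator g) = \<one>\<^bsub>real_group\<^esub>"
    using R.primitive_surface_relator[of "\<lambda>c d. 0" "\<lambda>r. r" g s t]
    by (simp add: surface_sum_def) (simp add: real_group_def)
  moreover have "case_sum s t ` (Inl ` {..<g} \<union> Inr ` {..<g}) \<subseteq> carrier real_group"
    by (simp add: real_group_def)
  ultimately obtain h where h: "h \<in> hom G real_group"
    "\<And>i. i \<in> Inl ` {..<g} \<union> Inr ` {..<g} \<Longrightarrow> h (case_sum a b i) = case_sum s t i"
    using presentation_hom[OF pres is_group R.is_group, of "case_sum s t"] by blast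
  show thesis
  proof
    show "real_hom G h"
      using h(1) by (simp add: real_hom_def hom_def real_group_def)
    show "h (a i) = s i" if "i < g" for i
      using h(2)[of "Inl i"] that by simp
    show "h (b i) = t i" if "i < g" for i
      using h(2)[of "Inr i"] that by simp
  qed
qed

lemma real_hom_unique:
  assumes u: "real_hom G u" and v: "real_hom G v"
    and ab: "\<And>i. i < g \<Longrightarrow> u (a i) = v (a i) \<and> u (b i) = v (b i)" and c: "c \<in> carrier G"
  shows "u c = v c"
proof (rule presentation_hom_unique[OF pres is_group group_real_group _ _ _ c])
  show "u \<in> hom G real_group" "v \<in> hom G real_group"
    using u v by (auto simp: hom_def real_hom_def real_group_def)
qed (use ab in auto)

lemma real_hom_integral:
  assumes u: "real_hom G u" and ab: "\<And>i. i < g \<Longrightarrow> u (a i) \<in> \<int> \<and> u (b i) \<in> \<int>" and c: "c \<in> carrier G"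
  shows "u c \<in> \<int>"
proof -
  obtain w where w: "w \<in> carrier (free_group (Inl ` {..<g} \<union> Inr ` {..<g}))" "c = eval_word G (case_sum a b) w"
    using presentation_surj[OF pres c] .
  have I: "fst ` set w \<subseteq> Inl ` {..<g} \<union> Inr ` {..<g}"
    using w(1) by (simp add: free_group_def)
  then have "eval_word G (case_sum a b) w \<in> carrier G \<and> u (eval_word G (case_sum a b) w) \<in> \<int>"
  proof (induction w)
    case Nil
    then show ?case by (simp add: real_hom_one[OF u])
  next
    case (Cons l w)
    then have "fst l \<in> Inl ` {..<g} \<union> Inr ` {..<g}" by simp
    then show ?case
      using Cons ab by (auto simp: real_homD[OF u] real_hom_inv[OF u])
  qed
  with w(2) show ?thesis by simp
qed

text \<open>The map induced by \<^term>\<open>\<alpha>\<close> on abelianisations is surjective from the lattice spanned by the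
  \<open>b\<^sub>i\<close> onto a lattice of the same rank, hence injective.  So every homomorphism to \<open>\<real>\<close> that kills
  the \<open>a\<^sub>i\<close> factors through \<^term>\<open>\<alpha>\<close>, and cannot tell \<^term>\<open>c\<close> from \<^term>\<open>c'\<close>.\<close>

lemma real_hom_factors:
  fixes \<alpha> :: "'a \<Rightarrow> nat word"
  assumes \<alpha>: "\<alpha> \<in> epi G (free_group {..<g})" and \<alpha>a: "\<And>i. i < g \<Longrightarrow> \<alpha> (a i) = \<one>\<^bsub>free_group {..<g}\<^esub>"
    and u: "real_hom G u" "\<And>i. i < g \<Longrightarrow> u (a i) = 0"
    and c: "c \<in> carrier G" "c' \<in> carrier G" and w: "w \<in> carrier (free_group {..<g})"
    and conj: "\<alpha> c' = w \<otimes>\<^bsub>free_group {..<g}\<^esub> \<alpha> c \<otimes>\<^bsub>free_group {..<g}\<^esub> inv\<^bsub>free_group {..<g}\<^esub> w"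
  shows "u c' = u c"
proof -
  let ?F = "free_group {..<g}"
  interpret F: group ?F by (rule group_free_group)
  interpret R: group real_group by (rule group_real_group)
  have \<alpha>hom: "\<alpha> \<in> hom G ?F" and \<alpha>surj: "\<alpha> ` carrier G = carrier ?F"
    using \<alpha> by (auto simp: epi_def)
  define e where "e k = eval_word real_group (\<lambda>i. if i = k then 1 else 0)" for k :: nat
  have "e k \<in> hom ?F real_group" for k
    unfolding e_def by (rule R.eval_word_hom) (simp add: real_group_def)
  then have eF: "real_hom ?F (e k)" for k
    by (auto simp: real_hom_def hom_def real_group_def)
  have eG: "real_hom G (\<lambda>c. e k (\<alpha> c))" for k
    by (rule real_hom_compose[OF eF \<alpha>hom])
  have "\<exists>m. real_hom G m \<and> (\<forall>j<g. m (a j) = 0 \<and> m (b j) = (if j = i then 1 else 0))" for i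
    using real_hom_exists[of "\<lambda>_. 0" "\<lambda>j. if j = i then 1 else 0"] by metis
  then obtain m where m: "\<And>i. real_hom G (m i)" "\<And>i j. j < g \<Longrightarrow> m i (a j) = 0"
    "\<And>i j. j < g \<Longrightarrow> m i (b j) = (if j = i then 1 else 0)"
    by metis
  have expand: "v d = (\<Sum>i<g. v (b i) * m i d)"
    if v: "real_hom G v" "\<And>i. i < g \<Longrightarrow> v (a i) = 0" and d: "d \<in> carrier G" for v d
  proof (rule real_hom_unique[OF v(1) _ _ d])
    show "real_hom G (\<lambda>d. \<Sum>i<g. v (b i) * m i d)"
      by (intro real_hom_sum real_hom_scale m)
    show "v (a j) = (\<Sum>i<g. v (b i) * m i (a j)) \<and> v (b j) = (\<Sum>i<g. v (b i) * m i (b j))"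
      if "j < g" for j
      using that by (simp add: m v if_distrib sum.delta cong: if_cong)
  qed
  define M where "M k i = e k (\<alpha> (b i))" for k i
  have eM: "e k (\<alpha> d) = (\<Sum>i<g. M k i * m i d)" if "d \<in> carrier G" for k d
    using expand[OF eG _ that] F.real_hom_one[OF eF] by (simp add: \<alpha>a M_def)
  have "\<exists>d\<in>carrier G. \<alpha> d = [(j, True)]" if "j < g" for j
  proof -
    have "[(j, True)] \<in> carrier ?F"
      using that by (simp add: free_group_def free_reduce_def)
    then show ?thesis
      using \<alpha>surj by (metis imageE)
  qed
  then obtain s where s: "\<And>j. j < g \<Longrightarrow> s j \<in> carrier G" "\<And>j. j < g \<Longrightarrow> \<alpha> (s j) = [(j, True)]"
    by metis
  have MP: "(\<Sum>i<g. M k i * m i (s j)) = (if k = j then 1 else 0)" if "k < g" "j < g" for k j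
    using eM[OF s(1)[OF that(2)], of k] s(2)[OF that(2)] by (auto simp: e_def real_group_def)
  have e_eq: "e k (\<alpha> c') = e k (\<alpha> c)" for k
    unfolding conj using w c hom_in_carrier[OF \<alpha>hom] by (intro F.real_hom_conj eF) auto
  have "m i c' - m i c = 0" if "i < g" for i
  proof (rule right_invertible_square_kernel[OF MP _ that])
    show "(\<Sum>i<g. M k i * (m i c' - m i c)) = 0" if "k < g" for k
      using e_eq[of k] c by (simp add: eM algebra_simps sum_subtractf)
  qed
  then show ?thesis
    using expand[OF u] c by simp
qed

text \<open>The duality underlying everything: a pairing-preserving endomorphism that is trivial on the
  Lagrangian subspace of homomorphisms killing all \<open>a\<^sub>i\<close> is trivial modulo its annihilator, which is
  that subspace itself.\<close>

lemma lagrangian_duality: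
  assumes h: "h \<in> hom G G" and v: "real_hom G v" and i: "i < g"
    and triv: "\<And>u c. real_hom G u \<Longrightarrow> (\<forall>i<g. u (a i) = 0) \<Longrightarrow> c \<in> carrier G \<Longrightarrow> u (h c) = u c"
    and pres: "\<And>u. real_hom G u \<Longrightarrow>
      pairing g a b (\<lambda>c. u (h c)) (\<lambda>c. v (h c)) = pairing g a b u v"
  shows "v (h (a i)) = v (a i)"
proof -
  obtain u where u: "real_hom G u" "\<And>j. j < g \<Longrightarrow> u (a j) = 0"
    "\<And>j. j < g \<Longrightarrow> u (b j) = (if j = i then 1 else 0)"
    using real_hom_exists[of "\<lambda>_. 0" "\<lambda>j. if j = i then 1 else 0"] by metis
  have "pairing g a b u (\<lambda>c. v (h c)) = pairing g a b (\<lambda>c. u (h c)) (\<lambda>c. v (h c))"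
    by (rule pairing_cong) (simp add: triv u)
  with pres[OF u(1)] have "pairing g a b u (\<lambda>c. v (h c) - v c) = 0"
    by (simp add: pairing_diff_right)
  moreover have "pairing g a b u z = - z (a i)" for z
    unfolding surface_sum_def using i
    by (simp add: u if_distrib[of "\<lambda>r. r * _"] sum_negf sum.delta cong: if_cong)
  ultimately show ?thesis
    by simp
qed

text \<open>Two handles are needed here.  In each of them there is a basis of the integral classes whose first
  member kills \<^term>\<open>d\<close>; a primitive combination of the two second members also kills \<^term>\<open>d\<close>, and it
  has a dual class among the combinations of the first members.\<close>

lemma integral_pair_exists:
  assumes g: "g \<ge> 2" and d: "d \<in> carrier G"
  obtains u v where "real_hom G u" "real_hom G v" "u d = 0" "v d = 0" "pairing g a b u v = 1"
    "\<And>c. c \<in> carrier G \<Longrightarrow> u c \<in> \<int>" "\<And>c. c \<in> carrier G \<Longrightarrow> v c \<in> \<int>"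
proof -
  define good where "good u \<longleftrightarrow> real_hom G u \<and> (\<forall>c\<in>carrier G. u c \<in> \<int>)" for u
  have comb: "good (\<lambda>c. of_int p * u c + of_int q * v c)" if "good u" "good v" for p q u v
    using that unfolding good_def by (auto intro!: real_hom_add real_hom_scale Ints_add Ints_mult)
  \<comment> \<open>One handle: a basis \<open>U, V\<close> of the classes supported there with \<open>U d = 0\<close>.\<close>
  have handle: "\<exists>U V. good U \<and> good V \<and> U d = 0 \<and> pairing g a b U V = 1
      \<and> (\<forall>j<g. j \<noteq> i \<longrightarrow> U (a j) = 0 \<and> U (b j) = 0 \<and> V (a j) = 0 \<and> V (b j) = 0)"
    if i: "i < g" for i
  proof -
    obtain A where A: "real_hom G A" "\<And>j. j < g \<Longrightarrow> A (a j) = (if j = i then 1 else 0)" "\<And>j. j < g \<Longrightarrow> A (b j) = 0"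
      using real_hom_exists[of "\<lambda>j. if j = i then 1 else 0" "\<lambda>_. 0"] by metis
    obtain B where B: "real_hom G B" "\<And>j. j < g \<Longrightarrow> B (b j) = (if j = i then 1 else 0)" "\<And>j. j < g \<Longrightarrow> B (a j) = 0"
      using real_hom_exists[of "\<lambda>_. 0" "\<lambda>j. if j = i then 1 else 0"] by metis
    have gd: "good A" "good B"
      using real_hom_integral[OF A(1)] real_hom_integral[OF B(1)] A B by (simp_all add: good_def)
    then obtain x y where xy: "A d = of_int x" "B d = of_int y"
      using d unfolding good_def by (metis Ints_cases)
    obtain p q r s where pqrs: "p * s - q * r = 1" "p * x + q * y = (0::int)"
      by (rule unimodular_annihilator)
    let ?U = "\<lambda>c. of_int p * A c + of_int q * B c" and ?V = "\<lambda>c. of_int r * A c + of_int s * B c"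
    have "?U d = of_int (p * x + q * y)"
      by (simp add: xy)
    then have "?U d = 0"
      using pqrs(2) by simp
    moreover have AB: "pairing g a b A B = 1"
      using i by (simp add: surface_sum_def A B if_distrib[of "\<lambda>r. r * _"] sum.delta cong: if_cong)
    have "pairing g a b ?U ?V = of_int p * of_int s - of_int q * of_int r"
      by (simp add: pairing_add_left pairing_add_right pairing_scale_left pairing_scale_right
          pairing_self AB pairing_swap[of g a b B A])
    then have "pairing g a b ?U ?V = of_int (p * s - q * r)"
      by simp
    then have "pairing g a b ?U ?V = 1"
      using pqrs(1) by simp
    ultimately show ?thesis
      using comb[OF gd] by (intro exI[of _ ?U] exI[of _ ?V]) (simp add: A B)
  qed
  obtain U V where UV: "good U" "good V" "U d = 0" "pairing g a b U V = 1"
    "\<forall>j<g. j \<noteq> 0 \<longrightarrow> U (a j) = 0 \<and> U (b j) = 0 \<and> V (a j) = 0 \<and> V (b j) = 0"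
    using handle[of 0] g by auto
  obtain U' V' where UV': "good U'" "good V'" "U' d = 0" "pairing g a b U' V' = 1"
    "\<forall>j<g. j \<noteq> 1 \<longrightarrow> U' (a j) = 0 \<and> U' (b j) = 0 \<and> V' (a j) = 0 \<and> V' (b j) = 0"
    using handle[of 1] g by auto
  have orth: "pairing g a b U V' = 0" "pairing g a b U' V = 0"
    unfolding surface_sum_def using UV(5) UV'(5)
    by (intro sum.neutral ballI; metis (no_types, lifting) lessThan_iff mult_zero_left mult_zero_right diff_zero zero_neq_one)+
  obtain x y where xy: "V d = of_int x" "V' d = of_int y"
    using UV(2) UV'(2) d unfolding good_def by (metis Ints_cases)
  obtain p q r s where pqrs: "p * s - q * r = 1" "p * x + q * y = (0::int)"
    by (rule unimodular_annihilator)
  let ?u = "\<lambda>c. of_int s * U c + of_int (- r) * U' c" and ?v = "\<lambda>c. of_int p * V c + of_int q * V' c"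
  have "?v d = of_int (p * x + q * y)"
    by (simp add: xy)
  then have vd: "?v d = 0"
    using pqrs(2) by simp
  have "pairing g a b ?u ?v = of_int (p * s - q * r)"
    by (simp only: pairing_add_left pairing_add_right pairing_scale_left pairing_scale_right
        UV(4) UV'(4) orth) simp
  then have "pairing g a b ?u ?v = 1"
    using pqrs(1) by simp
  moreover have "good ?u" "good ?v"
    using comb UV(1,2) UV'(1,2) by blast+
  ultimately show thesis
    using that[of ?u ?v] vd UV(3) UV'(3) by (auto simp: good_def)
qed

end

section \<open>Winding numbers of circle-valued functions along paths\<close>

lemma cis_eq_iff: "cis (2 * pi * x) = cis (2 * pi * y) \<longleftrightarrow> x - y \<in> \<int>"
proof -
  have "cis (2 * pi * x) = cis (2 * pi * y) \<longleftrightarrow> (\<exists>n::int. 2 * pi * x = 2 * pi * y + 2 * pi * n)"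
    using sin_cos_eq_iff[of "2 * pi * x" "2 * pi * y"] by (auto simp: complex_eq_iff)
  also have "\<dots> \<longleftrightarrow> (\<exists>n::int. 2 * pi * x = 2 * pi * (y + n))"
    by (simp add: distrib_left)
  also have "\<dots> \<longleftrightarrow> (\<exists>n::int. x = y + n)"
    by simp
  also have "\<dots> \<longleftrightarrow> x - y \<in> \<int>"
    by (auto simp: Ints_def algebra_simps image_iff)
  finally show ?thesis .
qed

lemma integer_differences_imp_constant:
  fixes f :: "'a::topological_space \<Rightarrow> real"
  assumes "connected S" "continuous_on S f" "\<And>x y. x \<in> S \<Longrightarrow> y \<in> S \<Longrightarrow> f x - f y \<in> \<int>"
    "x \<in> S" "y \<in> S"
  shows "f x = f y"
proof -
  have "f constant_on S"
  proof (rule continuous_discrete_range_constant[OF assms(1,2)])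
    fix x assume "x \<in> S"
    then have "1 \<le> \<bar>f y - f x\<bar>" if "y \<in> S" "f y \<noteq> f x" for y
      using Ints_nonzero_abs_ge1[of "f y - f x"] assms(3)[of y x] that by simp
    then show "\<exists>e>0. \<forall>y. y \<in> S \<and> f y \<noteq> f x \<longrightarrow> e \<le> norm (f y - f x)"
      by (intro exI[of _ 1]) auto
  qed
  then show ?thesis
    using assms(4,5) by (metis constant_on_def)
qed

lemma countable_range_imp_constant:
  fixes f :: "'a::topological_space \<Rightarrow> 'b::metric_space"
  assumes "connected S" "continuous_on S f" "countable (f ` S)" "x \<in> S" "y \<in> S"
  shows "f x = f y"
  using connected_uncountable[OF connected_continuous_image[OF assms(2,1)], of "f x" "f y"] assms by auto

text \<open>Every value is attained on an interval with rational endpoints, and there are only countably many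
  of these.\<close>

lemma countable_range_locally_constant:
  fixes f :: "real \<Rightarrow> 'b"
  assumes "\<And>t. t \<in> S \<Longrightarrow> \<exists>e>0. \<forall>s\<in>S. \<bar>s - t\<bar> < e \<longrightarrow> f s = f t"
  shows "countable (f ` S)"
proof -
  let ?val = "\<lambda>(p, q). f (SOME s. s \<in> S \<and> s \<in> {p<..<q})"
  have "f t \<in> ?val ` (\<rat> \<times> \<rat>)" if t: "t \<in> S" for t
  proof -
    obtain e where e: "e > 0" "\<And>s. s \<in> S \<Longrightarrow> \<bar>s - t\<bar> < e \<Longrightarrow> f s = f t"
      using assms[OF t] by blast
    obtain p where p: "p \<in> \<rat>" "t - e < p" "p < t"
      using Rats_dense_in_real[of "t - e" t] e by auto
    obtain q where q: "q \<in> \<rat>" "t < q" "q < t + e"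
      using Rats_dense_in_real[of t "t + e"] e by auto
    have "(SOME s. s \<in> S \<and> s \<in> {p<..<q}) \<in> S \<and> (SOME s. s \<in> S \<and> s \<in> {p<..<q}) \<in> {p<..<q}"
      by (rule someI[of _ t]) (use t p q in auto)
    then have "f (SOME s. s \<in> S \<and> s \<in> {p<..<q}) = f t"
      using p q by (intro e(2)) auto
    then show ?thesis
      using p(1) q(1) by (intro image_eqI[of _ _ "(p, q)"]) auto
  qed
  then have "f ` S \<subseteq> ?val ` (\<rat> \<times> \<rat>)"
    by blast
  then show ?thesis
    by (rule countable_subset) (simp add: countable_rat)
qed

definition angle_lift :: "'a::topological_space set \<Rightarrow> ('a \<Rightarrow> complex) \<Rightarrow> ('a \<Rightarrow> real) \<Rightarrow> bool" where
  "angle_lift S h \<theta> \<longleftrightarrow> continuous_on S \<theta> \<and> (\<forall>x\<in>S. h x = cis (2 * pi * \<theta> x))"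

lemma angle_lift_exists:
  fixes S :: "'a::real_normed_vector set"
  assumes "convex S" "continuous_on S h" "\<And>x. x \<in> S \<Longrightarrow> norm (h x) = 1"
  obtains \<theta> where "angle_lift S h \<theta>"
proof -
  obtain L where L: "continuous_on S L" "\<And>x. x \<in> S \<Longrightarrow> h x = exp (L x)"
    using continuous_logarithm_on_contractible[OF assms(2) convex_imp_contractible[OF assms(1)]] assms(3)
    by (metis norm_zero zero_neq_one)
  have "h x = cis (2 * pi * (Im (L x) / (2 * pi)))" if "x \<in> S" for x
  proof -
    have "Re (L x) = 0"
      using assms(3)[OF that] L(2)[OF that] by (simp add: norm_exp_eq_Re)
    then show ?thesis
      using L(2)[OF that] by (simp add: exp_eq_polar)
  qed
  moreover have "continuous_on S (\<lambda>x. Im (L x) / (2 * pi))"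
    by (intro continuous_intros L) auto
  ultimately show thesis
    by (intro that[of "\<lambda>x. Im (L x) / (2 * pi)"]) (simp add: angle_lift_def)
qed

lemma angle_lift_diff:
  assumes "connected S" "angle_lift S h \<theta>" "angle_lift S h \<theta>'" "x \<in> S" "y \<in> S"
  shows "\<theta> y - \<theta> x = \<theta>' y - \<theta>' x"
proof -
  have int: "\<theta> x - \<theta>' x \<in> \<int>" if "x \<in> S" for x
    using assms that by (simp add: angle_lift_def flip: cis_eq_iff)
  have "\<theta> x - \<theta>' x = \<theta> y - \<theta>' y"
    by (rule integer_differences_imp_constant[OF assms(1), where f = "\<lambda>x. \<theta> x - \<theta>' x"])
       (use assms in \<open>auto simp: angle_lift_def intro!: continuous_intros Ints_diff int\<close>)
  then show ?thesis by simp
qed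

lemma angle_liftD: "angle_lift S h \<theta> \<Longrightarrow> x \<in> S \<Longrightarrow> h x = cis (2 * pi * \<theta> x)"
  by (simp add: angle_lift_def)

text \<open>The number of turns, as a real number, since the ends of the path may have different images.\<close>

definition winding :: "('a \<Rightarrow> complex) \<Rightarrow> (real \<Rightarrow> 'a) \<Rightarrow> real" where
  "winding P c = (THE r. \<exists>\<theta>. angle_lift {0..1} (\<lambda>t. P (c t)) \<theta> \<and> r = \<theta> 1 - \<theta> 0)"

definition circle_map :: "'a topology \<Rightarrow> ('a \<Rightarrow> complex) \<Rightarrow> bool" where
  "circle_map X P \<longleftrightarrow> continuous_map X euclidean P \<and> (\<forall>x\<in>topspace X. norm (P x) = 1)"

lemma winding_eq: "angle_lift {0..1} (\<lambda>t. P (c t)) \<theta> \<Longrightarrow> winding P c = \<theta> 1 - \<theta> 0"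
  unfolding winding_def
  by (rule the_equality) (auto intro: angle_lift_diff[of "{0..1::real}"])

lemma path_angle_lift:
  assumes "circle_map X P" "pathin X c"
  obtains \<theta> where "angle_lift {0..1} (\<lambda>t. P (c t)) \<theta>" "winding P c = \<theta> 1 - \<theta> 0"
proof -
  have "continuous_on {0..1} (P \<circ> c)"
    using continuous_map_compose[OF assms(2)[unfolded pathin_def], of euclidean P] assms(1)
    by (simp add: circle_map_def)
  moreover have "norm ((P \<circ> c) t) = 1" if "t \<in> {0..1}" for t
    using assms that path_image_subset_topspace[OF assms(2)] by (auto simp: circle_map_def Pi_iff)
  ultimately obtain \<theta> where "angle_lift {0..1} (P \<circ> c) \<theta>"
    using angle_lift_exists[of "{0..1::real}" "P \<circ> c"] by auto
  then show thesis
    using that[of \<theta>] winding_eq[of P c \<theta>] by (simp add: o_def)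
qed

text \<open>Lift the whole homotopy to the line: while the path is deformed, both ends of its lift move
  continuously inside a coset of \<open>\<int>\<close>, so they stay put.\<close>

lemma winding_path_homotopic:
  assumes P: "circle_map X P" and cd: "path_homotopic X c d"
  shows "winding P c = winding P d"
proof -
  let ?I = "top_of_set {0..1::real}"
  obtain h where h: "continuous_map (prod_topology ?I ?I) X h" "\<And>x. h (0, x) = c x" "\<And>x. h (1, x) = d x"
    "\<And>t. t \<in> {0..1} \<Longrightarrow> h (t, 0) = c 0 \<and> h (t, 1) = c 1"
    using cd unfolding path_homotopic_def homotopic_with_def by auto
  have I2: "prod_topology ?I ?I = top_of_set ({0..1} \<times> {0..1})"
    by (simp add: prod_topology_subtopology subtopology_subtopology
        euclidean_product_topology[symmetric] Times_Int_Times)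
  have cont: "continuous_on ({0..1} \<times> {0..1}) (\<lambda>y. P (h y))"
    using continuous_map_compose[OF h(1), of euclidean P] P unfolding I2 circle_map_def by (simp add: o_def)
  have "h y \<in> topspace X" if "y \<in> {0..1} \<times> {0..1}" for y
    using continuous_map_image_subset_topspace[OF h(1)] that by (auto simp: image_subset_iff)
  then have nrm: "norm (P (h y)) = 1" if "y \<in> {0..1} \<times> {0..1}" for y
    using P that by (auto simp: circle_map_def)
  obtain \<Theta> where \<Theta>: "angle_lift ({0..1} \<times> {0..1}) (\<lambda>y. P (h y)) \<Theta>"
    by (rule angle_lift_exists[OF _ cont nrm]) (auto intro: convex_Times)
  have slice: "angle_lift {0..1} (\<lambda>t. P (h (s, t))) (\<lambda>t. \<Theta> (s, t))" if "s \<in> {0..1}" for s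
    using \<Theta> that unfolding angle_lift_def
    by (auto intro!: continuous_on_compose2[of "{0..1} \<times> {0..1}" \<Theta>] continuous_intros)
  have const: "\<Theta> (0, e) = \<Theta> (1, e)" if e: "e = 0 \<or> e = 1" for e
  proof (rule integer_differences_imp_constant[where f = "\<lambda>s. \<Theta> (s, e)" and S = "{0..1}"])
    show "continuous_on {0..1} (\<lambda>s. \<Theta> (s, e))"
      using \<Theta> e unfolding angle_lift_def
      by (auto intro!: continuous_on_compose2[of "{0..1} \<times> {0..1}" \<Theta>] continuous_intros)
    show "\<Theta> (s, e) - \<Theta> (t, e) \<in> \<int>" if "s \<in> {0..1}" "t \<in> {0..1}" for s t
    proof -
      have "h (s, e) = h (t, e)"
        using h(4)[OF that(1)] h(4)[OF that(2)] e by auto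
      then have "cis (2 * pi * \<Theta> (s, e)) = cis (2 * pi * \<Theta> (t, e))"
        using \<Theta> that e unfolding angle_lift_def by (metis SigmaI atLeastAtMost_iff order_refl zero_le_one)
      then show ?thesis
        by (simp add: cis_eq_iff)
    qed
  qed auto
  have "winding P c = \<Theta> (0, 1) - \<Theta> (0, 0)"
    by (rule winding_eq) (use slice[of 0] h(2) in simp)
  moreover have "winding P d = \<Theta> (1, 1) - \<Theta> (1, 0)"
    by (rule winding_eq) (use slice[of 1] h(3) in simp)
  ultimately show ?thesis
    using const by simp
qed

lemma winding_endpoints:
  assumes "circle_map X P" "pathin X c"
  shows "P (c 1) = P (c 0) * cis (2 * pi * winding P c)"
proof -
  obtain \<theta> where \<theta>: "angle_lift {0..1} (\<lambda>t. P (c t)) \<theta>" "winding P c = \<theta> 1 - \<theta> 0"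
    by (rule path_angle_lift[OF assms])
  have "P (c 0) * cis (2 * pi * winding P c) = cis (2 * pi * \<theta> 0 + 2 * pi * (\<theta> 1 - \<theta> 0))"
    using angle_liftD[OF \<theta>(1), of 0] \<theta>(2) by (simp add: cis_mult)
  also have "2 * pi * \<theta> 0 + 2 * pi * (\<theta> 1 - \<theta> 0) = 2 * pi * \<theta> 1"
    by (simp add: algebra_simps)
  also have "cis (2 * pi * \<theta> 1) = P (c 1)"
    using angle_liftD[OF \<theta>(1), of 1] by simp
  finally show ?thesis ..
qed

lemma winding_integral:
  assumes "circle_map X P" "pathin X c" "P (c 0) = P (c 1)"
  shows "winding P c \<in> \<int>"
proof -
  have "P (c 0) \<noteq> 0"
    using assms path_start_in_topspace[OF assms(2)] by (auto simp: circle_map_def)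
  moreover have "P (c 0) * cis (2 * pi * winding P c) = P (c 0) * 1"
    using winding_endpoints[OF assms(1,2)] assms(3) by (metis mult_1_right)
  ultimately have "cis (2 * pi * winding P c) = 1"
    by (simp only: mult_cancel_left) simp
  then show ?thesis
    using cis_eq_iff[of "winding P c" 0] by simp
qed

text \<open>Before the lifts of the two halves can be glued, the second one is shifted by the integer by which
  they disagree in the middle.\<close>

lemma winding_path_join:
  assumes P: "circle_map X P" and cd: "pathin X c" "pathin X d" "c 1 = d 0"
  shows "winding P (path_join c d) = winding P c + winding P d"
proof -
  obtain \<theta> where \<theta>: "angle_lift {0..1} (\<lambda>t. P (c t)) \<theta>" "winding P c = \<theta> 1 - \<theta> 0"
    by (rule path_angle_lift[OF P cd(1)])
  obtain \<theta>' where \<theta>': "angle_lift {0..1} (\<lambda>t. P (d t)) \<theta>'" "winding P d = \<theta>' 1 - \<theta>' 0"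
    by (rule path_angle_lift[OF P cd(2)])
  have "cis (2 * pi * \<theta> 1) = cis (2 * pi * \<theta>' 0)"
    using angle_liftD[OF \<theta>(1), of 1] angle_liftD[OF \<theta>'(1), of 0] cd(3) by simp
  then have "\<theta> 1 - \<theta>' 0 \<in> \<int>"
    by (simp only: cis_eq_iff)
  then have shift: "cis (2 * pi * (\<theta>' t + (\<theta> 1 - \<theta>' 0))) = cis (2 * pi * \<theta>' t)" for t
    by (subst cis_eq_iff) simp
  let ?\<phi> = "\<lambda>t. if t \<le> 1/2 then \<theta> (2 * t) else \<theta>' (2 * t - 1) + (\<theta> 1 - \<theta>' 0)"
  have mid: "\<theta> (2 * t) = \<theta>' (2 * t - 1) + (\<theta> 1 - \<theta>' 0)" if "t * 2 = 1" for t
  proof -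
    have t: "2 * t = 1" using that by simp
    show ?thesis unfolding t by simp
  qed
  have "continuous_on {0..1} ?\<phi>"
  proof -
    have "continuous_on ({0..1/2} \<union> {1/2..1}) ?\<phi>"
      using \<theta>(1) \<theta>'(1) unfolding angle_lift_def
      by (intro continuous_on_If)
         (auto intro!: continuous_intros continuous_on_compose2[of "{0..1}" \<theta>] continuous_on_compose2[of "{0..1}" \<theta>'] intro: mid)
    then show ?thesis
      by (simp add: split_01)
  qed
  moreover have "P (path_join c d t) = cis (2 * pi * ?\<phi> t)" if "t \<in> {0..1}" for t
    using that \<theta>(1) \<theta>'(1) by (simp add: path_join_def angle_lift_def shift)
  ultimately have "angle_lift {0..1} (\<lambda>t. P (path_join c d t)) ?\<phi>"
    by (simp add: angle_lift_def)
  then have "winding P (path_join c d) = ?\<phi> 1 - ?\<phi> 0"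
    by (rule winding_eq)
  with \<theta>(2) \<theta>'(2) show ?thesis
    by simp
qed

lemma winding_path_reverse:
  assumes P: "circle_map X P" and c: "pathin X c"
  shows "winding P (path_reverse c) = - winding P c"
proof -
  obtain \<theta> where \<theta>: "angle_lift {0..1} (\<lambda>t. P (c t)) \<theta>" "winding P c = \<theta> 1 - \<theta> 0"
    by (rule path_angle_lift[OF P c])
  then have "angle_lift {0..1} (\<lambda>t. P (path_reverse c t)) (\<lambda>t. \<theta> (1 - t))"
    unfolding angle_lift_def path_reverse_def
    by (auto intro!: continuous_intros continuous_on_compose2[of "{0..1}" \<theta>])
  then have "winding P (path_reverse c) = \<theta> (1 - 1) - \<theta> (1 - 0)"
    by (rule winding_eq)
  with \<theta>(2) show ?thesis
    by simp
qed

definition class_winding :: "('a \<Rightarrow> complex) \<Rightarrow> (real \<Rightarrow> 'a) set \<Rightarrow> real" where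
  "class_winding P C = winding P (SOME c. c \<in> C)"

lemma class_winding_path_class:
  assumes "circle_map X P" "pathin X c"
  shows "class_winding P (path_class X c) = winding P c"
proof -
  have "(SOME d. d \<in> path_class X c) \<in> path_class X c"
    using path_class_self[OF assms(2)] by (rule someI[of "\<lambda>d. d \<in> path_class X c"])
  then show ?thesis
    unfolding class_winding_def
    using winding_path_homotopic[OF assms(1), of c] by (simp add: in_path_class_iff)
qed

lemma real_hom_class_winding:
  assumes "circle_map X P"
  shows "real_hom (fundamental_group X x0) (class_winding P)"
  unfolding real_hom_def
proof (intro ballI)
  fix C D assume "C \<in> carrier (fundamental_group X x0)" "D \<in> carrier (fundamental_group X x0)"
  then obtain c d where cd: "c \<in> paths_between X x0 x0" "C = path_class X c"
    "d \<in> paths_between X x0 x0" "D = path_class X d"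
    by (elim fundamental_group_carrierE) blast
  then show "class_winding P (C \<otimes>\<^bsub>fundamental_group X x0\<^esub> D) = class_winding P C + class_winding P D"
    by (simp add: fundamental_group_mult class_winding_path_class[OF assms] paths_between_def
        pathin_path_join winding_path_join[OF assms])
qed

section \<open>The glued surface\<close>

lemma index_2: "i \<noteq> j \<Longrightarrow> k = i \<or> k = j" for i j k :: 2
  using exhaust_2[of i] exhaust_2[of j] exhaust_2[of k] by auto

lemma mem_unit_square: "z \<in> cbox 0 1 \<longleftrightarrow> (\<forall>i. 0 \<le> z $ i \<and> z $ i \<le> 1)" for z :: plane
  by (simp add: mem_box_cart)

lemma unit_Ints_iff: "0 \<le> x \<Longrightarrow> x \<le> 1 \<Longrightarrow> x \<in> \<int> \<longleftrightarrow> x = 0 \<or> x = 1" for x :: real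
  by (auto elim!: Ints_cases)

lemma torus_proj_eq_iff: "torus_proj z = torus_proj w \<longleftrightarrow> (\<forall>i. z $ i - w $ i \<in> \<int>)"
proof
  assume "torus_proj z = torus_proj w"
  moreover have "z \<in> torus_proj z"
    by (simp add: torus_proj_def)
  ultimately have "z \<in> torus_proj w"
    by simp
  then show "\<forall>i. z $ i - w $ i \<in> \<int>"
    by (simp add: torus_proj_def)
next
  assume *: "\<forall>i. z $ i - w $ i \<in> \<int>"
  have "v $ i - z $ i \<in> \<int> \<longleftrightarrow> v $ i - w $ i \<in> \<int>" for v i
  proof -
    have "v $ i - w $ i = (v $ i - z $ i) + (z $ i - w $ i)" "v $ i - z $ i = (v $ i - w $ i) - (z $ i - w $ i)"
      by simp_all
    then show ?thesis
      using * by (metis Ints_add Ints_diff)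
  qed
  then show "torus_proj z = torus_proj w"
    by (simp add: torus_proj_def)
qed

text \<open>The neighbouring square across the side on which coordinate \<open>i\<close> equals 1; this treats right and
  upper sides uniformly.\<close>

definition nxt :: "('s, 'm) origami_scheme \<Rightarrow> 2 \<Rightarrow> 's \<Rightarrow> 's" where
  "nxt Q i = (if i = 1 then right_of Q else above_of Q)"

definition prv :: "('s, 'm) origami_scheme \<Rightarrow> 2 \<Rightarrow> 's \<Rightarrow> 's" where
  "prv Q i = inv_into (squares Q) (nxt Q i)"

definition corner :: "plane \<Rightarrow> bool" where
  "corner z \<longleftrightarrow> (\<forall>i. z $ i \<in> \<int>)"

text \<open>The map on the surface induced by a function on the squares that is compatible with the gluing.\<close>

definition surface_map :: "('s \<times> plane \<Rightarrow> 'b) \<Rightarrow> 's point \<Rightarrow> 'b" where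
  "surface_map F x = F (SOME y. y \<in> x)"

lemma gluing_eq:
  "gluing Q = {((s, z), (nxt Q i s, z - axis i 1)) | s z i. s \<in> squares Q \<and> z \<in> cbox 0 1 \<and> z $ i = 1}"
  unfolding gluing_def nxt_def
  apply (intro equalityI subsetI)
   apply (elim UnE CollectE exE conjE)
    apply (rule CollectI, rule exI, rule exI, rule exI[of _ 1], force)
   apply (rule CollectI, rule exI, rule exI, rule exI[of _ 2], force)
  apply (elim CollectE exE conjE)
  subgoal for x s z i using exhaust_2[of i] by auto
  done

lemma gluingE:
  assumes "(y, y') \<in> gluing Q"
  obtains s z i where "y = (s, z)" "y' = (nxt Q i s, z - axis i 1)" "s \<in> squares Q" "z \<in> cbox 0 1" "z $ i = 1"
  using assms unfolding gluing_eq by blast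

locale origami_surface =
  fixes Q :: "'s origami"
  assumes origami: "is_origami Q"
begin

abbreviation X :: "'s point topology" where "X \<equiv> surface Q"
abbreviation pt :: "'s \<Rightarrow> plane \<Rightarrow> 's point" where "pt s z \<equiv> glued_point Q (s, z)"
abbreviation unit_square :: "plane set" where "unit_square \<equiv> cbox 0 1"

lemma finite_squares: "finite (squares Q)" and squares_nonempty: "squares Q \<noteq> {}"
  using origami by (auto simp: is_origami_def)

lemma bij_nxt: "bij_betw (nxt Q i) (squares Q) (squares Q)"
  using origami by (simp add: is_origami_def nxt_def)

lemma nxt_in [simp]: "s \<in> squares Q \<Longrightarrow> nxt Q i s \<in> squares Q"
  using bij_nxt bij_betwE by blast

lemma prv_in [simp]: "s \<in> squares Q \<Longrightarrow> prv Q i s \<in> squares Q"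
  using bij_nxt unfolding prv_def by (metis bij_betw_imp_surj_on inv_into_into)

lemma nxt_prv [simp]: "s \<in> squares Q \<Longrightarrow> nxt Q i (prv Q i s) = s"
  using bij_nxt unfolding prv_def by (metis bij_betw_inv_into_right)

lemma prv_nxt [simp]: "s \<in> squares Q \<Longrightarrow> prv Q i (nxt Q i s) = s"
  using bij_nxt unfolding prv_def by (metis bij_betw_inv_into_left)

lemma sum_nxt: "(\<Sum>s\<in>squares Q. F (nxt Q i s)) = (\<Sum>s\<in>squares Q. F s)"
  using sum.reindex_bij_betw[OF bij_nxt] .

lemma glued_point_eq_iff: "glued_point Q y = glued_point Q y' \<longleftrightarrow> y' \<in> glued_point Q y"
proof
  assume "y' \<in> glued_point Q y"
  then have "(y, y') \<in> (gluing Q \<union> (gluing Q)\<inverse>)\<^sup>*"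
    by (simp add: glued_point_def)
  moreover have "sym ((gluing Q \<union> (gluing Q)\<inverse>)\<^sup>*)"
    by (intro sym_rtrancl sym_Un_converse)
  ultimately show "glued_point Q y = glued_point Q y'"
    unfolding glued_point_def by (auto intro: rtrancl_trans dest: symD)
qed (auto simp: glued_point_def)

lemma glued_point_self: "y \<in> glued_point Q y"
  by (simp add: glued_point_def)

lemma glued_point_induct [consumes 1, case_names base step]:
  assumes "y' \<in> glued_point Q y" "R y"
    "\<And>y y'. R y \<Longrightarrow> (y, y') \<in> gluing Q \<or> (y', y) \<in> gluing Q \<Longrightarrow> R y'"
  shows "R y'"
proof -
  have "(y, y') \<in> (gluing Q \<union> (gluing Q)\<inverse>)\<^sup>*"
    using assms(1) by (simp add: glued_point_def)
  then show ?thesis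
    by (induction rule: rtrancl_induct) (use assms(2,3) in blast)+
qed

lemma pt_glue:
  assumes "s \<in> squares Q" "z \<in> unit_square" "z $ i = 1"
  shows "pt (nxt Q i s) (z - axis i 1) = pt s z"
proof -
  have "((s, z), (nxt Q i s, z - axis i 1)) \<in> gluing Q"
    using assms unfolding gluing_eq by blast
  then show ?thesis
    by (metis (no_types, lifting) Image_singleton_iff UnI1 glued_point_def glued_point_eq_iff r_into_rtrancl)
qed

lemma compatible_class:
  assumes "\<And>y y'. (y, y') \<in> gluing Q \<Longrightarrow> F y = F y'" "y' \<in> glued_point Q y"
  shows "F y' = F y"
  using assms(2) by (induction rule: glued_point_induct) (auto dest: assms(1))

lemma surface_map_pt:
  assumes "\<And>y y'. (y, y') \<in> gluing Q \<Longrightarrow> F y = F y'"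
  shows "surface_map F (pt s z) = F (s, z)"
proof -
  have "(SOME y. y \<in> pt s z) \<in> pt s z"
    by (rule someI[of "\<lambda>y. y \<in> pt s z", OF glued_point_self])
  then show ?thesis
    unfolding surface_map_def using compatible_class[where F = F, OF assms] by metis
qed

lemma topspace_squares: "topspace (squares_topology Q) = squares Q \<times> unit_square"
  by (simp add: squares_topology_def)

lemma topspace_X: "topspace X = glued_point Q ` (squares Q \<times> unit_square)"
  by (simp add: surface_def topspace_squares)

lemma pt_in [simp]: "s \<in> squares Q \<Longrightarrow> z \<in> unit_square \<Longrightarrow> pt s z \<in> topspace X"
  by (auto simp: topspace_X)

lemma topspace_XE:
  assumes "x \<in> topspace X"
  obtains s z where "s \<in> squares Q" "z \<in> unit_square" "x = pt s z"
  using assms by (auto simp: topspace_X)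

lemma rep_torus_proj: "y' \<in> glued_point Q y \<Longrightarrow> torus_proj (snd y') = torus_proj (snd y)"
  by (rule compatible_class[of "\<lambda>y. torus_proj (snd y)"])
     (auto elim!: gluingE simp: torus_proj_eq_iff axis_def)

lemma covering_pt: "covering (pt s z) = torus_proj z"
proof -
  have "covering (pt s z) = (\<Union>y\<in>pt s z. torus_proj (snd y))"
    by (simp add: covering_def case_prod_unfold)
  also have "\<dots> = (\<Union>y\<in>pt s z. torus_proj z)"
    using rep_torus_proj[of _ "(s, z)"] by (intro SUP_cong) auto
  also have "\<dots> = torus_proj z"
    using glued_point_self by auto
  finally show ?thesis .
qed

lemma punctured_pt_iff:
  "s \<in> squares Q \<Longrightarrow> z \<in> unit_square \<Longrightarrow> pt s z \<in> punctured_surface Q \<longleftrightarrow> \<not> corner z"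
  by (simp add: punctured_surface_def covering_pt torus_proj_eq_iff corner_def)

lemma openin_squares_iff:
  "openin (squares_topology Q) W \<longleftrightarrow> W \<subseteq> squares Q \<times> unit_square \<and>
     (\<forall>s\<in>squares Q. openin (top_of_set unit_square) {z. (s, z) \<in> W})"
proof (intro iffI conjI ballI)
  assume W: "openin (squares_topology Q) W"
  then show sub: "W \<subseteq> squares Q \<times> unit_square"
    using openin_subset topspace_squares by blast
  fix s assume s: "s \<in> squares Q"
  have "continuous_map (top_of_set unit_square) (squares_topology Q) (\<lambda>z. (s, z))"
    using s unfolding squares_topology_def by (intro continuous_map_pairedI) auto
  from openin_continuous_map_preimage[OF this W]
  show "openin (top_of_set unit_square) {z. (s, z) \<in> W}"
    using sub by (auto elim!: back_subst[of "openin _"])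
next
  assume *: "W \<subseteq> squares Q \<times> unit_square \<and>
     (\<forall>s\<in>squares Q. openin (top_of_set unit_square) {z. (s, z) \<in> W})"
  have "W = (\<Union>s\<in>squares Q. {s} \<times> {z. (s, z) \<in> W})"
    using * by auto
  moreover have "openin (squares_topology Q) (\<Union>s\<in>squares Q. {s} \<times> {z. (s, z) \<in> W})"
    using * unfolding squares_topology_def by (intro openin_Union) (auto simp: openin_prod_Times_iff)
  ultimately show "openin (squares_topology Q) W"
    by simp
qed

lemma openin_X_iff:
  "openin X U \<longleftrightarrow> U \<subseteq> topspace X \<and>
     (\<forall>s\<in>squares Q. openin (top_of_set unit_square) {z \<in> unit_square. pt s z \<in> U})"
  unfolding surface_def openin_quotient_topology topspace_quotient_topology openin_squares_iff
  by (auto simp: topspace_squares)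

lemma continuous_map_glued: "continuous_map (squares_topology Q) X (glued_point Q)"
  unfolding surface_def by (rule quotient_imp_continuous_map[OF quotient_map_quotient_topology])

lemma continuous_map_pt:
  assumes "s \<in> squares Q" "continuous_map T (top_of_set unit_square) f"
  shows "continuous_map T X (\<lambda>t. pt s (f t))"
proof -
  have "continuous_map T (squares_topology Q) (\<lambda>t. (s, f t))"
    using assms unfolding squares_topology_def by (intro continuous_map_pairedI) auto
  from continuous_map_compose[OF this continuous_map_glued] show ?thesis
    by (simp add: o_def)
qed

lemma continuous_map_surface_map:
  fixes F :: "'s \<times> plane \<Rightarrow> 'b::topological_space"
  assumes F: "\<And>y y'. (y, y') \<in> gluing Q \<Longrightarrow> F y = F y'"
    and cont: "\<And>s. s \<in> squares Q \<Longrightarrow> continuous_on unit_square (\<lambda>z. F (s, z))"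
  shows "continuous_map X euclidean (surface_map F)"
proof (rule continuous_compose_quotient_map)
  show "quotient_map (squares_topology Q) X (glued_point Q)"
    unfolding surface_def by (rule quotient_map_quotient_topology)
  have eq: "surface_map F \<circ> glued_point Q = F"
    using surface_map_pt[OF F] by (auto simp: fun_eq_iff)
  show "continuous_map (squares_topology Q) euclidean (surface_map F \<circ> glued_point Q)"
    unfolding eq continuous_map_def
  proof (intro conjI allI impI)
    fix U :: "'b set" assume U: "openin euclidean U"
    have "openin (top_of_set unit_square) (unit_square \<inter> (\<lambda>z. F (s, z)) -` U)" if "s \<in> squares Q" for s
      using cont[OF that] U by (intro continuous_openin_preimage_gen) auto
    moreover have "{z. (s, z) \<in> {y \<in> topspace (squares_topology Q). F y \<in> U}} = unit_square \<inter> (\<lambda>z. F (s, z)) -` U"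
      if "s \<in> squares Q" for s
      using that by (auto simp: topspace_squares)
    ultimately show "openin (squares_topology Q) {y \<in> topspace (squares_topology Q). F y \<in> U}"
      unfolding openin_squares_iff by (auto simp: topspace_squares)
  qed auto
qed

text \<open>If only one coordinate of a point is 0 or 1, then the gluing leads across one side, and from there
  only back.\<close>

lemma rep_not_corner:
  assumes y: "(t, w) \<in> pt s z" and s: "s \<in> squares Q" and z: "z \<in> unit_square" and nc: "\<not> corner z"
  shows "(t, w) = (s, z) \<or> (\<exists>i. z $ i = 1 \<and> (t, w) = (nxt Q i s, z - axis i 1))
     \<or> (\<exists>i. z $ i = 0 \<and> (t, w) = (prv Q i s, z + axis i 1))" (is "?B (t, w)")
  using y
proof (induction rule: glued_point_induct)
  case base
  then show ?case by simp
next
  case (step y y')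
  have other: False if "z $ i = 0 \<or> z $ i = 1" "z $ j = 0 \<or> z $ j = 1" "i \<noteq> j" for i j
  proof -
    have "z $ k \<in> \<int>" for k
      using index_2[OF that(3), of k] that(1,2) by auto
    with nc show False
      by (simp add: corner_def)
  qed
  have ax: "axis i (1::real) $ j = (if j = i then 1 else 0)" for i j :: 2
    by (simp add: axis_def)
  from step(2) show ?case
  proof
    assume "(y, y') \<in> gluing Q"
    then obtain s' z' j where y: "y = (s', z')" "y' = (nxt Q j s', z' - axis j 1)"
      "s' \<in> squares Q" "z' $ j = 1"
      by (elim gluingE) blast
    from step(1) consider "y = (s, z)" | i where "z $ i = 1" "y = (nxt Q i s, z - axis i 1)"
      | i where "z $ i = 0" "y = (prv Q i s, z + axis i 1)" by blast
    then show "?B y'"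
    proof cases
      case 1
      then show ?thesis using y by auto
    next
      case (2 i)
      then have z': "z' = z - axis i 1" using y(1) by simp
      then have "j \<noteq> i" using y(4) 2(1) by (auto simp: ax)
      moreover have "z $ j = 1" using y(4) z' \<open>j \<noteq> i\<close> by (simp add: ax)
      ultimately show ?thesis using other[of i j] 2(1) by auto
    next
      case (3 i)
      then have z': "z' = z + axis i 1" "s' = prv Q i s" using y(1) by auto
      show ?thesis
      proof (cases "j = i")
        case True
        then show ?thesis using y(2) z' s by simp
      next
        case False
        then have "z $ j = 1" using y(4) z' by (simp add: ax)
        then show ?thesis using other[of i j] 3(1) False by auto
      qed
    qed
  next
    assume "(y', y) \<in> gluing Q"
    then obtain s' z' j where y: "y' = (s', z')" "y = (nxt Q j s', z' - axis j 1)"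
      "s' \<in> squares Q" "z' $ j = 1"
      by (elim gluingE) blast
    from step(1) consider "y = (s, z)" | i where "z $ i = 1" "y = (nxt Q i s, z - axis i 1)"
      | i where "z $ i = 0" "y = (prv Q i s, z + axis i 1)" by blast
    then show "?B y'"
    proof cases
      case 1
      then have "z $ j = 0" "z' = z + axis j 1" "s' = prv Q j s"
        using y by (auto simp: ax)
      then show ?thesis using y(1) by blast
    next
      case (2 i)
      show ?thesis
      proof (cases "j = i")
        case True
        then have "z' = z" using y 2 by simp
        moreover have "nxt Q i s' = nxt Q i s" using y 2 True by simp
        then have "s' = s" using y(3) s by (metis prv_nxt)
        ultimately show ?thesis using y(1) by simp
      next
        case False
        then have "z $ j = 0"
          using y 2 by (auto simp: ax vec_eq_iff dest!: spec[of _ j])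
        then show ?thesis using other[of i j] 2(1) False by auto
      qed
    next
      case (3 i)
      then have z': "z' - axis j 1 = z + axis i 1" using y(2) by simp
      have "j \<noteq> i"
      proof
        assume "j = i"
        then have "(z' - axis j 1) $ i = (z + axis i 1) $ i" using z' by simp
        then show False using \<open>j = i\<close> y(4) 3(1) by (simp add: ax)
      qed
      moreover have "(z' - axis j 1) $ j = (z + axis i 1) $ j" using z' by simp
      then have "z $ j = 0" using \<open>j \<noteq> i\<close> y(4) by (simp add: ax)
      ultimately show ?thesis using other[of i j] 3(1) by auto
    qed
  qed
qed

lemma rep_interior:
  assumes "(t, w) \<in> pt s z" "s \<in> squares Q" "\<And>i. 0 < z $ i \<and> z $ i < 1"
  shows "(t, w) = (s, z)"
proof -
  have "z \<in> unit_square"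
    using assms(3) by (auto simp: mem_unit_square intro: less_imp_le)
  moreover have "\<not> corner z"
    using assms(3)[of 1] unit_Ints_iff[of "z $ 1"] by (auto simp: corner_def)
  ultimately show ?thesis
    using rep_not_corner[OF assms(1,2)] assms(3) by (metis less_irrefl)
qed

text \<open>The saturation of a closed set consists of the set itself, its translates across the sides and
  finitely many corners.\<close>

lemma closed_map_glued: "closed_map (squares_topology Q) X (glued_point Q)"
  unfolding closed_map_def
proof (intro allI impI)
  fix C assume C: "closedin (squares_topology Q) C"
  then have sub: "C \<subseteq> squares Q \<times> unit_square"
    using closedin_subset topspace_squares by blast
  have slice: "closed {z. (s, z) \<in> C}" if s: "s \<in> squares Q" for s
  proof -
    have "openin (top_of_set unit_square) {z. (s, z) \<in> squares Q \<times> unit_square - C}"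
      using C s unfolding closedin_def topspace_squares openin_squares_iff by blast
    moreover have "{z. (s, z) \<in> squares Q \<times> unit_square - C} = unit_square - {z. (s, z) \<in> C}"
      using s by auto
    ultimately have "closedin (top_of_set unit_square) {z. (s, z) \<in> C}"
      using sub by (auto simp: closedin_def)
    then show ?thesis
      using closedin_closed_trans closed_cbox by blast
  qed
  have "openin X (topspace X - glued_point Q ` C)"
    unfolding openin_X_iff
  proof (intro conjI ballI)
    fix s assume s: "s \<in> squares Q"
    define A where "A = (\<Union>i. {z \<in> unit_square. z $ i = 1 \<and> z - axis i 1 \<in> {w. (nxt Q i s, w) \<in> C}})"
    define B where "B = (\<Union>i. {z \<in> unit_square. z $ i = 0 \<and> z + axis i 1 \<in> {w. (prv Q i s, w) \<in> C}})"
    define K where "K = {z \<in> unit_square. corner z \<and> pt s z \<in> glued_point Q ` C}"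
    have shift: "closed {z. (t, f z) \<in> C}" if "t \<in> squares Q" "continuous_on UNIV f" for t and f :: "plane \<Rightarrow> plane"
      using closed_vimage[OF slice[OF that(1)] that(2)] by (simp add: vimage_def)
    have "closed A" "closed B"
      unfolding A_def B_def using s
      by (auto intro!: closed_UN closed_Collect_conj closed_Collect_eq continuous_intros closed_cbox shift
          simp flip: Collect_conj_eq)
    moreover have "finite K"
    proof (rule finite_subset)
      have "z \<in> (\<lambda>(p, q). \<chi> i. if i = 1 then p else q) ` ({0, 1} \<times> {0, 1})" if "z \<in> K" for z :: plane
      proof -
        have "z $ i = 0 \<or> z $ i = 1" for i
          using that unit_Ints_iff[of "z $ i"] by (auto simp: K_def corner_def mem_unit_square)
        then have "(z $ 1, z $ 2) \<in> {0, 1} \<times> {0, 1}" by blast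
        moreover have "z = (\<lambda>(p, q). \<chi> i. if i = 1 then p else q) (z $ 1, z $ 2)"
          by (simp add: vec_eq_iff forall_2)
        ultimately show ?thesis by blast
      qed
      then show "K \<subseteq> (\<lambda>(p, q). \<chi> i. if i = 1 then p else q) ` ({0, 1} \<times> {0, 1})" by blast
    qed auto
    ultimately have closed: "closed ({z. (s, z) \<in> C} \<union> A \<union> B \<union> K)"
      using slice[OF s] finite_imp_closed[OF \<open>finite K\<close>] by (intro closed_Un)
    have "{z \<in> unit_square. pt s z \<in> glued_point Q ` C} = {z. (s, z) \<in> C} \<union> A \<union> B \<union> K"
    proof (intro equalityI subsetI)
      fix z assume "z \<in> {z \<in> unit_square. pt s z \<in> glued_point Q ` C}"
      then obtain t w where z: "z \<in> unit_square" "(t, w) \<in> C" "pt s z = pt t w" by auto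
      then have "(t, w) \<in> pt s z" by (simp add: glued_point_eq_iff)
      show "z \<in> {z. (s, z) \<in> C} \<union> A \<union> B \<union> K"
      proof (cases "corner z")
        case True
        then show ?thesis using z by (auto simp: K_def)
      next
        case False
        from rep_not_corner[OF \<open>(t, w) \<in> pt s z\<close> s z(1) False] show ?thesis
          using z by (auto simp: A_def B_def)
      qed
    next
      fix z assume "z \<in> {z. (s, z) \<in> C} \<union> A \<union> B \<union> K"
      then consider "(s, z) \<in> C" | "z \<in> A" | "z \<in> B" | "z \<in> K" by blast
      then show "z \<in> {z \<in> unit_square. pt s z \<in> glued_point Q ` C}"
      proof cases
        case 1
        then show ?thesis using sub by auto
      next
        case 2
        then obtain i where i: "z \<in> unit_square" "z $ i = 1" "(nxt Q i s, z - axis i 1) \<in> C"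
          by (auto simp: A_def)
        then show ?thesis using pt_glue[OF s i(1,2)] by (auto intro!: image_eqI[OF _ i(3)])
      next
        case 3
        then obtain i where i: "z \<in> unit_square" "z $ i = 0" "(prv Q i s, z + axis i 1) \<in> C"
          by (auto simp: B_def)
        have "pt (nxt Q i (prv Q i s)) (z + axis i 1 - axis i 1) = pt (prv Q i s) (z + axis i 1)"
          using i(2) sub i(3) s by (intro pt_glue) (auto simp: axis_def)
        then show ?thesis using i s by (auto intro!: image_eqI[OF _ i(3)])
      next
        case 4
        then show ?thesis by (auto simp: K_def)
      qed
    qed
    then have "{z \<in> unit_square. pt s z \<in> topspace X - glued_point Q ` C}
        = unit_square - ({z. (s, z) \<in> C} \<union> A \<union> B \<union> K)"
      using s by auto
    then show "openin (top_of_set unit_square) {z \<in> unit_square. pt s z \<in> topspace X - glued_point Q ` C}"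
      using openin_open_Int[OF open_Compl[OF closed], of unit_square] by (simp only: Diff_eq)
  qed blast
  moreover have "glued_point Q ` C \<subseteq> topspace X"
    using sub by (auto simp: topspace_X)
  ultimately show "closedin X (glued_point Q ` C)"
    by (simp add: closedin_def)
qed

lemma Hausdorff_X: "Hausdorff_space X"
proof -
  have "Hausdorff_space (squares_topology Q)" "compact_space (squares_topology Q)"
    unfolding squares_topology_def
    by (auto simp: Hausdorff_space_prod_topology compact_space_prod_topology Hausdorff_space_subtopology
        compact_space_subtopology compact_space_discrete_topology finite_squares)
  then have "normal_space (squares_topology Q)"
    by (simp add: compact_Hausdorff_or_regular_imp_normal_space)
  then show ?thesis
    using normal_Hausdorff_space_closed_continuous_map_image[OF _ _ closed_map_glued continuous_map_glued]
      \<open>Hausdorff_space (squares_topology Q)\<close> by (simp add: topspace_X topspace_squares)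
qed

text \<open>A set of squares that is invariant under both gluing permutations is a union of sheets, so its
  image in the surface is open and closed.\<close>

lemma squares_connected:
  assumes A: "A \<subseteq> squares Q" "A \<noteq> {}" and nxt: "\<And>i s. s \<in> A \<Longrightarrow> nxt Q i s \<in> A"
  shows "A = squares Q"
proof -
  have img: "nxt Q i ` A = A" for i
  proof (rule card_subset_eq)
    show "finite A" using A finite_squares finite_subset by blast
    show "nxt Q i ` A \<subseteq> A" using nxt by blast
    have "inj_on (nxt Q i) A" using bij_nxt A(1) by (meson bij_betw_imp_inj_on inj_on_subset)
    then show "card (nxt Q i ` A) = card A" by (rule card_image)
  qed
  have iff: "nxt Q i s \<in> A \<longleftrightarrow> s \<in> A" if "s \<in> squares Q" for i s
  proof
    assume "nxt Q i s \<in> A"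
    then obtain t where "t \<in> A" "nxt Q i s = nxt Q i t" using img[of i] by blast
    then show "s \<in> A" using that A(1) prv_nxt by (metis subsetD)
  qed (use nxt in blast)
  have "fst y \<in> A \<longleftrightarrow> fst y' \<in> A" if "(y, y') \<in> gluing Q" for y y'
    using that by (elim gluingE) (simp add: iff)
  then have cls: "fst y' \<in> A \<longleftrightarrow> fst y \<in> A" if "y' \<in> glued_point Q y" for y y'
    using compatible_class[of "\<lambda>y. fst y \<in> A", OF _ that] by blast
  define U where "U = glued_point Q ` (A \<times> unit_square)"
  have U: "pt t z \<in> U \<longleftrightarrow> t \<in> A" if "z \<in> unit_square" for t z
  proof
    assume "pt t z \<in> U"
    then obtain s w where "s \<in> A" "pt t z = pt s w" by (auto simp: U_def)
    then show "t \<in> A" using cls[of "(s, w)" "(t, z)"] by (simp add: glued_point_eq_iff)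
  qed (use that in \<open>auto simp: U_def\<close>)
  have Usub: "U \<subseteq> topspace X" using A(1) by (auto simp: U_def topspace_X)
  have "openin X U"
    unfolding openin_X_iff
  proof (intro conjI ballI Usub)
    fix t assume "t \<in> squares Q"
    show "openin (top_of_set unit_square) {z \<in> unit_square. pt t z \<in> U}"
      by (cases "t \<in> A") (simp_all add: U cong: conj_cong)
  qed
  moreover have "openin X (topspace X - U)"
    unfolding openin_X_iff
  proof (intro conjI ballI)
    fix t assume t: "t \<in> squares Q"
    show "openin (top_of_set unit_square) {z \<in> unit_square. pt t z \<in> topspace X - U}"
      using t by (cases "t \<in> A") (simp_all add: U cong: conj_cong)
  qed blast
  then have "closedin X U" using Usub by (simp add: closedin_def)
  ultimately have "U = {} \<or> U = topspace X"
    using origami by (auto simp: is_origami_def connected_space_clopen_in)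
  moreover have "U \<noteq> {}" using A(2) U[of 0] by (auto simp: mem_unit_square)
  ultimately have "U = topspace X" by blast
  then have "t \<in> A" if "t \<in> squares Q" for t
    using U[of 0 t] pt_in[OF that, of 0] by (simp add: mem_unit_square)
  then show ?thesis using A(1) by blast
qed

definition seg :: "'s \<Rightarrow> plane \<Rightarrow> plane \<Rightarrow> real \<Rightarrow> 's point" where
  "seg s z w = (\<lambda>t. pt s (linepath z w t))"

lemma linepath_in_square: "z \<in> unit_square \<Longrightarrow> w \<in> unit_square \<Longrightarrow> t \<in> {0..1} \<Longrightarrow> linepath z w t \<in> unit_square"
  using linepath_in_convex_hull[of z _ w t] closed_segment_subset[of z unit_square w]
  by (meson convex_box(1) linepath_in_path subsetD)

lemma seg_path:
  assumes "s \<in> squares Q" "z \<in> unit_square" "w \<in> unit_square"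
  shows "seg s z w \<in> paths_between X (pt s z) (pt s w)"
proof -
  have "continuous_map (top_of_set {0..1}) (top_of_set unit_square) (linepath z w)"
    using linepath_in_square[OF assms(2,3)]
    by (auto simp: continuous_map_in_subtopology intro: continuous_on_linepath)
  then have "pathin X (seg s z w)"
    unfolding pathin_def seg_def by (rule continuous_map_pt[OF assms(1)])
  then show ?thesis
    by (simp add: paths_between_def seg_def linepath_0' linepath_1')
qed

lemma axis_in_square [simp]: "axis i 1 \<in> unit_square" "0 \<in> unit_square" "1 \<in> unit_square"
  by (auto simp: mem_unit_square axis_def)

lemma pt_axis: "s \<in> squares Q \<Longrightarrow> pt s (axis i 1) = pt (nxt Q i s) 0"
  using pt_glue[of s "axis i 1" i] axis_in_square(1)[of i] by (simp add: axis_nth)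

lemma path_exists:
  assumes "x \<in> topspace X" "y \<in> topspace X"
  obtains c where "c \<in> paths_between X x y"
proof -
  obtain s z where x: "s \<in> squares Q" "z \<in> unit_square" "x = pt s z"
    by (rule topspace_XE[OF assms(1)])
  obtain t w where y: "t \<in> squares Q" "w \<in> unit_square" "y = pt t w"
    by (rule topspace_XE[OF assms(2)])
  let ?A = "{t \<in> squares Q. paths_between X x (pt t 0) \<noteq> {}}"
  have "?A = squares Q"
  proof (rule squares_connected)
    show "?A \<noteq> {}"
      using x seg_path[of s z 0] by auto
    fix i t assume "t \<in> ?A"
    then obtain c where c: "t \<in> squares Q" "c \<in> paths_between X x (pt t 0)" by blast
    have "path_join c (seg t 0 (axis i 1)) \<in> paths_between X x (pt (nxt Q i t) 0)"
      using paths_between_join[OF c(2) seg_path[of t 0 "axis i 1"]] c(1) by (simp add: pt_axis)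
    then show "nxt Q i t \<in> ?A" using c(1) by auto
  qed auto
  then obtain c where "c \<in> paths_between X x (pt t 0)" using y(1) by blast
  from paths_between_join[OF this seg_path[OF y(1) _ y(2), of 0]] that y(3) show thesis by simp
qed

end

section \<open>Charts of the translation structure\<close>

context origami_surface
begin

text \<open>A local section of the covering is the inverse of a chart.  It is injective if its domain contains no
  two points that differ by an integral vector, because the covering recovers a point up to such a
  vector.\<close>

lemma section_chart:
  assumes W: "open W"
    and cov: "\<And>z. z \<in> W \<Longrightarrow> covering (\<psi> z) = torus_proj z"
    and nc: "\<And>z. z \<in> W \<Longrightarrow> \<not> corner z"
    and small: "\<And>z w. z \<in> W \<Longrightarrow> w \<in> W \<Longrightarrow> (\<forall>i. z $ i - w $ i \<in> \<int>) \<Longrightarrow> z = w"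
    and cont: "continuous_map (top_of_set W) X \<psi>"
    and opn: "\<And>W'. open W' \<Longrightarrow> W' \<subseteq> W \<Longrightarrow> openin X (\<psi> ` W')"
  shows "translation_chart Q (\<psi> ` W) (inv_into W \<psi>)"
proof -
  have inj: "inj_on \<psi> W"
    using cov small by (metis inj_onI torus_proj_eq_iff)
  have inv: "inv_into W \<psi> (\<psi> z) = z" if "z \<in> W" for z
    using inj that by (rule inv_into_f_f)
  have img: "inv_into W \<psi> ` \<psi> ` W = W"
    using inv by force
  have sub: "\<psi> ` W \<subseteq> topspace X"
    using continuous_map_image_subset_topspace[OF cont] by simp
  have "\<psi> z \<in> punctured_surface Q" if "z \<in> W" for z
    using that sub cov[OF that] nc[OF that] by (auto simp: punctured_surface_def torus_proj_eq_iff corner_def)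
  moreover have "homeomorphic_map (subtopology X (\<psi> ` W)) (top_of_set W) (inv_into W \<psi>)"
    unfolding homeomorphic_map_maps homeomorphic_maps_def
  proof (intro exI[of _ \<psi>] conjI)
    show "continuous_map (top_of_set W) (subtopology X (\<psi> ` W)) \<psi>"
      using cont by (auto simp: continuous_map_in_subtopology)
    show "continuous_map (subtopology X (\<psi> ` W)) (top_of_set W) (inv_into W \<psi>)"
      unfolding continuous_map_def
    proof (intro conjI allI impI)
      fix V assume "openin (top_of_set W) V"
      then have V: "open V" "V \<subseteq> W"
        using W by (auto simp: openin_open_eq)
      have "{x \<in> topspace (subtopology X (\<psi> ` W)). inv_into W \<psi> x \<in> V} = \<psi> ` V \<inter> \<psi> ` W"
        using sub inv V by (auto, metis subsetD)
      then show "openin (subtopology X (\<psi> ` W)) {x \<in> topspace (subtopology X (\<psi> ` W)). inv_into W \<psi> x \<in> V}"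
        using opn[OF V] by (auto simp: openin_subtopology)
    qed (use inv in auto)
  qed (use inv in auto)
  ultimately show ?thesis
    unfolding translation_chart_def using opn[OF W] W img cov inv by auto
qed

lemma chart_interior:
  assumes s: "s \<in> squares Q"
  shows "openin X (pt s ` box 0 1)" "translation_chart Q (pt s ` box 0 1) (inv_into (box 0 1) (pt s))"
proof -
  have box: "z \<in> box 0 1 \<longleftrightarrow> (\<forall>i. 0 < z $ i \<and> z $ i < 1)" for z :: plane
    by (simp add: mem_box_cart)
  have opn: "openin X (pt s ` W')" if W': "open W'" "W' \<subseteq> box 0 1" for W'
    unfolding openin_X_iff
  proof (intro conjI ballI)
    show "pt s ` W' \<subseteq> topspace X"
      using s W'(2) box_subset_cbox by (auto intro!: pt_in)
    fix t assume "t \<in> squares Q"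
    have "{z \<in> unit_square. pt t z \<in> pt s ` W'} = unit_square \<inter> {z. t = s \<and> z \<in> W'}"
    proof -
      have "t = s \<and> z \<in> W'" if z: "pt t z = pt s w" "w \<in> W'" for z w
      proof -
        have "(t, z) \<in> pt s w"
          using z(1) by (simp add: glued_point_eq_iff[symmetric])
        then have "(t, z) = (s, w)"
          by (rule rep_interior[OF _ s]) (use W'(2) z(2) box in blast)
        then show ?thesis using z(2) by simp
      qed
      then show ?thesis by auto
    qed
    moreover have "open {z. t = s \<and> z \<in> W'}"
      using W'(1) by (cases "t = s") auto
    ultimately show "openin (top_of_set unit_square) {z \<in> unit_square. pt t z \<in> pt s ` W'}"
      by (simp add: openin_open_Int)
  qed
  from opn[of "box 0 1"] show "openin X (pt s ` box 0 1)"
    by (simp add: open_box)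
  show "translation_chart Q (pt s ` box 0 1) (inv_into (box 0 1) (pt s))"
  proof (rule section_chart)
    show "continuous_map (top_of_set (box 0 1)) X (pt s)"
      using continuous_map_pt[OF s, of "top_of_set (box 0 1)" "\<lambda>z. z"] box_subset_cbox
      by (auto simp: continuous_map_in_subtopology)
    show "\<not> corner z" if "z \<in> box 0 1" for z
    proof -
      have "0 < z $ 1" "z $ 1 < 1"
        using that by (auto simp: box)
      then show ?thesis
        using unit_Ints_iff[of "z $ 1"] by (auto simp: corner_def)
    qed
    show "z = w" if "z \<in> box 0 1" "w \<in> box 0 1" "\<forall>i. z $ i - w $ i \<in> \<int>" for z w :: plane
    proof -
      have "0 < z $ i \<and> z $ i < 1 \<and> 0 < w $ i \<and> w $ i < 1" for i
        using that(1,2) by (simp add: box)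
      then have "\<bar>z $ i - w $ i\<bar> < 1" for i
        by (smt (verit))
      then have "z $ i - w $ i = 0" for i
        using that(3) Ints_nonzero_abs_less1[of "z $ i - w $ i"] by blast
      then show ?thesis by (simp add: vec_eq_iff)
    qed
  qed (use opn in \<open>auto simp: covering_pt open_box\<close>)
qed

text \<open>The right half of \<open>s\<close> and the left half of its neighbour (or the upper and the lower half) form
  one rectangle.  Its width is 1 so that it contains no two points with the same image in the torus,
  even if the square is its own neighbour.\<close>

lemma chart_across_side:
  fixes i :: 2
  assumes s: "s \<in> squares Q"
  defines "W \<equiv> {z. 1/2 < z $ i \<and> z $ i < 3/2 \<and> (\<forall>j. j \<noteq> i \<longrightarrow> 0 < z $ j \<and> z $ j < 1)}"
  shows "\<exists>\<psi>. translation_chart Q (\<psi> ` W) (inv_into W \<psi>) \<and> (\<forall>z\<in>W. z $ i \<le> 1 \<longrightarrow> \<psi> z = pt s z)"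
proof -
  define \<psi> where "\<psi> z = (if z $ i \<le> 1 then pt s z else pt (nxt Q i s) (z - axis i 1))" for z
  have ax: "axis i (1::real) $ j = (if j = i then 1 else 0)" for j
    by (simp add: axis_def)
  have opW: "open W"
  proof -
    have "W = {z. 1/2 < z $ i} \<inter> {z. z $ i < 3/2} \<inter> (\<Inter>j\<in>- {i}. {z. 0 < z $ j} \<inter> {z. z $ j < 1})"
      by (auto simp: W_def)
    then show ?thesis
      by (auto intro!: open_Int open_INT open_Collect_less continuous_intros)
  qed
  have low: "z \<in> unit_square" if "z \<in> W" "z $ i \<le> 1" for z
    unfolding mem_unit_square
  proof
    fix j show "0 \<le> z $ j \<and> z $ j \<le> 1"
      using that by (cases "j = i") (auto simp: W_def intro: less_imp_le)
  qed
  have high: "0 < (z - axis i 1) $ j \<and> (z - axis i 1) $ j < 1" if "z \<in> W" "z $ i > 1" for z j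
    using that by (cases "j = i") (auto simp: W_def ax)
  have high': "z - axis i 1 \<in> unit_square" if "z \<in> W" "z $ i \<ge> 1" for z
    unfolding mem_unit_square
  proof
    fix j show "0 \<le> (z - axis i 1) $ j \<and> (z - axis i 1) $ j \<le> 1"
      using that by (cases "j = i") (auto simp: W_def ax intro: less_imp_le)
  qed
  obtain j where j: "j \<noteq> i"
    by (metis exhaust_2 zero_neq_one num1_eq_iff one_neq_zero)
  have nc: "\<not> corner z" if "z \<in> W" for z
    using that j unit_Ints_iff[of "z $ j"] by (force simp: W_def corner_def)
  have opn: "openin X (\<psi> ` W')" if W': "open W'" "W' \<subseteq> W" for W'
    unfolding openin_X_iff
  proof (intro conjI ballI)
    show "\<psi> ` W' \<subseteq> topspace X"
      using W'(2) low high' s by (auto simp: \<psi>_def intro!: pt_in)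
    fix t assume t: "t \<in> squares Q"
    let ?R = "{z. (t = s \<and> z \<in> W') \<or> (t = nxt Q i s \<and> z + axis i 1 \<in> W')}"
    have "{z \<in> unit_square. pt t z \<in> \<psi> ` W'} = unit_square \<inter> ?R"
    proof (intro equalityI subsetI)
      fix z assume "z \<in> {z \<in> unit_square. pt t z \<in> \<psi> ` W'}"
      then obtain w where z: "z \<in> unit_square" "pt t z = \<psi> w" "w \<in> W'" by auto
      then have w: "w \<in> W" using W'(2) by blast
      show "z \<in> unit_square \<inter> ?R"
      proof (cases "w $ i \<le> 1")
        case True
        then have "(t, z) \<in> pt s w"
          using z(2) by (simp add: \<psi>_def flip: glued_point_eq_iff)
        from rep_not_corner[OF this s low[OF w True] nc[OF w]]
        consider "(t, z) = (s, w)" | k where "w $ k = 1" "(t, z) = (nxt Q k s, w - axis k 1)"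
          | k where "w $ k = 0" by blast
        then show ?thesis
        proof cases
          case 1
          then show ?thesis using z by simp
        next
          case (2 k)
          then have "k = i" using w by (force simp: W_def)
          then show ?thesis using z 2 by simp
        next
          case (3 k)
          then show ?thesis using w by (cases "k = i") (force simp: W_def)+
        qed
      next
        case False
        then have "(t, z) \<in> pt (nxt Q i s) (w - axis i 1)"
          using z(2) by (simp add: \<psi>_def flip: glued_point_eq_iff)
        then have "(t, z) = (nxt Q i s, w - axis i 1)"
          by (rule rep_interior) (use s high[OF w] False in auto)
        then show ?thesis using z by simp
      qed
    next
      fix z assume z: "z \<in> unit_square \<inter> ?R"
      then consider "t = s" "z \<in> W'" | "t = nxt Q i s" "z + axis i 1 \<in> W'" by blast
      then have "pt t z \<in> \<psi> ` W'"
      proof cases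
        case 1
        then have "\<psi> z = pt t z" using z by (simp add: \<psi>_def mem_unit_square)
        then show ?thesis using 1 by (metis imageI)
      next
        case 2
        have "\<psi> (z + axis i 1) = pt t z"
        proof (cases "z $ i = 0")
          case True
          then have "z + axis i 1 \<in> unit_square"
            using low[of "z + axis i 1"] 2(2) W'(2) by (auto simp: ax)
          then have "pt (nxt Q i s) (z + axis i 1 - axis i 1) = pt s (z + axis i 1)"
            using True by (intro pt_glue[OF s]) (auto simp: ax)
          then show ?thesis using True 2(1) by (simp add: \<psi>_def ax)
        next
          case False
          then have "z $ i > 0" using z by (auto simp: mem_unit_square less_le)
          then show ?thesis using 2(1) by (simp add: \<psi>_def ax)
        qed
        then show ?thesis using 2 by (metis imageI)
      qed
      then show "z \<in> {z \<in> unit_square. pt t z \<in> \<psi> ` W'}" using z by simp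
    qed
    moreover have "open ((\<lambda>z. z + axis i 1) -` W')"
      using W'(1) by (intro open_vimage continuous_intros)
    then have "open ?R"
      using W'(1) by (cases "t = s"; cases "t = nxt Q i s") (auto simp: vimage_def intro: open_Collect_disj)
    ultimately show "openin (top_of_set unit_square) {z \<in> unit_square. pt t z \<in> \<psi> ` W'}"
      by (simp add: openin_open_Int)
  qed
  have "translation_chart Q (\<psi> ` W) (inv_into W \<psi>)"
  proof (rule section_chart[OF opW])
    show "covering (\<psi> z) = torus_proj z" for z
      by (simp add: \<psi>_def covering_pt torus_proj_eq_iff ax)
    show "z = w" if "z \<in> W" "w \<in> W" "\<forall>i. z $ i - w $ i \<in> \<int>" for z w
    proof -
      have "\<bar>z $ k - w $ k\<bar> < 1" for k
        using that(1,2) by (cases "k = i") (force simp: W_def)+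
      then have "z $ k - w $ k = 0" for k
        using that(3) Ints_nonzero_abs_less1[of "z $ k - w $ k"] by blast
      then show ?thesis by (simp add: vec_eq_iff)
    qed
    show "continuous_map (top_of_set W) X \<psi>"
      unfolding \<psi>_def
    proof (rule continuous_map_cases_le)
      show "continuous_map (subtopology (top_of_set W) {z \<in> topspace (top_of_set W). z $ i \<le> 1}) X (pt s)"
        using low by (intro continuous_map_pt[OF s, of _ "\<lambda>z. z"])
          (auto simp: continuous_map_in_subtopology subtopology_subtopology)
      show "continuous_map (subtopology (top_of_set W) {z \<in> topspace (top_of_set W). 1 \<le> z $ i}) X
          (\<lambda>z. pt (nxt Q i s) (z - axis i 1))"
        using high' s by (intro continuous_map_pt)
          (auto simp: continuous_map_in_subtopology subtopology_subtopology intro!: continuous_intros)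
      show "pt s z = pt (nxt Q i s) (z - axis i 1)" if "z \<in> topspace (top_of_set W)" "z $ i = 1" for z
        using pt_glue[OF s, of z i] low[of z] that by simp
    qed (auto intro!: continuous_intros)
  qed (use opn nc in auto)
  then show ?thesis
    by (intro exI[of _ \<psi>]) (simp add: \<psi>_def)
qed

lemma chart_exists:
  assumes x: "x \<in> punctured_surface Q"
  obtains U \<phi> where "translation_chart Q U \<phi>" "x \<in> U"
proof -
  have "x \<in> topspace X" using x by (simp add: punctured_surface_def)
  then obtain s z where s: "s \<in> squares Q" and z: "z \<in> unit_square" "x = pt s z"
    by (rule topspace_XE)
  then have nc: "\<not> corner z" using x punctured_pt_iff by simp
  note chart = that
  have edge: thesis if t: "t \<in> squares Q" and w: "w \<in> unit_square" "w $ i = 1" "x = pt t w" "\<not> corner w" for t w i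
  proof -
    let ?W = "{z. 1/2 < z $ i \<and> z $ i < 3/2 \<and> (\<forall>j. j \<noteq> i \<longrightarrow> 0 < z $ j \<and> z $ j < 1)}"
    obtain \<psi> where \<psi>: "translation_chart Q (\<psi> ` ?W) (inv_into ?W \<psi>)" "\<forall>z\<in>?W. z $ i \<le> 1 \<longrightarrow> \<psi> z = pt t z"
      using chart_across_side[OF t, of i] by blast
    have "0 < w $ j \<and> w $ j < 1" if "j \<noteq> i" for j
    proof -
      have "w $ j \<notin> \<int>"
      proof
        assume "w $ j \<in> \<int>"
        then have "w $ k \<in> \<int>" for k using index_2[OF that, of k] w(2) by auto
        then show False using w(4) by (simp add: corner_def)
      qed
      moreover have "0 \<le> w $ j" "w $ j \<le> 1" using w(1) by (auto simp: mem_unit_square)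
      ultimately show ?thesis by (auto simp: less_le)
    qed
    then have wW: "w \<in> ?W" using w(2) by simp
    then have eq: "\<psi> w = x" using \<psi>(2) w(2,3) by auto
    from wW have "\<psi> w \<in> \<psi> ` ?W" by (rule imageI)
    with \<psi>(1) show thesis unfolding eq by (rule chart)
  qed
  consider "\<forall>i. 0 < z $ i \<and> z $ i < 1" | i where "z $ i = 1" | i where "z $ i = 0"
    using z(1) unfolding mem_unit_square by (metis less_le)
  then show thesis
  proof cases
    case 1
    then have "x \<in> pt s ` box 0 1" using z by (auto simp: mem_box_cart)
    with chart_interior(2)[OF s] show thesis by (rule that)
  next
    case (2 i)
    then show thesis using edge[OF s] z nc by blast
  next
    case (3 i)
    let ?w = "z + axis i 1"
    have ax: "axis i (1::real) $ j = (if j = i then 1 else 0)" for j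
      by (simp add: axis_def)
    have w: "?w \<in> unit_square" "?w $ i = 1" using 3 z(1) by (auto simp: mem_unit_square ax)
    have "pt (nxt Q i (prv Q i s)) (?w - axis i 1) = pt (prv Q i s) ?w"
      using w s by (intro pt_glue) auto
    then have "x = pt (prv Q i s) ?w" using s z by simp
    moreover have "\<not> corner ?w"
    proof
      assume "corner ?w"
      then have "?w $ k - axis i 1 $ k \<in> \<int>" for k by (auto simp: corner_def ax intro!: Ints_diff simp del: vector_add_component)
      then show False using nc by (simp add: corner_def)
    qed
    ultimately show thesis using edge[of "prv Q i s" ?w i] w s by simp
  qed
qed

section \<open>Integral cocycles and holonomy\<close>

text \<open>A cellular 1-cochain assigns \<open>e 1 s\<close> to the lower and \<open>e 2 s\<close> to the left side of the square
  \<open>s\<close>.\<close>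

definition cocycle :: "(2 \<Rightarrow> 's \<Rightarrow> real) \<Rightarrow> bool" where
  "cocycle e \<longleftrightarrow> (\<forall>s\<in>squares Q. e 1 s + e 2 (nxt Q 1 s) = e 2 s + e 1 (nxt Q 2 s))"

definition integral_cochain :: "(2 \<Rightarrow> 's \<Rightarrow> real) \<Rightarrow> bool" where
  "integral_cochain e \<longleftrightarrow> (\<forall>s\<in>squares Q. \<forall>i. e i s \<in> \<int>)"

text \<open>The bilinear interpolation of the primitive of a cocycle on the boundary of a square.\<close>

definition interpolation :: "(2 \<Rightarrow> 's \<Rightarrow> real) \<Rightarrow> 's \<Rightarrow> plane \<Rightarrow> real" where
  "interpolation e s z = z $ 1 * e 1 s + z $ 2 * e 2 s + z $ 1 * z $ 2 * (e 2 (nxt Q 1 s) - e 2 s)"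

text \<open>Integral cocycles become maps to the circle which send all vertices to 1 and wind around it along
  each side as often as the cocycle says.\<close>

definition cocycle_circle :: "(2 \<Rightarrow> 's \<Rightarrow> real) \<Rightarrow> 's point \<Rightarrow> complex" where
  "cocycle_circle e = surface_map (\<lambda>(s, z). cis (2 * pi * interpolation e s z))"

lemma cocycle_circle_compatible:
  assumes "cocycle e" "integral_cochain e" "(y, y') \<in> gluing Q"
  shows "(\<lambda>(s, z). cis (2 * pi * interpolation e s z)) y = (\<lambda>(s, z). cis (2 * pi * interpolation e s z)) y'"
proof -
  obtain s z i where y: "y = (s, z)" "y' = (nxt Q i s, z - axis i 1)" "s \<in> squares Q" "z $ i = 1"
    using assms(3) by (elim gluingE) blast
  have "interpolation e s z - interpolation e (nxt Q i s) (z - axis i 1) = e i s"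
  proof (cases "i = 1")
    case True
    then show ?thesis using y(4) by (simp add: interpolation_def axis_def algebra_simps)
  next
    case False
    then have i: "i = 2" using exhaust_2 by blast
    have "e 1 s + e 2 (nxt Q 1 s) = e 2 s + e 1 (nxt Q 2 s)"
      using assms(1) y(3) by (simp add: cocycle_def)
    then have c: "e 1 (nxt Q 2 s) = e 1 s + e 2 (nxt Q 1 s) - e 2 s" by simp
    show ?thesis using y(4) i by (simp add: interpolation_def axis_def c algebra_simps)
  qed
  moreover have "e i s \<in> \<int>" using assms(2) y(3) by (simp add: integral_cochain_def)
  ultimately show ?thesis by (simp add: y cis_eq_iff)
qed

lemma cocycle_circle_pt:
  assumes "cocycle e" "integral_cochain e"
  shows "cocycle_circle e (pt s z) = cis (2 * pi * interpolation e s z)"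
  unfolding cocycle_circle_def by (subst surface_map_pt) (use cocycle_circle_compatible[OF assms] in auto)

lemma circle_map_cocycle_circle:
  assumes "cocycle e" "integral_cochain e"
  shows "circle_map X (cocycle_circle e)"
  unfolding circle_map_def
proof (intro conjI ballI)
  show "continuous_map X euclidean (cocycle_circle e)"
    unfolding cocycle_circle_def
    by (rule continuous_map_surface_map[OF cocycle_circle_compatible[OF assms]])
       (auto simp: interpolation_def cis.ctr intro!: continuous_intros)
  fix x assume "x \<in> topspace X"
  then show "norm (cocycle_circle e x) = 1"
    by (elim topspace_XE) (simp add: cocycle_circle_pt[OF assms])
qed

lemma winding_seg:
  assumes "cocycle e" "integral_cochain e"
  shows "winding (cocycle_circle e) (seg s z w) = interpolation e s w - interpolation e s z"
proof -
  have "angle_lift {0..1} (\<lambda>t. cocycle_circle e (seg s z w t)) (\<lambda>t. interpolation e s (linepath z w t))"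
    unfolding angle_lift_def
    by (auto simp: seg_def cocycle_circle_pt[OF assms] interpolation_def linepath_def intro!: continuous_intros)
  then have "winding (cocycle_circle e) (seg s z w)
      = interpolation e s (linepath z w 1) - interpolation e s (linepath z w 0)"
    by (rule winding_eq)
  then show ?thesis by (simp add: linepath_0' linepath_1')
qed

text \<open>The cocycle of the \<open>i\<close>-th coordinate: a side in direction \<open>i\<close> has displacement 1.\<close>

definition coord :: "2 \<Rightarrow> 2 \<Rightarrow> 's \<Rightarrow> real" where
  "coord i = (\<lambda>j s. if j = i then 1 else 0)"

lemma coord: "cocycle (coord i)" "integral_cochain (coord i)"
  by (auto simp: cocycle_def integral_cochain_def coord_def)

lemma interpolation_coord: "interpolation (coord i) s z = z $ i"
  using exhaust_2[of i] by (auto simp: interpolation_def coord_def)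

text \<open>The holonomy vector is defined for all paths, also for those through vertices of the squares.\<close>

definition hol :: "(real \<Rightarrow> 's point) \<Rightarrow> plane" where
  "hol c = (\<chi> i. winding (cocycle_circle (coord i)) c)"

lemma hol_nth: "hol c $ i = winding (cocycle_circle (coord i)) c"
  by (simp add: hol_def)

lemma hol_path_join: "pathin X c \<Longrightarrow> pathin X d \<Longrightarrow> c 1 = d 0 \<Longrightarrow> hol (path_join c d) = hol c + hol d"
  by (simp add: vec_eq_iff hol_nth winding_path_join[OF circle_map_cocycle_circle[OF coord]])

lemma hol_path_reverse: "pathin X c \<Longrightarrow> hol (path_reverse c) = - hol c"
  by (simp add: vec_eq_iff hol_nth winding_path_reverse[OF circle_map_cocycle_circle[OF coord]])

lemma hol_seg: "hol (seg s z w) = w - z"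
  by (simp add: vec_eq_iff hol_nth winding_seg[OF coord] interpolation_coord)

text \<open>Holonomy is the displacement of a lift of the path in the torus to the plane.\<close>

lemma path_developed:
  assumes c: "pathin X c"
  obtains g where "continuous_on {0..1} g" "\<And>t. t \<in> {0..1} \<Longrightarrow> covering (c t) = torus_proj (g t)"
    "hol c = g 1 - g 0"
proof -
  have "\<exists>\<theta>. angle_lift {0..1} (\<lambda>t. cocycle_circle (coord i) (c t)) \<theta> \<and> hol c $ i = \<theta> 1 - \<theta> 0" for i
    unfolding hol_nth using path_angle_lift[OF circle_map_cocycle_circle[OF coord] c] by metis
  then obtain \<theta> where \<theta>: "\<And>i. angle_lift {0..1} (\<lambda>t. cocycle_circle (coord i) (c t)) (\<theta> i)"
    "\<And>i. hol c $ i = \<theta> i 1 - \<theta> i 0" by metis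
  show thesis
  proof (rule that[of "\<lambda>t. \<chi> i. \<theta> i t"])
    show "continuous_on {0..1} (\<lambda>t. \<chi> i. \<theta> i t)"
      using \<theta>(1) by (intro continuous_on_vec_lambda) (simp add: angle_lift_def)
    show "hol c = (\<chi> i. \<theta> i 1) - (\<chi> i. \<theta> i 0)"
      by (simp add: vec_eq_iff \<theta>(2))
    fix t :: real assume t: "t \<in> {0..1}"
    then have "c t \<in> topspace X" using path_image_subset_topspace[OF c] by auto
    then obtain s z where z: "c t = pt s z" by (rule topspace_XE)
    have "cis (2 * pi * z $ i) = cis (2 * pi * \<theta> i t)" for i
      using angle_liftD[OF \<theta>(1) t, of i] by (simp add: z cocycle_circle_pt[OF coord] interpolation_coord)
    then show "covering (c t) = torus_proj (\<chi> i. \<theta> i t)"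
      by (simp add: z covering_pt torus_proj_eq_iff cis_eq_iff)
  qed
qed

end

section \<open>Affine maps act linearly on holonomy\<close>

context origami_surface
begin

text \<open>A chart and a developed path are both lifts of the covering, so they differ by an integral vector,
  which is constant by continuity.\<close>

lemma chart_lift_constant:
  assumes chart: "translation_chart Q U \<phi>" and J: "connected J"
    and c: "continuous_map (top_of_set J) X c" "c ` J \<subseteq> U"
    and g: "continuous_on J g" "\<And>t. t \<in> J \<Longrightarrow> covering (c t) = torus_proj (g t)"
    and st: "s \<in> J" "t \<in> J"
  shows "g s - \<phi> (c s) = g t - \<phi> (c t)"
proof -
  have "continuous_map (subtopology X U) (top_of_set (\<phi> ` U)) \<phi>"
    using chart unfolding translation_chart_def by (intro homeomorphic_imp_continuous_map) blast
  moreover have "continuous_map (top_of_set J) (subtopology X U) c"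
    using c by (auto simp: continuous_map_in_subtopology)
  ultimately have "continuous_map (top_of_set J) (top_of_set (\<phi> ` U)) (\<phi> \<circ> c)"
    by (rule continuous_map_compose[rotated])
  then have cont: "continuous_on J (\<lambda>t. \<phi> (c t))"
    by (simp add: continuous_map_in_subtopology o_def)
  have int: "g t $ i - \<phi> (c t) $ i \<in> \<int>" if "t \<in> J" for t i
  proof -
    have "torus_proj (g t) = torus_proj (\<phi> (c t))"
      using chart c(2) that g(2)[OF that] unfolding translation_chart_def by auto
    then show ?thesis
      by (simp add: torus_proj_eq_iff)
  qed
  have "(g s - \<phi> (c s)) $ i = (g t - \<phi> (c t)) $ i" for i
    by (rule integer_differences_imp_constant[OF J, where f = "\<lambda>t. (g t - \<phi> (c t)) $ i"])
       (use st in \<open>auto intro!: continuous_intros cont g(1) Ints_diff int\<close>)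
  then show ?thesis
    by (simp add: vec_eq_iff)
qed

text \<open>Along a path, the difference \<open>D\<close> between the developed image of \<open>f\<close> and \<open>A\<close> times the
  developed path is locally constant as long as the path stays in the punctured surface, and takes
  values in a fixed countable set whenever it meets a vertex.  So \<open>D\<close> has countable range, and being
  continuous it is constant.\<close>

lemma hol_affine:
  assumes f: "continuous_map X X f" and A: "affine_with Q f A"
    and punct: "\<And>x. x \<in> topspace X \<Longrightarrow> f x \<in> punctured_surface Q \<longleftrightarrow> x \<in> punctured_surface Q"
    and c: "pathin X c"
  shows "hol (f \<circ> c) = A *v hol c"
proof -
  obtain g where g: "continuous_on {0..1} g" "\<And>t. t \<in> {0..1} \<Longrightarrow> covering (c t) = torus_proj (g t)"
    "hol c = g 1 - g 0"
    using path_developed[OF c] by metis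
  have fc: "pathin X (f \<circ> c)"
    using c f by (rule pathin_compose)
  obtain k where k: "continuous_on {0..1} k" "\<And>t. t \<in> {0..1} \<Longrightarrow> covering ((f \<circ> c) t) = torus_proj (k t)"
    "hol (f \<circ> c) = k 1 - k 0"
    using path_developed[OF fc] by metis
  have top: "c t \<in> topspace X" "f (c t) \<in> topspace X" if "t \<in> {0..1}" for t
    using path_image_subset_topspace[OF c] path_image_subset_topspace[OF fc] that by auto
  define D where "D t = k t - A *v g t" for t
  define T where "T = {t \<in> {0..1}. c t \<notin> punctured_surface Q}"
  define Z where "Z = {v :: plane. \<forall>i. v $ i \<in> \<int>}"
  have "continuous_on {0..1} D"
    unfolding D_def by (intro continuous_intros k g matrix_vector_mult_linear_continuous_on[THEN continuous_on_compose2]) auto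
  moreover have "countable (D ` {0..1})"
  proof -
    have "countable Z"
    proof (rule countable_subset)
      show "Z \<subseteq> (\<lambda>(p, q). \<chi> i. if i = 1 then p else q) ` (\<int> \<times> \<int>)"
      proof
        fix v assume "v \<in> Z"
        then have "(v $ 1, v $ 2) \<in> \<int> \<times> \<int>" by (simp add: Z_def)
        moreover have "v = (\<lambda>(p, q). \<chi> i. if i = 1 then p else q) (v $ 1, v $ 2)"
          by (simp add: vec_eq_iff forall_2)
        ultimately show "v \<in> (\<lambda>(p, q). \<chi> i. if i = 1 then p else q) ` (\<int> \<times> \<int>)" by blast
      qed
      show "countable ((\<lambda>(p, q). (\<chi> i. if i = 1 then p else q) :: plane) ` (\<int> \<times> \<int>))"
        by (intro countable_image countable_SIGMA) (simp_all add: Ints_def)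
    qed
    then have "countable ((\<lambda>(m, n). n - A *v m) ` (Z \<times> Z))"
      by (intro countable_image countable_SIGMA)
    moreover have "D ` T \<subseteq> (\<lambda>(m, n). n - A *v m) ` (Z \<times> Z)"
    proof
      fix d assume "d \<in> D ` T"
      then obtain t where t: "t \<in> {0..1}" "c t \<notin> punctured_surface Q" "d = D t" by (auto simp: T_def)
      then have "covering (c t) = torus_proj 0" "covering (f (c t)) = torus_proj 0"
        using punct[OF top(1)] top by (auto simp: punctured_surface_def)
      then have "g t \<in> Z" "k t \<in> Z"
        using g(2)[OF t(1)] k(2)[OF t(1)] by (auto simp: torus_proj_eq_iff Z_def)
      then show "d \<in> (\<lambda>(m, n). n - A *v m) ` (Z \<times> Z)"
        using t(3) by (auto simp: D_def intro!: image_eqI[of _ _ "(g t, k t)"])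
    qed
    ultimately have "countable (D ` T)"
      by (rule countable_subset[rotated])
    moreover have "countable (D ` ({0..1} - T))"
    proof (rule countable_range_locally_constant)
      fix t assume "t \<in> {0..1} - T"
      then have t: "t \<in> {0..1}" "c t \<in> punctured_surface Q" by (auto simp: T_def)
      obtain U \<phi> where U: "translation_chart Q U \<phi>" "c t \<in> U"
        by (rule chart_exists[OF t(2)])
      have "f (c t) \<in> punctured_surface Q"
        using punct[OF top(1)[OF t(1)]] t(2) by simp
      then obtain V \<psi> where V: "translation_chart Q V \<psi>" "f (c t) \<in> V"
        by (rule chart_exists)
      obtain W b where W: "openin X W" "c t \<in> W" "W \<subseteq> U" "f ` W \<subseteq> V" "\<forall>y\<in>W. \<psi> (f y) = A *v \<phi> y + b"
        using A U V unfolding affine_with_def by metis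
      have "openin (top_of_set {0..1}) {s \<in> topspace (top_of_set {0..1}). c s \<in> W}"
        using c[unfolded pathin_def] W(1) by (rule openin_continuous_map_preimage)
      then obtain e where e: "e > 0" "\<And>s. s \<in> {0..1} \<Longrightarrow> \<bar>s - t\<bar> < e \<Longrightarrow> c s \<in> W"
        using t(1) W(2) unfolding openin_euclidean_subtopology_iff
        by (simp add: dist_real_def) (metis atLeastAtMost_iff)
      define J where "J = {0..1} \<inter> {t - e<..<t + e}"
      have J: "connected J" "J \<subseteq> {0..1}" "t \<in> J"
        using t(1) e(1) by (auto simp: J_def intro!: convex_connected convex_Int)
      have JW: "c ` J \<subseteq> W" using e(2) by (auto simp: J_def)
      have cJ: "continuous_map (top_of_set J) X c" "continuous_map (top_of_set J) X (f \<circ> c)"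
        using c fc J(2) unfolding pathin_def
        by (metis continuous_map_from_subtopology inf.absorb_iff2 subtopology_subtopology)+
      have "D s = D t" if "s \<in> {0..1} - T" "\<bar>s - t\<bar> < e" for s
      proof -
        have s: "s \<in> J" using that by (auto simp: J_def)
        have "g s - \<phi> (c s) = g t - \<phi> (c t)"
          using chart_lift_constant[OF U(1) J(1) cJ(1) _ _ _ s J(3), of g] JW W(3) g(1,2) J(2)
          by (meson continuous_on_subset subset_trans subsetD)
        then have gs: "g s = g t - \<phi> (c t) + \<phi> (c s)" by (simp add: algebra_simps)
        have "(f \<circ> c) ` J \<subseteq> V" using JW W(4) by fastforce
        then have "k s - \<psi> ((f \<circ> c) s) = k t - \<psi> ((f \<circ> c) t)"
          using chart_lift_constant[OF V(1) J(1) cJ(2) _ _ _ s J(3), of k] k(1,2) J(2)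
          by (meson continuous_on_subset subset_trans subsetD)
        then have ks: "k s = k t - \<psi> (f (c t)) + \<psi> (f (c s))" by (simp add: algebra_simps)
        have "c s \<in> W" "c t \<in> W" using JW s J(3) by auto
        then have "\<psi> (f (c s)) = A *v \<phi> (c s) + b" "\<psi> (f (c t)) = A *v \<phi> (c t) + b"
          using W(5) by auto
        then show ?thesis
          by (simp add: D_def gs ks matrix_vector_right_distrib matrix_vector_mult_diff_distrib)
      qed
      then show "\<exists>e>0. \<forall>s\<in>{0..1} - T. \<bar>s - t\<bar> < e \<longrightarrow> D s = D t"
        using e(1) by blast
    qed
    ultimately have "countable (D ` T \<union> D ` ({0..1} - T))"
      by (rule countable_Un)
    then show ?thesis
      by (rule countable_subset[rotated]) (intro subsetI, elim imageE, metis Diff_iff UnI1 UnI2 imageI)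
  qed
  ultimately have "D 0 = D 1"
    by (intro countable_range_imp_constant[of "{0..1::real}"]) auto
  then show ?thesis
    by (simp add: D_def g(3) k(3) matrix_vector_mult_diff_distrib algebra_simps)
qed

text \<open>The columns of the linear part are holonomies of images of sides of a square.\<close>

lemma linear_part_unique:
  assumes f: "continuous_map X X f"
    and punct: "\<And>x. x \<in> topspace X \<Longrightarrow> f x \<in> punctured_surface Q \<longleftrightarrow> x \<in> punctured_surface Q"
    and A: "affine_with Q f A" and B: "affine_with Q f B"
  shows "A = B"
proof -
  obtain s where s: "s \<in> squares Q" using squares_nonempty by blast
  have "A *v axis i 1 = B *v axis i 1" for i
  proof -
    have c: "pathin X (seg s 0 (axis i 1))"
      using seg_path[OF s, of 0 "axis i 1"] by (simp add: paths_between_def)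
    show ?thesis
      using hol_affine[OF f A punct c] hol_affine[OF f B punct c] by (simp add: hol_seg)
  qed
  then have "column i A = column i B" for i
    by (simp add: matrix_vector_mult_basis)
  then show ?thesis
    by (simp add: vec_eq_iff column_def)
qed

section \<open>The affine group\<close>

definition aff_set :: "('s point \<Rightarrow> 's point) set" where
  "aff_set = carrier (aff_group Q)"

lemma aff_setD:
  assumes "f \<in> aff_set"
  shows "f \<in> extensional (topspace X)" "homeomorphic_map X X f" "continuous_map X X f"
    "bij_betw f (topspace X) (topspace X)"
    "\<And>c. c \<in> carrier (homology_group 2 X) \<Longrightarrow> hom_induced 2 X {} X {} f c = c"
    "f ` punctured_surface Q = punctured_surface Q"
    "\<And>x. x \<in> topspace X \<Longrightarrow> f x \<in> topspace X"
    "\<And>x. x \<in> topspace X \<Longrightarrow> f x \<in> punctured_surface Q \<longleftrightarrow> x \<in> punctured_surface Q"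
proof -
  show 1: "f \<in> extensional (topspace X)" "homeomorphic_map X X f"
    "\<And>c. c \<in> carrier (homology_group 2 X) \<Longrightarrow> hom_induced 2 X {} X {} f c = c"
    and p: "f ` punctured_surface Q = punctured_surface Q"
    using assms by (auto simp: aff_set_def aff_group_def orientation_preserving_homeo_def)
  show "continuous_map X X f" by (rule homeomorphic_imp_continuous_map[OF 1(2)])
  have inj: "inj_on f (topspace X)" and surj: "f ` topspace X = topspace X"
    using homeomorphic_imp_injective_map[OF 1(2)] homeomorphic_imp_surjective_map[OF 1(2)] by auto
  then show "bij_betw f (topspace X) (topspace X)" by (simp add: bij_betw_def)
  show "f x \<in> topspace X" if "x \<in> topspace X" for x using surj that by blast
  show "f x \<in> punctured_surface Q \<longleftrightarrow> x \<in> punctured_surface Q" if x: "x \<in> topspace X" for x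
  proof
    assume "f x \<in> punctured_surface Q"
    then obtain y where "y \<in> punctured_surface Q" "f x = f y" using p by (metis imageE)
    then show "x \<in> punctured_surface Q"
      using inj x by (metis (no_types, lifting) inj_onD mem_Collect_eq punctured_surface_def)
  qed (use p in blast)
qed

lemma der_eq:
  assumes "f \<in> aff_set" "affine_with Q f A"
  shows "der Q f = A"
  unfolding der_def
  using assms linear_part_unique[OF aff_setD(3)[OF assms(1)] aff_setD(8)[OF assms(1)]]
  by (intro the_equality) auto

lemma der_affine: "f \<in> aff_set \<Longrightarrow> affine_with Q f (der Q f)" "f \<in> aff_set \<Longrightarrow> det (der Q f) = 1"
proof -
  assume f: "f \<in> aff_set"
  then obtain A where "det A = 1" "affine_with Q f A"
    by (auto simp: aff_set_def aff_group_def)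
  with der_eq[OF f] show "affine_with Q f (der Q f)" "det (der Q f) = 1" by auto
qed

lemma hol_aff: "f \<in> aff_set \<Longrightarrow> pathin X c \<Longrightarrow> hol (f \<circ> c) = der Q f *v hol c"
  by (rule hol_affine[OF aff_setD(3) der_affine(1) aff_setD(8)])

lemma affine_with_cong:
  assumes "affine_with Q f A" "\<And>x. x \<in> topspace X \<Longrightarrow> f x = f' x"
  shows "affine_with Q f' A"
  unfolding affine_with_def
proof (intro allI impI ballI)
  fix U \<phi> V \<psi> x assume c: "translation_chart Q U \<phi> \<and> translation_chart Q V \<psi>" and x: "x \<in> U" "f' x \<in> V"
  then have U: "U \<subseteq> topspace X"
    by (auto simp: translation_chart_def punctured_surface_def)
  then have "f x \<in> V" using assms(2)[of x] x by auto
  then obtain W t where "openin X W" "x \<in> W" "W \<subseteq> U" "f ` W \<subseteq> V" "\<forall>y\<in>W. \<psi> (f y) = A *v \<phi> y + t"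
    using assms(1) c x(1) unfolding affine_with_def by metis
  moreover have "f y = f' y" if "y \<in> W" for y
    using calculation(3) U that assms(2) by blast
  ultimately show "\<exists>W t. openin X W \<and> x \<in> W \<and> W \<subseteq> U \<and> f' ` W \<subseteq> V \<and> (\<forall>y\<in>W. \<psi> (f' y) = A *v \<phi> y + t)"
    by (intro exI[of _ W] exI[of _ t]) (auto simp: image_subset_iff)
qed

lemma affine_with_compose:
  assumes "affine_with Q f A" "affine_with Q g B" "continuous_map X X g"
    and g: "\<And>x. x \<in> punctured_surface Q \<Longrightarrow> g x \<in> punctured_surface Q"
  shows "affine_with Q (f \<circ> g) (A ** B)"
  unfolding affine_with_def
proof (intro allI impI ballI)
  fix U \<phi> V \<psi> x assume c: "translation_chart Q U \<phi> \<and> translation_chart Q V \<psi>" and x: "x \<in> U" "(f \<circ> g) x \<in> V"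
  then have "g x \<in> punctured_surface Q"
    using g by (auto simp: translation_chart_def)
  then obtain Y \<eta> where Y: "translation_chart Q Y \<eta>" "g x \<in> Y"
    by (rule chart_exists)
  obtain W1 t1 where 1: "openin X W1" "x \<in> W1" "W1 \<subseteq> U" "g ` W1 \<subseteq> Y" "\<forall>y\<in>W1. \<eta> (g y) = B *v \<phi> y + t1"
    using assms(2) c x(1) Y unfolding affine_with_def by metis
  obtain W2 t2 where 2: "openin X W2" "g x \<in> W2" "W2 \<subseteq> Y" "f ` W2 \<subseteq> V" "\<forall>y\<in>W2. \<psi> (f y) = A *v \<eta> y + t2"
    using assms(1) c x(2) Y unfolding affine_with_def by (metis comp_apply)
  let ?W = "W1 \<inter> {y \<in> topspace X. g y \<in> W2}"
  have "openin X ?W"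
    using 1(1) openin_continuous_map_preimage[OF assms(3) 2(1)] by (rule openin_Int)
  moreover have "x \<in> ?W"
    using 1(1,2) 2(2) openin_subset by auto
  moreover have "\<psi> ((f \<circ> g) y) = (A ** B) *v \<phi> y + (A *v t1 + t2)" if "y \<in> ?W" for y
    using that 1(5) 2(5) by (simp add: matrix_vector_right_distrib matrix_vector_mul_assoc)
  ultimately show "\<exists>W t. openin X W \<and> x \<in> W \<and> W \<subseteq> U \<and> (f \<circ> g) ` W \<subseteq> V \<and>
      (\<forall>y\<in>W. \<psi> ((f \<circ> g) y) = (A ** B) *v \<phi> y + t)"
    using 1(3) 2(4) by (intro exI[of _ ?W] exI[of _ "A *v t1 + t2"]) auto
qed

lemma affine_with_inverse:
  assumes f: "affine_with Q f A" and AB: "B ** A = mat 1"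
    and g: "continuous_map X X g" "\<And>x. x \<in> topspace X \<Longrightarrow> f (g x) = x"
      "\<And>x. x \<in> topspace X \<Longrightarrow> g (f x) = x"
  shows "affine_with Q g B"
  unfolding affine_with_def
proof (intro allI impI ballI)
  fix U \<phi> V \<psi> x assume c: "translation_chart Q U \<phi> \<and> translation_chart Q V \<psi>" and x: "x \<in> U" "g x \<in> V"
  have U: "U \<subseteq> topspace X"
    using c by (auto simp: translation_chart_def punctured_surface_def)
  have "f (g x) \<in> U" using x U g(2) by auto
  then obtain W t where W: "openin X W" "g x \<in> W" "W \<subseteq> V" "f ` W \<subseteq> U" "\<forall>y\<in>W. \<phi> (f y) = A *v \<psi> y + t"
    using f c x unfolding affine_with_def by metis
  let ?W = "U \<inter> {y \<in> topspace X. g y \<in> W}"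
  have "openin X ?W"
    using c openin_continuous_map_preimage[OF g(1) W(1)] by (intro openin_Int) (auto simp: translation_chart_def)
  moreover have "x \<in> ?W" using x U W(2) by auto
  moreover have "\<psi> (g y) = B *v \<phi> y + (- (B *v t))" if "y \<in> ?W" for y
  proof -
    have "\<phi> y = A *v \<psi> (g y) + t"
      using W(5) g(2) that by force
    then have "B *v \<phi> y = (B ** A) *v \<psi> (g y) + B *v t"
      by (simp add: matrix_vector_right_distrib matrix_vector_mul_assoc)
    then show ?thesis by (simp add: AB)
  qed
  ultimately show "\<exists>W t. openin X W \<and> x \<in> W \<and> W \<subseteq> U \<and> g ` W \<subseteq> V \<and> (\<forall>y\<in>W. \<psi> (g y) = B *v \<phi> y + t)"
    using W(3) by (intro exI[of _ ?W] exI[of _ "- (B *v t)"]) auto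
qed

text \<open>Two charts differ by an integral vector that is only locally constant, so the neighbourhood has to
  be one on which it changes by less than 1.\<close>

lemma affine_with_id: "affine_with Q (\<lambda>x. x) (mat 1)"
  unfolding affine_with_def
proof (intro allI impI ballI)
  fix U \<phi> V \<psi> x assume c: "translation_chart Q U \<phi> \<and> translation_chart Q V \<psi>" and x: "x \<in> U" "x \<in> V"
  have U: "U \<subseteq> topspace X" "openin X U" "openin X V"
    using c by (auto simp: translation_chart_def punctured_surface_def)
  have cont: "continuous_map (subtopology X U) euclidean \<phi>" "continuous_map (subtopology X V) euclidean \<psi>"
    using c unfolding translation_chart_def
    by (meson homeomorphic_imp_continuous_map continuous_map_into_fulltopology)+
  let ?S = "subtopology X (U \<inter> V)"
  have cont': "continuous_map ?S euclidean \<phi>" "continuous_map ?S euclidean \<psi>"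
    using cont by (metis continuous_map_from_subtopology subtopology_subtopology inf_commute)+
  let ?d = "\<lambda>y. \<psi> y - \<phi> y"
  have "continuous_map ?S euclidean ?d"
    by (intro continuous_map_diff cont')
  then have "openin ?S {y \<in> topspace ?S. ?d y \<in> ball (?d x) 1}"
    by (rule openin_continuous_map_preimage) simp
  then have W: "openin X {y \<in> topspace ?S. ?d y \<in> ball (?d x) 1}" (is "openin X ?W")
    using U by (meson openin_Int openin_trans_full)
  have int: "?d y $ i \<in> \<int>" if "y \<in> U \<inter> V" for y i
  proof -
    have "torus_proj (\<psi> y) = torus_proj (\<phi> y)"
      using c that unfolding translation_chart_def by auto
    then show ?thesis by (simp add: torus_proj_eq_iff)
  qed
  have eq: "?d y = ?d x" if y: "y \<in> ?W" for y
  proof -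
    have "?d y $ i - ?d x $ i = 0" for i
    proof -
      have "\<bar>(?d y - ?d x) $ i\<bar> \<le> norm (?d y - ?d x)" by (rule component_le_norm_cart)
      also have "\<dots> < 1" using y by (simp add: dist_norm norm_minus_commute)
      finally have "\<bar>?d y $ i - ?d x $ i\<bar> < 1" by simp
      moreover have "?d y $ i - ?d x $ i \<in> \<int>"
        using int[of y i] int[of x i] x y by (intro Ints_diff) auto
      ultimately show ?thesis using Ints_nonzero_abs_less1 by blast
    qed
    then show ?thesis by (simp add: vec_eq_iff)
  qed
  have "\<psi> y = mat 1 *v \<phi> y + ?d x" if "y \<in> ?W" for y
    using eq[OF that] by (simp add: algebra_simps)
  moreover have "x \<in> ?W" using x U by auto
  ultimately show "\<exists>W t. openin X W \<and> x \<in> W \<and> W \<subseteq> U \<and> (\<lambda>x. x) ` W \<subseteq> V \<and> (\<forall>y\<in>W. \<psi> y = mat 1 *v \<phi> y + t)"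
    using W by (intro exI[of _ ?W] exI[of _ "?d x"]) auto
qed

end

section \<open>Translations permute the squares\<close>

context origami_surface
begin

text \<open>Develop a path from a vertex: a translation preserves its holonomy and maps the vertex to a vertex.\<close>

lemma translation_covering:
  assumes f: "f \<in> aff_set" and der: "der Q f = mat 1" and x: "x \<in> topspace X"
  shows "covering (f x) = covering x"
proof -
  obtain s where s: "s \<in> squares Q" using squares_nonempty by blast
  let ?v = "pt s 0"
  have v: "?v \<in> topspace X" "?v \<notin> punctured_surface Q"
    using s by (auto simp: punctured_pt_iff corner_def)
  obtain c where c: "c \<in> paths_between X ?v x"
    by (rule path_exists[OF v(1) x])
  then have cp: "pathin X c" "c 0 = ?v" "c 1 = x" by (auto simp: paths_between_def)
  obtain g where g: "\<And>t. t \<in> {0..1} \<Longrightarrow> covering (c t) = torus_proj (g t)" "hol c = g 1 - g 0"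
    using path_developed[OF cp(1)] by metis
  have fc: "pathin X (f \<circ> c)"
    using cp(1) aff_setD(3)[OF f] by (rule pathin_compose)
  obtain k where k: "\<And>t. t \<in> {0..1} \<Longrightarrow> covering ((f \<circ> c) t) = torus_proj (k t)" "hol (f \<circ> c) = k 1 - k 0"
    using path_developed[OF fc] by metis
  have "k 1 - k 0 = g 1 - g 0"
    using hol_aff[OF f cp(1)] der g(2) k(2) by simp
  then have k1: "k 1 = g 1 - g 0 + k 0" by (simp add: algebra_simps)
  have fv: "f ?v \<in> topspace X" "f ?v \<notin> punctured_surface Q"
    using aff_setD(7,8)[OF f v(1)] v(2) by auto
  have "covering ?v = torus_proj 0" "covering (f ?v) = torus_proj 0"
    using v fv by (auto simp: punctured_surface_def)
  then have int: "g 0 $ i \<in> \<int>" "k 0 $ i \<in> \<int>" for i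
    using g(1)[of 0] k(1)[of 0] cp(2) by (auto simp: torus_proj_eq_iff)
  have "torus_proj (k 1) = torus_proj (g 1)"
    unfolding torus_proj_eq_iff k1 using int by (auto intro!: Ints_diff)
  then show ?thesis
    using g(1)[of 1] k(1)[of 1] cp(3) by simp
qed

text \<open>Over an open square a translation is a section of the covering, so it stays in one sheet, because
  the sheets are open and the square is connected.  The closed square follows by continuity.\<close>

lemma translation_square:
  assumes f: "f \<in> aff_set" and der: "der Q f = mat 1" and s: "s \<in> squares Q"
  obtains t where "t \<in> squares Q" "\<And>z. z \<in> unit_square \<Longrightarrow> f (pt s z) = pt t z"
proof -
  let ?B = "box 0 1 :: plane set"
  have box: "z \<in> ?B \<longleftrightarrow> (\<forall>i. 0 < z $ i \<and> z $ i < 1)" for z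
    by (simp add: mem_box_cart)
  have sub: "?B \<subseteq> unit_square" by (rule box_subset_cbox)
  have sheet: "\<exists>t\<in>squares Q. f (pt s z) = pt t z" if z: "z \<in> ?B" for z
  proof -
    have top: "pt s z \<in> topspace X" by (intro pt_in s subsetD[OF sub z])
    obtain t w where t: "t \<in> squares Q" "w \<in> unit_square" "f (pt s z) = pt t w"
      by (rule topspace_XE[OF aff_setD(7)[OF f top]])
    have "torus_proj w = torus_proj z"
      using translation_covering[OF f der top] t(3) by (simp add: covering_pt)
    then have int: "w $ i - z $ i \<in> \<int>" for i by (simp add: torus_proj_eq_iff)
    have "w $ i - z $ i = 0" for i
    proof -
      have "\<bar>w $ i - z $ i\<bar> < 1"
        using t(2) z unfolding mem_unit_square box by (smt (verit))
      then show ?thesis using int[of i] Ints_nonzero_abs_less1 by blast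
    qed
    then have "w = z" by (simp add: vec_eq_iff)
    then show ?thesis using t by blast
  qed
  define \<Omega> where "\<Omega> t = {z \<in> ?B. f (pt s z) = pt t z}" for t
  have contf: "continuous_map (top_of_set unit_square) X (\<lambda>z. f (pt s z))"
    using continuous_map_compose[OF continuous_map_pt[OF s, of "top_of_set unit_square" "\<lambda>z. z"] aff_setD(3)[OF f]]
    by (simp add: o_def)
  have opn: "open (\<Omega> t)" if t: "t \<in> squares Q" for t
  proof -
    have "\<Omega> t = {z \<in> topspace (top_of_set unit_square). f (pt s z) \<in> pt t ` ?B} \<inter> ?B"
    proof (intro equalityI subsetI)
      fix z assume z: "z \<in> {z \<in> topspace (top_of_set unit_square). f (pt s z) \<in> pt t ` ?B} \<inter> ?B"
      then obtain t' w where t': "f (pt s z) = pt t' z" "f (pt s z) = pt t w" "w \<in> ?B" using sheet by blast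
      then have "(t', z) \<in> pt t w" by (simp flip: glued_point_eq_iff)
      then have "(t', z) = (t, w)" by (rule rep_interior[OF _ t]) (use t'(3) box in blast)
      then show "z \<in> \<Omega> t" using z t' by (simp add: \<Omega>_def)
    qed (use sub in \<open>auto simp: \<Omega>_def\<close>)
    moreover have "openin (top_of_set unit_square) {z \<in> topspace (top_of_set unit_square). f (pt s z) \<in> pt t ` ?B}"
      by (rule openin_continuous_map_preimage[OF contf chart_interior(1)[OF t]])
    ultimately obtain T where "open T" "\<Omega> t = unit_square \<inter> T \<inter> ?B"
      unfolding openin_open by metis
    then have "\<Omega> t = T \<inter> ?B" using sub by blast
    then show ?thesis using \<open>open T\<close> by (simp add: open_Int open_box)
  qed
  have disj: "t = t'" if "t \<in> squares Q" "t' \<in> squares Q" "z \<in> \<Omega> t" "z \<in> \<Omega> t'" for t t' z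
  proof -
    have "(t, z) \<in> pt t' z" using that by (simp add: \<Omega>_def flip: glued_point_eq_iff)
    then show ?thesis using rep_interior[OF _ that(2), of t z z] that(3) box by (auto simp: \<Omega>_def)
  qed
  let ?h = "(\<chi> i. 1/2) :: plane"
  have h: "?h \<in> ?B" by (simp add: box)
  obtain t where t: "t \<in> squares Q" "f (pt s ?h) = pt t ?h" using sheet[OF h] by blast
  have "?B \<subseteq> \<Omega> t"
  proof (rule ccontr)
    assume "\<not> ?B \<subseteq> \<Omega> t"
    let ?R = "\<Union>t'\<in>squares Q - {t}. \<Omega> t'"
    have "connected ?B" by (simp add: convex_connected)
    moreover have "open (\<Omega> t)" "open ?R" using opn t(1) by auto
    moreover have "?B \<subseteq> \<Omega> t \<union> ?R" using sheet by (auto simp: \<Omega>_def)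
    moreover have "\<Omega> t \<inter> ?R \<inter> ?B = {}" using disj t(1) by blast
    moreover have "\<Omega> t \<inter> ?B \<noteq> {}" using h t by (auto simp: \<Omega>_def)
    moreover have "?R \<inter> ?B \<noteq> {}" using \<open>\<not> ?B \<subseteq> \<Omega> t\<close> \<open>?B \<subseteq> \<Omega> t \<union> ?R\<close> by blast
    ultimately show False unfolding connected_def by blast
  qed
  then have eqB: "f (pt s z) = pt t z" if "z \<in> ?B" for z using that by (auto simp: \<Omega>_def)
  have "f (pt s z) = pt t z" if z: "z \<in> unit_square" for z
  proof (rule forall_in_closure_of_eq[OF _ Hausdorff_X contf _ eqB])
    show "z \<in> (top_of_set unit_square) closure_of ?B"
    proof -
      have "closure ?B = unit_square" using h by (intro closure_box) blast
      moreover have "(top_of_set unit_square) closure_of ?B = unit_square \<inter> closure ?B"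
        using sub by (subst closure_of_subtopology_open) auto
      ultimately show ?thesis using z by simp
    qed
    show "continuous_map (top_of_set unit_square) X (pt t)"
      using continuous_map_pt[OF t(1), of "top_of_set unit_square" "\<lambda>z. z"] by simp
  qed
  with t(1) show thesis by (rule that)
qed

definition deck :: "('s point \<Rightarrow> 's point) \<Rightarrow> ('s \<Rightarrow> 's) \<Rightarrow> bool" where
  "deck f \<sigma> \<longleftrightarrow> (\<forall>s\<in>squares Q. \<sigma> s \<in> squares Q \<and> (\<forall>z\<in>unit_square. f (pt s z) = pt (\<sigma> s) z))"

lemma translation_deck:
  assumes "f \<in> aff_set" "der Q f = mat 1"
  obtains \<sigma> where "deck f \<sigma>"
proof -
  have "\<forall>s\<in>squares Q. \<exists>t. t \<in> squares Q \<and> (\<forall>z\<in>unit_square. f (pt s z) = pt t z)"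
    using translation_square[OF assms] by metis
  then show thesis
    using that unfolding deck_def by metis
qed

lemma pt_side_inject:
  assumes "s \<in> squares Q" "t \<in> squares Q" "z \<in> unit_square" "\<not> corner z" "pt s z = pt t z"
  shows "s = t"
proof -
  have "(t, z) \<in> pt s z" using assms(5) by (simp flip: glued_point_eq_iff)
  moreover have "z \<noteq> z - axis i 1" "z \<noteq> z + axis i 1" for i :: 2
    by (auto simp: vec_eq_iff axis_def)
  ultimately show ?thesis
    using rep_not_corner[OF _ assms(1,3,4), of t z] by (metis prod.inject)
qed

lemma deck_nxt:
  assumes "deck f \<sigma>" "s \<in> squares Q"
  shows "\<sigma> (nxt Q i s) = nxt Q i (\<sigma> s)"
proof -
  let ?z = "(\<chi> j. if j = i then 1 else 1/2) :: plane" and ?w = "(\<chi> j. if j = i then 0 else 1/2) :: plane"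
  have z: "?z \<in> unit_square" "?w \<in> unit_square" "?z $ i = 1" "?z - axis i 1 = ?w"
    by (auto simp: mem_unit_square vec_eq_iff axis_def)
  have \<sigma>: "\<sigma> s \<in> squares Q" "\<sigma> (nxt Q i s) \<in> squares Q"
    using assms by (auto simp: deck_def)
  have "pt (\<sigma> (nxt Q i s)) ?w = f (pt (nxt Q i s) ?w)"
    using assms z(2) by (simp add: deck_def)
  also have "pt (nxt Q i s) ?w = pt s ?z"
    using pt_glue[OF assms(2) z(1,3)] by (simp only: z(4))
  also have "f (pt s ?z) = pt (\<sigma> s) ?z"
    using assms z(1) by (simp add: deck_def)
  also have "\<dots> = pt (nxt Q i (\<sigma> s)) ?w"
    using pt_glue[OF \<sigma>(1) z(1,3)] by (simp only: z(4))
  finally have "pt (\<sigma> (nxt Q i s)) ?w = pt (nxt Q i (\<sigma> s)) ?w" .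
  moreover have "\<not> corner ?w"
  proof -
    obtain j where "j \<noteq> i" using exhaust_2[of i] by (metis zero_neq_one num1_eq_iff one_neq_zero)
    then have "?w $ j \<notin> \<int>" using unit_Ints_iff[of "1/2"] by simp
    then show ?thesis unfolding corner_def by blast
  qed
  ultimately show ?thesis
    using \<sigma> z(2) by (intro pt_side_inject) auto
qed

lemma deck_funpow: "deck f \<sigma> \<Longrightarrow> deck (f ^^ n) (\<sigma> ^^ n)"
  by (induction n) (auto simp: deck_def)

lemma deck_fixed_square:
  assumes "deck f \<sigma>" "s \<in> squares Q" "\<sigma> s = s"
  shows "\<And>t. t \<in> squares Q \<Longrightarrow> \<sigma> t = t" "\<And>x. x \<in> topspace X \<Longrightarrow> f x = x"
proof -
  have "{t \<in> squares Q. \<sigma> t = t} = squares Q"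
    using assms by (intro squares_connected) (auto simp: deck_nxt)
  then show *: "\<sigma> t = t" if "t \<in> squares Q" for t using that by blast
  show "f x = x" if "x \<in> topspace X" for x
    using topspace_XE[OF that] * assms(1) unfolding deck_def by metis
qed

lemma periodic_funpow:
  assumes "finite S" "inj_on h S" "h ` S \<subseteq> S" "s \<in> S"
  obtains n where "n > 0" "(h ^^ n) s = s"
proof -
  have in_S: "(h ^^ k) s \<in> S" for k
    using assms(3,4) by (induction k) auto
  have "\<not> inj (\<lambda>k. (h ^^ k) s)"
    using in_S assms(1) by (meson finite_subset image_subsetI infinite_UNIV_nat finite_imageD)
  then obtain k l where kl: "k < l" "(h ^^ k) s = (h ^^ l) s"
    unfolding inj_def by (metis linorder_neqE_nat)
  have "(h ^^ k) s = (h ^^ l) s \<Longrightarrow> k < l \<Longrightarrow> (h ^^ (l - k)) s = s" for k l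
  proof (induction k arbitrary: l)
    case (Suc k)
    then obtain l' where l': "l = Suc l'" by (metis less_imp_Suc_add)
    then have "(h ^^ k) s = (h ^^ l') s"
      using Suc.prems(1) in_S assms(2) by (simp add: inj_on_eq_iff)
    then show ?case using Suc.IH[of l'] Suc.prems(2) l' by simp
  qed simp
  with kl show thesis using that[of "l - k"] by simp
qed

section \<open>Cellular cup products\<close>

text \<open>The cup product of two cellular cochains, evaluated on the sum of all squares.\<close>

definition cup :: "(2 \<Rightarrow> 's \<Rightarrow> real) \<Rightarrow> (2 \<Rightarrow> 's \<Rightarrow> real) \<Rightarrow> real" where
  "cup e e' = (\<Sum>s\<in>squares Q. e 1 s * e' 2 (nxt Q 1 s) - e 2 s * e' 1 (nxt Q 2 s))"

definition coboundary :: "('s point \<Rightarrow> real) \<Rightarrow> 2 \<Rightarrow> 's \<Rightarrow> real" where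
  "coboundary \<xi> i s = \<xi> (pt (nxt Q i s) 0) - \<xi> (pt s 0)"

lemma opposite_corner:
  assumes "s \<in> squares Q"
  shows "pt (nxt Q 2 (nxt Q 1 s)) 0 = pt s 1" "pt (nxt Q 1 (nxt Q 2 s)) 0 = pt s 1"
proof -
  have *: "pt (nxt Q j (nxt Q i s)) 0 = pt s 1" if "i \<noteq> j" for i j
  proof -
    have "(1::plane) - axis i 1 = axis j 1"
      using index_2[OF that] that by (auto simp: vec_eq_iff axis_def)
    then have "pt s 1 = pt (nxt Q i s) (axis j 1)"
      using pt_glue[OF assms axis_in_square(3), of i] by simp
    also have "\<dots> = pt (nxt Q j (nxt Q i s)) 0"
      using assms by (simp add: pt_axis)
    finally show ?thesis ..
  qed
  show "pt (nxt Q 2 (nxt Q 1 s)) 0 = pt s 1" "pt (nxt Q 1 (nxt Q 2 s)) 0 = pt s 1"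
    by (rule *; simp)+
qed

lemma cocycle_coboundary: "cocycle (coboundary \<xi>)"
  by (simp add: cocycle_def coboundary_def opposite_corner)

text \<open>The analogue of integration by parts: reindexing the sum over the squares by the gluing permutations
  moves the coboundary over to the cocycle.\<close>

lemma cup_coboundary_left:
  assumes "cocycle e"
  shows "cup (coboundary \<xi>) e = 0"
proof -
  let ?x = "\<lambda>s. \<xi> (pt s 0)"
  have "cup (coboundary \<xi>) e = (\<Sum>s\<in>squares Q. ?x (nxt Q 1 s) * e 2 (nxt Q 1 s)) - (\<Sum>s\<in>squares Q. ?x (nxt Q 2 s) * e 1 (nxt Q 2 s))
      - (\<Sum>s\<in>squares Q. ?x s * (e 2 (nxt Q 1 s) - e 1 (nxt Q 2 s)))"
    by (simp add: cup_def coboundary_def algebra_simps sum.distrib sum_subtractf)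
  also have "\<dots> = (\<Sum>s\<in>squares Q. ?x s * e 2 s) - (\<Sum>s\<in>squares Q. ?x s * e 1 s)
      - (\<Sum>s\<in>squares Q. ?x s * (e 2 (nxt Q 1 s) - e 1 (nxt Q 2 s)))"
    using sum_nxt[of "\<lambda>s. ?x s * e 2 s" 1] sum_nxt[of "\<lambda>s. ?x s * e 1 s" 2] by simp
  also have "\<dots> = (\<Sum>s\<in>squares Q. ?x s * (e 2 s + e 1 (nxt Q 2 s) - (e 1 s + e 2 (nxt Q 1 s))))"
    by (simp add: algebra_simps sum.distrib sum_subtractf)
  also have "\<dots> = 0"
    using assms by (intro sum.neutral) (simp add: cocycle_def)
  finally show ?thesis .
qed

lemma cup_coboundary_right:
  assumes "cocycle e"
  shows "cup e (coboundary \<xi>) = 0"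
proof -
  let ?x = "\<lambda>s. \<xi> (pt s 0)"
  have "cup e (coboundary \<xi>) = (\<Sum>s\<in>squares Q. \<xi> (pt s 1) * (e 1 s - e 2 s))
      - (\<Sum>s\<in>squares Q. e 1 s * ?x (nxt Q 1 s)) + (\<Sum>s\<in>squares Q. e 2 s * ?x (nxt Q 2 s))"
    by (simp add: cup_def coboundary_def opposite_corner algebra_simps sum.distrib sum_subtractf)
  also have "(\<Sum>s\<in>squares Q. \<xi> (pt s 1) * (e 1 s - e 2 s))
      = (\<Sum>s\<in>squares Q. \<xi> (pt s 1) * (e 1 (nxt Q 2 s) - e 2 (nxt Q 1 s)))"
  proof (intro sum.cong refl)
    fix s assume "s \<in> squares Q"
    then have "e 1 s - e 2 s = e 1 (nxt Q 2 s) - e 2 (nxt Q 1 s)"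
      using assms by (auto simp: cocycle_def algebra_simps)
    then show "\<xi> (pt s 1) * (e 1 s - e 2 s) = \<xi> (pt s 1) * (e 1 (nxt Q 2 s) - e 2 (nxt Q 1 s))" by simp
  qed
  also have "\<dots> = (\<Sum>s\<in>squares Q. e 1 (nxt Q 2 s) * ?x (nxt Q 1 (nxt Q 2 s)))
      - (\<Sum>s\<in>squares Q. e 2 (nxt Q 1 s) * ?x (nxt Q 2 (nxt Q 1 s)))"
    by (simp add: opposite_corner algebra_simps sum_subtractf)
  also have "\<dots> = (\<Sum>s\<in>squares Q. e 1 s * ?x (nxt Q 1 s)) - (\<Sum>s\<in>squares Q. e 2 s * ?x (nxt Q 2 s))"
    using sum_nxt[of "\<lambda>s. e 1 s * ?x (nxt Q 1 s)" 2] sum_nxt[of "\<lambda>s. e 2 s * ?x (nxt Q 2 s)" 1] by simp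
  finally show ?thesis by simp
qed

lemma cup_add_left: "cup (\<lambda>i s. e i s + e' i s) f = cup e f + cup e' f"
  by (simp add: cup_def algebra_simps sum.distrib sum_subtractf)

lemma cup_add_right: "cup f (\<lambda>i s. e i s + e' i s) = cup f e + cup f e'"
  by (simp add: cup_def algebra_simps sum.distrib sum_subtractf)

lemma cup_add_coboundaries:
  assumes "cocycle e" "cocycle e'"
  shows "cup (\<lambda>i s. e i s + coboundary \<xi> i s) (\<lambda>i s. e' i s + coboundary \<zeta> i s) = cup e e'"
  using assms
  by (simp add: cup_add_left cup_add_right cup_coboundary_left cup_coboundary_right cocycle_coboundary)

lemma cup_cong:
  "(\<And>i s. s \<in> squares Q \<Longrightarrow> e i s = e' i s) \<Longrightarrow> (\<And>i s. s \<in> squares Q \<Longrightarrow> f i s = f' i s) \<Longrightarrow> cup e f = cup e' f'"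
  unfolding cup_def by (intro sum.cong refl) simp

lemma cup_coord: "cup (coord 1) (coord 2) = card (squares Q)"
  by (simp add: cup_def coord_def)

text \<open>Two closed curves that cross exactly once: the core of the horizontal cylinder of squares
  through \<open>s\<close>, and the curve going up from \<open>s\<close> until it first returns to this cylinder and then back
  to \<open>s\<close> inside the cylinder.  Their dual cocycles have cup product 1, so the fundamental class
  generates the second cohomology integrally.\<close>

lemma dual_cocycles_exist:
  obtains e e' where "cocycle e" "integral_cochain e" "cocycle e'" "integral_cochain e'" "cup e e' = 1"
proof -
  obtain s where s: "s \<in> squares Q" using squares_nonempty by blast
  have inj: "inj_on (nxt Q i) (squares Q)" and img: "nxt Q i ` squares Q \<subseteq> squares Q" for i
    using bij_nxt[of i] by (auto simp: bij_betw_def)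
  have pow: "(nxt Q i ^^ n) s \<in> squares Q" for i n
    using s by (induction n) auto
  define C where "C = range (\<lambda>n. (nxt Q 1 ^^ n) s)"
  have sC: "s \<in> C" unfolding C_def by (rule range_eqI[of _ _ 0]) simp
  have C: "nxt Q 1 t \<in> C \<longleftrightarrow> t \<in> C" if t: "t \<in> squares Q" for t
  proof
    assume "nxt Q 1 t \<in> C"
    then obtain n where n: "nxt Q 1 t = (nxt Q 1 ^^ n) s" by (auto simp: C_def)
    obtain p where p: "p > 0" "(nxt Q 1 ^^ p) s = s"
      by (rule periodic_funpow[OF finite_squares inj img s])
    have "\<exists>k. nxt Q 1 t = (nxt Q 1 ^^ Suc k) s"
    proof (cases n)
      case 0
      then show ?thesis using n p by (intro exI[of _ "p - 1"]) simp
    qed (use n in blast)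
    then obtain k where "nxt Q 1 t = nxt Q 1 ((nxt Q 1 ^^ k) s)" by auto
    then have "t = (nxt Q 1 ^^ k) s" using inj[of 1] t pow by (simp add: inj_on_eq_iff)
    then show "t \<in> C" by (auto simp: C_def)
  next
    assume "t \<in> C"
    then obtain n where "t = (nxt Q 1 ^^ n) s" by (auto simp: C_def)
    then have "nxt Q 1 t = (nxt Q 1 ^^ Suc n) s" by simp
    then show "nxt Q 1 t \<in> C" unfolding C_def by blast
  qed
  obtain p where p: "p > 0" "(nxt Q 2 ^^ p) s = s"
    by (rule periodic_funpow[OF finite_squares inj img s])
  define k where "k = (LEAST k. (nxt Q 2 ^^ Suc k) s \<in> C)"
  have "(nxt Q 2 ^^ Suc (p - 1)) s \<in> C" using p sC by simp
  then have k: "(nxt Q 2 ^^ Suc k) s \<in> C" unfolding k_def by (rule LeastI)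
  have min: "(nxt Q 2 ^^ Suc l) s \<notin> C" if "l < k" for l
    using that not_less_Least unfolding k_def by blast
  obtain j where j: "(nxt Q 2 ^^ Suc k) s = (nxt Q 1 ^^ j) s" using k unfolding C_def by blast
  \<comment> \<open>Counting visits with multiplicity makes the sums telescope even where the curve passes through a
    square more than once.\<close>
  define cnt where "cnt i n t = (\<Sum>l<n. if (nxt Q i ^^ Suc l) s = t then 1 else (0::real))" for i n t
  have tel: "cnt i n (nxt Q i t) - cnt i n t = (if s = t then 1 else 0) - (if (nxt Q i ^^ n) s = t then 1 else 0)"
    if t: "t \<in> squares Q" for i n t
  proof -
    have "cnt i n (nxt Q i t) = (\<Sum>l<n. if (nxt Q i ^^ l) s = t then 1 else 0)"
      unfolding cnt_def using inj[of i] pow t by (intro sum.cong refl) (simp add: inj_on_eq_iff)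
    then have "cnt i n (nxt Q i t) - cnt i n t
        = - (\<Sum>l<n. (if (nxt Q i ^^ Suc l) s = t then 1 else 0) - (if (nxt Q i ^^ l) s = t then 1 else 0))"
      unfolding cnt_def by (simp add: sum_subtractf)
    also have "\<dots> = (if s = t then 1 else 0) - (if (nxt Q i ^^ n) s = t then 1 else 0)"
      by (subst sum_lessThan_telescope) simp
    finally show ?thesis .
  qed
  define e where "e i t = (if i = 1 then cnt 2 (Suc k) t else cnt 1 j t)" for i :: 2 and t
  define e' where "e' i t = (if i = 2 \<and> t \<in> C then 1 else (0::real))" for i :: 2 and t
  have e12: "e 1 t = cnt 2 (Suc k) t" "e 2 t = cnt 1 j t" for t by (auto simp: e_def)
  have "cocycle e"
    unfolding cocycle_def
  proof
    fix t assume t: "t \<in> squares Q"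
    show "e 1 t + e 2 (nxt Q 1 t) = e 2 t + e 1 (nxt Q 2 t)"
      using tel[OF t, of 2 "Suc k"] tel[OF t, of 1 j] unfolding e12 j by simp
  qed
  moreover have "integral_cochain e"
    by (auto simp: integral_cochain_def e_def cnt_def intro!: Ints_sum)
  moreover have "cocycle e'" "integral_cochain e'"
    by (auto simp: cocycle_def integral_cochain_def e'_def C)
  moreover have "cup e e' = 1"
  proof -
    have "cup e e' = (\<Sum>t\<in>squares Q. e 1 t * (if t \<in> C then 1 else 0))"
      unfolding cup_def by (intro sum.cong refl) (simp add: e'_def C)
    also have "\<dots> = (\<Sum>t\<in>squares Q. \<Sum>l<Suc k. if t = (nxt Q 2 ^^ Suc l) s then (if t \<in> C then 1 else 0) else 0)"
      unfolding e12 cnt_def sum_distrib_right by (intro sum.cong refl) auto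
    also have "\<dots> = (\<Sum>l<Suc k. \<Sum>t\<in>squares Q. if t = (nxt Q 2 ^^ Suc l) s then (if t \<in> C then 1 else 0) else 0)"
      by (rule sum.swap)
    also have "\<dots> = (\<Sum>l<Suc k. if (nxt Q 2 ^^ Suc l) s \<in> C then 1 else 0)"
      using pow[of "Suc _" 2] finite_squares by (intro sum.cong refl) (simp only: sum.delta if_True)
    also have "\<dots> = (\<Sum>l<Suc k. if l = k then 1 else 0)"
      using k min by (intro sum.cong refl) (metis lessThan_iff less_antisym)
    also have "\<dots> = 1" by simp
    finally show ?thesis .
  qed
  ultimately show thesis by (rule that)
qed

end

section \<open>Rooted loops\<close>

text \<open>The cancellation rule to which all computations with concatenated paths below reduce.\<close>

lemma path_join_cancel_middle:
  assumes "pathin X p" "pathin X r" "pathin X q" "p 1 = r 1" "q 0 = r 1"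
  shows "path_homotopic X (path_join (path_join p (path_reverse r)) (path_join r q)) (path_join p q)"
proof -
  note [simp] = pathin_path_join pathin_path_reverse assms
  have "path_homotopic X (path_join (path_join p (path_reverse r)) (path_join r q))
      (path_join p (path_join (path_reverse r) (path_join r q)))"
    by (rule path_join_assoc) simp_all
  also have "path_homotopic X \<dots> (path_join p (path_join (path_join (path_reverse r) r) q))"
    by (intro path_join_cong path_homotopic_refl path_homotopic_sym[OF path_join_assoc]) simp_all
  also have "path_homotopic X \<dots> (path_join p (path_join (\<lambda>_. r 1) q))"
    by (intro path_join_cong path_homotopic_refl path_join_reverse_left) simp_all
  also have "path_homotopic X \<dots> (path_join p q)"
    by (intro path_join_cong path_homotopic_refl path_join_const_left) simp_all
  finally show ?thesis .
qed

lemma fundamental_group_inv: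
  assumes "x0 \<in> topspace X" "c \<in> paths_between X x0 x0"
  shows "inv\<^bsub>fundamental_group X x0\<^esub> (path_class X c) = path_class X (path_reverse c)"
proof (rule group.inv_equality[OF group_fundamental_group[OF assms(1)]])
  show "path_class X (path_reverse c) \<otimes>\<^bsub>fundamental_group X x0\<^esub> path_class X c = \<one>\<^bsub>fundamental_group X x0\<^esub>"
    using assms(2) path_class_cong[OF path_join_reverse_left[of X c]]
    by (simp add: fundamental_group_mult paths_between_reverse fundamental_group_one)
       (simp add: paths_between_def)
qed (use assms in \<open>auto intro: path_class_in_carrier paths_between_reverse\<close>)

lemma paths_between_topspace: "c \<in> paths_between X x y \<Longrightarrow> x \<in> topspace X \<and> y \<in> topspace X"
  unfolding paths_between_def using path_start_in_topspace path_finish_in_topspace by blast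

lemma induced_auto_path_class:
  assumes f: "continuous_map X X f" and \<gamma>: "\<gamma> \<in> paths_between X x0 (f x0)" and c: "c \<in> paths_between X x0 x0"
  shows "induced_auto X x0 f \<gamma> (path_class X c)
       = path_class X (path_join \<gamma> (path_join (f \<circ> c) (path_reverse \<gamma>)))"
proof -
  have eq: "path_class X (path_join \<gamma> (path_join (f \<circ> d) (path_reverse \<gamma>)))
      = path_class X (path_join \<gamma> (path_join (f \<circ> c) (path_reverse \<gamma>)))" if "d \<in> path_class X c" for d
  proof -
    have h: "path_homotopic X d c"
      using that by (simp add: in_path_class_iff path_homotopic_sym)
    have ends: "d 0 = x0" "d 1 = x0" "pathin X \<gamma>" "\<gamma> 1 = f x0"
      using path_homotopic_ends[OF h] c \<gamma> by (auto simp: paths_between_def)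
    show ?thesis
      by (intro path_class_cong path_join_cong path_homotopic_refl path_homotopic_compose[OF h f])
         (simp_all add: ends pathin_path_reverse)
  qed
  have "path_class X c \<noteq> {}"
    using c path_class_self[of X c] by (auto simp: paths_between_def)
  then have "(\<Union>d\<in>path_class X c. path_class X (path_join \<gamma> (path_join (f \<circ> d) (path_reverse \<gamma>))))
      = path_class X (path_join \<gamma> (path_join (f \<circ> c) (path_reverse \<gamma>)))"
    by (rule SUP_eq_const[OF _ eq])
  then show ?thesis
    by (simp add: induced_auto_def path_class_in_carrier[OF c])
qed

lemma induced_auto_hom:
  assumes f: "continuous_map X X f" and \<gamma>: "\<gamma> \<in> paths_between X x0 (f x0)"
  shows "induced_auto X x0 f \<gamma> \<in> hom (fundamental_group X x0) (fundamental_group X x0)"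
proof (rule homI)
  have in_loop: "path_join \<gamma> (path_join (f \<circ> c) (path_reverse \<gamma>)) \<in> paths_between X x0 x0"
    if "c \<in> paths_between X x0 x0" for c
    using paths_between_join[OF \<gamma> paths_between_join[OF paths_between_compose[OF that f] paths_between_reverse[OF \<gamma>]]] .
  fix C assume "C \<in> carrier (fundamental_group X x0)"
  then show "induced_auto X x0 f \<gamma> C \<in> carrier (fundamental_group X x0)"
    by (elim fundamental_group_carrierE) (simp add: induced_auto_path_class[OF f \<gamma>] in_loop path_class_in_carrier)
next
  fix C D assume "C \<in> carrier (fundamental_group X x0)" "D \<in> carrier (fundamental_group X x0)"
  then obtain c d where cd: "c \<in> paths_between X x0 x0" "C = path_class X c"
    "d \<in> paths_between X x0 x0" "D = path_class X d"
    by (elim fundamental_group_carrierE) blast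
  have P: "pathin X c" "pathin X d" "c 0 = x0" "c 1 = x0" "d 0 = x0" "d 1 = x0"
    "pathin X \<gamma>" "\<gamma> 0 = x0" "\<gamma> 1 = f x0" "pathin X (f \<circ> c)" "pathin X (f \<circ> d)"
    using cd \<gamma> pathin_compose[OF _ f] by (auto simp: paths_between_def)
  note [simp] = P pathin_path_join pathin_path_reverse
  let ?r = "path_reverse \<gamma>"
  have "path_homotopic X (path_join (path_join \<gamma> (path_join (f \<circ> c) ?r)) (path_join \<gamma> (path_join (f \<circ> d) ?r)))
      (path_join (path_join (path_join \<gamma> (f \<circ> c)) ?r) (path_join \<gamma> (path_join (f \<circ> d) ?r)))"
    by (intro path_join_cong path_homotopic_refl path_homotopic_sym[OF path_join_assoc]) simp_all
  also have "path_homotopic X \<dots> (path_join (path_join \<gamma> (f \<circ> c)) (path_join (f \<circ> d) ?r))"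
    by (rule path_join_cancel_middle) simp_all
  also have "path_homotopic X \<dots> (path_join \<gamma> (path_join (f \<circ> c) (path_join (f \<circ> d) ?r)))"
    by (rule path_join_assoc) simp_all
  also have "path_homotopic X \<dots> (path_join \<gamma> (path_join (path_join (f \<circ> c) (f \<circ> d)) ?r))"
    by (intro path_join_cong path_homotopic_refl path_homotopic_sym[OF path_join_assoc]) simp_all
  finally have hom: "path_homotopic X (path_join (path_join \<gamma> (path_join (f \<circ> c) ?r)) (path_join \<gamma> (path_join (f \<circ> d) ?r)))
      (path_join \<gamma> (path_join (f \<circ> path_join c d) ?r))"
    by (simp only: compose_path_join)
  have loops: "path_join \<gamma> (path_join (f \<circ> c) ?r) \<in> paths_between X x0 x0"
    "path_join \<gamma> (path_join (f \<circ> d) ?r) \<in> paths_between X x0 x0"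
    by (auto simp: paths_between_def)
  have "induced_auto X x0 f \<gamma> (C \<otimes>\<^bsub>fundamental_group X x0\<^esub> D)
      = path_class X (path_join \<gamma> (path_join (f \<circ> path_join c d) ?r))"
    using cd by (simp add: fundamental_group_mult induced_auto_path_class[OF f \<gamma>] paths_between_join)
  also have "\<dots> = path_class X (path_join (path_join \<gamma> (path_join (f \<circ> c) ?r)) (path_join \<gamma> (path_join (f \<circ> d) ?r)))"
    by (rule path_class_cong[OF hom, symmetric])
  also have "\<dots> = induced_auto X x0 f \<gamma> C \<otimes>\<^bsub>fundamental_group X x0\<^esub> induced_auto X x0 f \<gamma> D"
    using cd loops by (simp add: fundamental_group_mult induced_auto_path_class[OF f \<gamma>])
  finally show "induced_auto X x0 f \<gamma> (C \<otimes>\<^bsub>fundamental_group X x0\<^esub> D)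
      = induced_auto X x0 f \<gamma> C \<otimes>\<^bsub>fundamental_group X x0\<^esub> induced_auto X x0 f \<gamma> D" .
qed

locale based_origami = origami_surface Q for Q :: "'s origami" +
  fixes x0 :: "'s point"
  assumes x0: "x0 \<in> topspace X"
begin

abbreviation \<pi> where "\<pi> \<equiv> fundamental_group X x0"

sublocale fg: group \<pi>
  using x0 by (rule group_fundamental_group)

text \<open>A fixed system of paths from the base point turns every path into a loop.\<close>

definition base_path :: "'s point \<Rightarrow> real \<Rightarrow> 's point" where
  "base_path x = (SOME c. c \<in> paths_between X x0 x)"

definition rooted :: "(real \<Rightarrow> 's point) \<Rightarrow> (real \<Rightarrow> 's point) set" where
  "rooted c = path_class X (path_join (path_join (base_path (c 0)) c) (path_reverse (base_path (c 1))))"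

lemma base_path: "x \<in> topspace X \<Longrightarrow> base_path x \<in> paths_between X x0 x"
  unfolding base_path_def using path_exists[OF x0, of x] someI_ex[of "\<lambda>c. c \<in> paths_between X x0 x"] by metis

lemma base_pathD:
  assumes "x \<in> topspace X"
  shows "pathin X (base_path x)" "base_path x 0 = x0" "base_path x 1 = x"
  using base_path[OF assms] by (auto simp: paths_between_def)

lemma rooted_in:
  assumes "c \<in> paths_between X x y"
  shows "rooted c \<in> carrier \<pi>"
proof -
  have "c 0 = x" "c 1 = y" "x \<in> topspace X" "y \<in> topspace X"
    using paths_between_topspace[OF assms] assms by (auto simp: paths_between_def)
  then show ?thesis
    unfolding rooted_def
    by (intro path_class_in_carrier paths_between_join paths_between_reverse base_path)
       (use assms in \<open>auto intro: base_path\<close>)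
qed

lemma rooted_cong: "path_homotopic X c d \<Longrightarrow> rooted c = rooted d"
  unfolding rooted_def
proof -
  assume h: "path_homotopic X c d"
  then have e: "d 0 = c 0" "d 1 = c 1" and p: "pathin X c"
    using path_homotopic_ends path_homotopic_pathin by blast+
  then have "c 0 \<in> topspace X" "c 1 \<in> topspace X"
    by (auto intro: path_start_in_topspace path_finish_in_topspace)
  note r = base_pathD[OF this(1)] base_pathD[OF this(2)]
  show "path_class X (path_join (path_join (base_path (c 0)) c) (path_reverse (base_path (c 1)))) =
    path_class X (path_join (path_join (base_path (d 0)) d) (path_reverse (base_path (d 1))))"
    unfolding e by (intro path_class_cong path_join_cong path_homotopic_refl h) (simp_all add: r pathin_path_reverse)
qed

lemma rooted_path_join:
  assumes c: "c \<in> paths_between X x y" and d: "d \<in> paths_between X y z"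
  shows "rooted (path_join c d) = rooted c \<otimes>\<^bsub>\<pi>\<^esub> rooted d"
proof -
  have top: "x \<in> topspace X" "y \<in> topspace X" "z \<in> topspace X"
    using paths_between_topspace[OF c] paths_between_topspace[OF d] by auto
  have cd: "pathin X c" "c 0 = x" "c 1 = y" "pathin X d" "d 0 = y" "d 1 = z"
    using c d by (auto simp: paths_between_def)
  note [simp] = base_pathD[OF top(1)] base_pathD[OF top(2)] base_pathD[OF top(3)] cd pathin_path_join pathin_path_reverse
  have "path_homotopic X (path_join (path_join (path_join (base_path x) c) (path_reverse (base_path y)))
        (path_join (path_join (base_path y) d) (path_reverse (base_path z))))
      (path_join (path_join (path_join (base_path x) c) (path_reverse (base_path y)))
        (path_join (base_path y) (path_join d (path_reverse (base_path z)))))"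
    by (intro path_join_cong path_homotopic_refl path_join_assoc) simp_all
  also have "path_homotopic X \<dots> (path_join (path_join (base_path x) c) (path_join d (path_reverse (base_path z))))"
    by (rule path_join_cancel_middle) simp_all
  also have "path_homotopic X \<dots> (path_join (path_join (path_join (base_path x) c) d) (path_reverse (base_path z)))"
    by (rule path_homotopic_sym[OF path_join_assoc]) simp_all
  also have "path_homotopic X \<dots> (path_join (path_join (base_path x) (path_join c d)) (path_reverse (base_path z)))"
    by (intro path_join_cong path_homotopic_refl path_join_assoc) simp_all
  finally have "path_class X (path_join (path_join (path_join (base_path x) c) (path_reverse (base_path y)))
        (path_join (path_join (base_path y) d) (path_reverse (base_path z))))
      = path_class X (path_join (path_join (base_path x) (path_join c d)) (path_reverse (base_path z)))"
    by (rule path_class_cong)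
  then show ?thesis
    unfolding rooted_def
    by (subst fundamental_group_mult) (simp_all add: paths_between_def)
qed

lemma real_hom_rooted_loop:
  assumes u: "real_hom \<pi> u" and c: "c \<in> paths_between X x0 x0"
  shows "u (rooted c) = u (path_class X c)"
proof -
  note r = base_path[OF x0]
  have "rooted c = path_class X (base_path x0) \<otimes>\<^bsub>\<pi>\<^esub> path_class X c \<otimes>\<^bsub>\<pi>\<^esub> path_class X (path_reverse (base_path x0))"
    using c r by (simp add: rooted_def fundamental_group_mult paths_between_join paths_between_reverse)
       (simp add: paths_between_def)
  also have "\<dots> = path_class X (base_path x0) \<otimes>\<^bsub>\<pi>\<^esub> path_class X c \<otimes>\<^bsub>\<pi>\<^esub> inv\<^bsub>\<pi>\<^esub> (path_class X (base_path x0))"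
    by (simp add: fundamental_group_inv[OF x0 r])
  finally show ?thesis
    using c r u by (simp add: fg.real_hom_conj path_class_in_carrier)
qed

text \<open>The loop by which the image under \<open>f\<close> of the chosen path to \<open>x\<close> differs from the chosen path to
  \<open>f x\<close>.\<close>

definition drift :: "('s point \<Rightarrow> 's point) \<Rightarrow> (real \<Rightarrow> 's point) \<Rightarrow> 's point \<Rightarrow> (real \<Rightarrow> 's point) set" where
  "drift f \<gamma> x = path_class X (path_join (path_join \<gamma> (f \<circ> base_path x)) (path_reverse (base_path (f x))))"

lemma drift_in:
  assumes f: "continuous_map X X f" and \<gamma>: "\<gamma> \<in> paths_between X x0 (f x0)" and x: "x \<in> topspace X"
  shows "drift f \<gamma> x \<in> carrier \<pi>"
proof -
  have "f x \<in> topspace X" using f x continuous_map_image_subset_topspace by blast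
  then show ?thesis
    unfolding drift_def
    using paths_between_join[OF paths_between_join[OF \<gamma> paths_between_compose[OF base_path[OF x] f]]
        paths_between_reverse[OF base_path]] by (intro path_class_in_carrier)
qed

text \<open>Expressed in rooted loops, the induced automorphism is application of \<open>f\<close> to paths, twisted by the
  drift at both ends.\<close>

lemma induced_auto_rooted:
  assumes f: "continuous_map X X f" and \<gamma>: "\<gamma> \<in> paths_between X x0 (f x0)" and c: "c \<in> paths_between X x y"
  shows "induced_auto X x0 f \<gamma> (rooted c) \<otimes>\<^bsub>\<pi>\<^esub> drift f \<gamma> y = drift f \<gamma> x \<otimes>\<^bsub>\<pi>\<^esub> rooted (f \<circ> c)"
proof -
  have top: "x \<in> topspace X" "y \<in> topspace X"
    using paths_between_topspace[OF c] by auto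
  then have ftop: "f x \<in> topspace X" "f y \<in> topspace X"
    using f continuous_map_image_subset_topspace by blast+
  have P: "pathin X c" "c 0 = x" "c 1 = y" "pathin X \<gamma>" "\<gamma> 0 = x0" "\<gamma> 1 = f x0"
    using c \<gamma> by (auto simp: paths_between_def)
  have Pf: "pathin X (f \<circ> c)" "pathin X (f \<circ> base_path x)" "pathin X (f \<circ> base_path y)"
    by (auto intro!: pathin_compose[OF _ f] P base_pathD top)
  note [simp] = base_pathD[OF top(1)] base_pathD[OF top(2)] base_pathD[OF ftop(1)] base_pathD[OF ftop(2)] P Pf
    pathin_path_join pathin_path_reverse
  let ?r = "path_reverse (f \<circ> base_path y)" and ?g = "path_reverse \<gamma>" and ?R = "path_reverse (base_path (f y))"
  let ?rc = "path_join (f \<circ> base_path x) (f \<circ> c)"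
  have "path_homotopic X (path_join (path_join \<gamma> (path_join (path_join ?rc ?r) ?g)) (path_join (path_join \<gamma> (f \<circ> base_path y)) ?R))
      (path_join (path_join (path_join \<gamma> (path_join ?rc ?r)) ?g) (path_join \<gamma> (path_join (f \<circ> base_path y) ?R)))"
    by (intro path_join_cong path_join_assoc path_homotopic_sym[OF path_join_assoc]) simp_all
  also have "path_homotopic X \<dots> (path_join (path_join \<gamma> (path_join ?rc ?r)) (path_join (f \<circ> base_path y) ?R))"
    by (rule path_join_cancel_middle) simp_all
  also have "path_homotopic X \<dots> (path_join (path_join (path_join \<gamma> ?rc) ?r) (path_join (f \<circ> base_path y) ?R))"
    by (intro path_join_cong path_homotopic_refl path_homotopic_sym[OF path_join_assoc]) simp_all
  also have "path_homotopic X \<dots> (path_join (path_join \<gamma> ?rc) ?R)"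
    by (rule path_join_cancel_middle) simp_all
  also have "path_homotopic X \<dots> (path_join (path_join (path_join \<gamma> (f \<circ> base_path x)) (f \<circ> c)) ?R)"
    by (intro path_join_cong path_homotopic_refl path_homotopic_sym[OF path_join_assoc]) simp_all
  also have "path_homotopic X \<dots> (path_join (path_join \<gamma> (f \<circ> base_path x)) (path_join (f \<circ> c) ?R))"
    by (rule path_join_assoc) simp_all
  finally have 1: "path_homotopic X (path_join (path_join \<gamma> (path_join (path_join ?rc ?r) ?g)) (path_join (path_join \<gamma> (f \<circ> base_path y)) ?R))
      (path_join (path_join \<gamma> (f \<circ> base_path x)) (path_join (f \<circ> c) ?R))" .
  have "path_homotopic X (path_join (path_join (path_join \<gamma> (f \<circ> base_path x)) (path_reverse (base_path (f x)))) (path_join (path_join (base_path (f x)) (f \<circ> c)) ?R))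
      (path_join (path_join (path_join \<gamma> (f \<circ> base_path x)) (path_reverse (base_path (f x)))) (path_join (base_path (f x)) (path_join (f \<circ> c) ?R)))"
    by (intro path_join_cong path_homotopic_refl path_join_assoc) simp_all
  also have "path_homotopic X \<dots> (path_join (path_join \<gamma> (f \<circ> base_path x)) (path_join (f \<circ> c) ?R))"
    by (rule path_join_cancel_middle) simp_all
  finally have 2: "path_homotopic X (path_join (path_join (path_join \<gamma> (f \<circ> base_path x)) (path_reverse (base_path (f x)))) (path_join (path_join (base_path (f x)) (f \<circ> c)) ?R))
      (path_join (path_join \<gamma> (f \<circ> base_path x)) (path_join (f \<circ> c) ?R))" .
  have L: "path_join (path_join (base_path x) c) (path_reverse (base_path y)) \<in> paths_between X x0 x0"
    by (simp add: paths_between_def)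
  have "induced_auto X x0 f \<gamma> (rooted c) = path_class X (path_join \<gamma> (path_join (path_join ?rc ?r) ?g))"
    unfolding rooted_def using induced_auto_path_class[OF f \<gamma> L]
    by (simp add: compose_path_join compose_path_reverse)
  then have "induced_auto X x0 f \<gamma> (rooted c) \<otimes>\<^bsub>\<pi>\<^esub> drift f \<gamma> y
      = path_class X (path_join (path_join \<gamma> (path_join (path_join ?rc ?r) ?g)) (path_join (path_join \<gamma> (f \<circ> base_path y)) ?R))"
    unfolding drift_def by (simp add: fundamental_group_mult paths_between_def)
  also have "\<dots> = path_class X (path_join (path_join \<gamma> (f \<circ> base_path x)) (path_join (f \<circ> c) ?R))"
    by (rule path_class_cong[OF 1])
  also have "\<dots> = path_class X (path_join (path_join (path_join \<gamma> (f \<circ> base_path x)) (path_reverse (base_path (f x)))) (path_join (path_join (base_path (f x)) (f \<circ> c)) ?R))"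
    by (rule path_class_cong[OF 2, symmetric])
  also have "\<dots> = drift f \<gamma> x \<otimes>\<^bsub>\<pi>\<^esub> rooted (f \<circ> c)"
    unfolding drift_def rooted_def by (simp add: fundamental_group_mult paths_between_def)
  finally show ?thesis .
qed

lemma real_hom_induced_auto_rooted:
  assumes u: "real_hom \<pi> u" and f: "continuous_map X X f" and \<gamma>: "\<gamma> \<in> paths_between X x0 (f x0)"
    and c: "c \<in> paths_between X x y"
  shows "u (induced_auto X x0 f \<gamma> (rooted c)) = u (drift f \<gamma> x) + u (rooted (f \<circ> c)) - u (drift f \<gamma> y)"
proof -
  have "x \<in> topspace X" "y \<in> topspace X"
    using paths_between_topspace[OF c] by auto
  then have "drift f \<gamma> x \<in> carrier \<pi>" "drift f \<gamma> y \<in> carrier \<pi>"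
    by (auto intro: drift_in[OF f \<gamma>])
  moreover have "induced_auto X x0 f \<gamma> (rooted c) \<in> carrier \<pi>"
    using induced_auto_hom[OF f \<gamma>] rooted_in[OF c] by (rule hom_in_carrier)
  moreover have "rooted (f \<circ> c) \<in> carrier \<pi>"
    by (rule rooted_in[OF paths_between_compose[OF c f]])
  ultimately have "u (induced_auto X x0 f \<gamma> (rooted c)) + u (drift f \<gamma> y) = u (drift f \<gamma> x) + u (rooted (f \<circ> c))"
    using induced_auto_rooted[OF f \<gamma> c] by (metis real_homD[OF u])
  then show ?thesis by simp
qed

section \<open>The fundamental class\<close>

definition edge :: "2 \<Rightarrow> 's \<Rightarrow> real \<Rightarrow> 's point" where
  "edge i s = seg s 0 (axis i 1)"

definition cochain :: "((real \<Rightarrow> 's point) set \<Rightarrow> real) \<Rightarrow> 2 \<Rightarrow> 's \<Rightarrow> real" where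
  "cochain u i s = u (rooted (edge i s))"

lemma edge_path: "s \<in> squares Q \<Longrightarrow> edge i s \<in> paths_between X (pt s 0) (pt (nxt Q i s) 0)"
  unfolding edge_def using seg_path[of s 0 "axis i 1"] by (simp add: pt_axis)

lemma edge_in: "s \<in> squares Q \<Longrightarrow> rooted (edge i s) \<in> carrier \<pi>"
  by (rule rooted_in[OF edge_path])

text \<open>The boundary of a square is null-homotopic.\<close>

lemma square_relation:
  assumes s: "s \<in> squares Q"
  shows "rooted (edge 1 s) \<otimes>\<^bsub>\<pi>\<^esub> rooted (edge 2 (nxt Q 1 s)) = rooted (edge 2 s) \<otimes>\<^bsub>\<pi>\<^esub> rooted (edge 1 (nxt Q 2 s))"
proof -
  let ?l = "\<lambda>i. path_join (linepath 0 (axis i 1)) (linepath (axis i 1) 1) :: real \<Rightarrow> plane"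
  have lc: "continuous_on {0..1} (?l i)" for i
  proof -
    have "pathin euclidean (?l i)"
      by (intro pathin_path_join) (auto simp: pathin_def linepath_def intro!: continuous_intros)
    then show ?thesis by (simp add: pathin_def)
  qed
  have li: "?l i ` {0..1} \<subseteq> unit_square" for i
  proof (rule image_subsetI)
    fix t :: real assume "t \<in> {0..1}"
    then show "?l i t \<in> unit_square"
      using linepath_in_square[of 0 "axis i 1" "2 * t"] linepath_in_square[of "axis i 1" 1 "2 * t - 1"]
      by (auto simp: path_join_def)
  qed
  have ends: "?l i 0 = 0" "?l i 1 = 1" for i
    by (simp_all add: linepath_0' linepath_1')
  have K: "continuous_map (top_of_set unit_square) X (pt s)"
    using continuous_map_pt[OF s, of "top_of_set unit_square" "\<lambda>z. z"] by simp
  have "path_homotopic X (pt s \<circ> ?l 1) (pt s \<circ> ?l 2)"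
    by (rule path_homotopic_convex[OF _ K lc li lc li]) (simp_all only: ends convex_box)
  moreover have "pt s \<circ> ?l i = path_join (edge i s) (seg s (axis i 1) 1)" for i
    by (simp add: edge_def seg_def path_join_def fun_eq_iff)
  ultimately have mid: "path_homotopic X (path_join (edge 1 s) (seg s (axis 1 1) 1)) (path_join (edge 2 s) (seg s (axis 2 1) 1))"
    by simp
  have opp: "path_homotopic X (path_join (edge i s) (seg s (axis i 1) 1)) (path_join (edge i s) (edge j (nxt Q i s)))"
    if "i \<noteq> j" for i j
  proof (intro path_join_cong path_homotopic_refl path_homotopic_eq)
    show "pathin X (edge i s)" "pathin X (seg s (axis i 1) 1)" "edge i s 1 = seg s (axis i 1) 1 0"
      using edge_path[OF s, of i] seg_path[OF s, of "axis i 1" 1] s by (auto simp: paths_between_def pt_axis)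
    fix t :: real assume t: "t \<in> {0..1}"
    have eq: "linepath (axis i 1) 1 t - axis i 1 = linepath 0 (axis j 1) t" "linepath (axis i 1) 1 t $ i = 1"
      using index_2[OF that] that by (auto simp: linepath_def vec_eq_iff axis_def)
    have "linepath (axis i 1) 1 t \<in> unit_square"
      using t by (intro linepath_in_square) auto
    from pt_glue[OF s this eq(2)] show "seg s (axis i 1) 1 t = edge j (nxt Q i s) t"
      by (simp add: seg_def edge_def eq(1))
  qed
  have "path_homotopic X (path_join (edge 1 s) (edge 2 (nxt Q 1 s))) (path_join (edge 2 s) (edge 1 (nxt Q 2 s)))"
    by (rule path_homotopic_trans[OF path_homotopic_sym[OF opp] path_homotopic_trans[OF mid opp]]) simp_all
  then have "rooted (path_join (edge 1 s) (edge 2 (nxt Q 1 s))) = rooted (path_join (edge 2 s) (edge 1 (nxt Q 2 s)))"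
    by (rule rooted_cong)
  then show ?thesis
    by (simp only: rooted_path_join[OF edge_path[OF s] edge_path[OF nxt_in[OF s]]])
qed

lemma cocycle_cochain:
  assumes u: "real_hom \<pi> u"
  shows "cocycle (cochain u)"
  unfolding cocycle_def cochain_def
proof
  fix s assume s: "s \<in> squares Q"
  have "u (rooted (edge 1 s) \<otimes>\<^bsub>\<pi>\<^esub> rooted (edge 2 (nxt Q 1 s))) = u (rooted (edge 2 s) \<otimes>\<^bsub>\<pi>\<^esub> rooted (edge 1 (nxt Q 2 s)))"
    by (simp only: square_relation[OF s])
  then show "u (rooted (edge 1 s)) + u (rooted (edge 2 (nxt Q 1 s))) = u (rooted (edge 2 s)) + u (rooted (edge 1 (nxt Q 2 s)))"
    using s by (simp add: real_homD[OF u] edge_in)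
qed

text \<open>A primitive on the fundamental group restricts to a cellular primitive on the squares, and
  so forces the cup product to vanish.\<close>

lemma cup_primitive:
  assumes q: "primitive \<pi> \<beta> q"
  shows "(\<Sum>s\<in>squares Q. \<beta> (rooted (edge 1 s)) (rooted (edge 2 (nxt Q 1 s)))
      - \<beta> (rooted (edge 2 s)) (rooted (edge 1 (nxt Q 2 s)))) = 0"
proof -
  let ?q = "\<lambda>i s. q (rooted (edge i s))"
  have "\<beta> (rooted (edge 1 s)) (rooted (edge 2 (nxt Q 1 s))) - \<beta> (rooted (edge 2 s)) (rooted (edge 1 (nxt Q 2 s)))
      = ?q 2 s - ?q 2 (nxt Q 1 s) + (?q 1 (nxt Q 2 s) - ?q 1 s)" if s: "s \<in> squares Q" for s
  proof -
    have "q (c \<otimes>\<^bsub>\<pi>\<^esub> d) = q c + q d + \<beta> c d" if "c \<in> carrier \<pi>" "d \<in> carrier \<pi>" for c d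
      using q that by (simp add: primitive_def)
    from this[of "rooted (edge 1 s)" "rooted (edge 2 (nxt Q 1 s))"]
      this[of "rooted (edge 2 s)" "rooted (edge 1 (nxt Q 2 s))"]
    show ?thesis using s square_relation[OF s] by (simp add: edge_in)
  qed
  then have "(\<Sum>s\<in>squares Q. \<beta> (rooted (edge 1 s)) (rooted (edge 2 (nxt Q 1 s)))
      - \<beta> (rooted (edge 2 s)) (rooted (edge 1 (nxt Q 2 s))))
      = (\<Sum>s\<in>squares Q. ?q 2 s - ?q 2 (nxt Q 1 s) + (?q 1 (nxt Q 2 s) - ?q 1 s))"
    by (intro sum.cong refl)
  also have "\<dots> = 0"
    using sum_nxt[of "?q 2" 1] sum_nxt[of "?q 1" 2] by (simp add: sum.distrib sum_subtractf)
  finally show ?thesis .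
qed

abbreviation winding_hom :: "(2 \<Rightarrow> 's \<Rightarrow> real) \<Rightarrow> (real \<Rightarrow> 's point) set \<Rightarrow> real" where
  "winding_hom e \<equiv> class_winding (cocycle_circle e)"

lemma winding_hom: "cocycle e \<Longrightarrow> integral_cochain e \<Longrightarrow> real_hom \<pi> (winding_hom e)"
  by (intro real_hom_class_winding circle_map_cocycle_circle)

lemma winding_hom_integral:
  assumes "cocycle e" "integral_cochain e" "C \<in> carrier \<pi>"
  shows "winding_hom e C \<in> \<int>"
proof -
  obtain c where c: "c \<in> paths_between X x0 x0" "C = path_class X c"
    using assms(3) by (rule fundamental_group_carrierE)
  note P = circle_map_cocycle_circle[OF assms(1,2)]
  show ?thesis
    using c winding_integral[OF P, of c] class_winding_path_class[OF P, of c] by (simp add: paths_between_def)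
qed

text \<open>Turning a cocycle into a class and the class back into a cochain changes it by a coboundary, which
  comes from the windings along the chosen paths to the vertices.\<close>

lemma cochain_winding_hom:
  assumes e: "cocycle e" "integral_cochain e" and s: "s \<in> squares Q"
  shows "cochain (winding_hom e) i s = e i s + coboundary (\<lambda>x. - winding (cocycle_circle e) (base_path x)) i s"
proof -
  note P = circle_map_cocycle_circle[OF e]
  have top: "pt s 0 \<in> topspace X" "pt (nxt Q i s) 0 \<in> topspace X" using s by auto
  have ed: "pathin X (edge i s)" "edge i s 0 = pt s 0" "edge i s 1 = pt (nxt Q i s) 0"
    using edge_path[OF s, of i] by (auto simp: paths_between_def)
  note [simp] = base_pathD[OF top(1)] base_pathD[OF top(2)] ed pathin_path_join pathin_path_reverse
  have "winding (cocycle_circle e) (edge i s) = e i s"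
    unfolding edge_def winding_seg[OF e] using exhaust_2[of i] by (auto simp: interpolation_def axis_def)
  then show ?thesis
    unfolding cochain_def rooted_def
    by (simp add: class_winding_path_class[OF P] winding_path_join[OF P] winding_path_reverse[OF P] coboundary_def)
qed

lemma cup_winding_hom:
  assumes "cocycle e" "integral_cochain e" "cocycle e'" "integral_cochain e'"
  shows "cup (cochain (winding_hom e)) (cochain (winding_hom e')) = cup e e'"
  using cup_cong[of "cochain (winding_hom e)" _ "cochain (winding_hom e')", OF cochain_winding_hom[OF assms(1,2)] cochain_winding_hom[OF assms(3,4)]]
    cup_add_coboundaries[OF assms(1,3)] by simp

text \<open>Holonomy as a function on the fundamental group.\<close>

definition period :: "(real \<Rightarrow> 's point) set \<Rightarrow> plane" where
  "period C = (\<chi> i. winding_hom (coord i) C)"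

lemma period_nth: "period C $ i = winding_hom (coord i) C"
  by (simp add: period_def)

lemma real_hom_period: "real_hom \<pi> (\<lambda>C. period C $ i)"
  unfolding period_nth by (rule winding_hom[OF coord])

lemma period_path_class: "c \<in> paths_between X x0 x0 \<Longrightarrow> period (path_class X c) = hol c"
  by (simp add: vec_eq_iff period_nth hol_nth paths_between_def
      class_winding_path_class[OF circle_map_cocycle_circle[OF coord]])

lemma period_induced_auto:
  assumes f: "f \<in> aff_set" and \<gamma>: "\<gamma> \<in> paths_between X x0 (f x0)" and C: "C \<in> carrier \<pi>"
  shows "period (induced_auto X x0 f \<gamma> C) = der Q f *v period C"
proof -
  obtain c where c: "c \<in> paths_between X x0 x0" "C = path_class X c"
    using C by (rule fundamental_group_carrierE)
  note fc = aff_setD(3)[OF f]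
  have P: "pathin X c" "c 0 = x0" "c 1 = x0" "pathin X \<gamma>" "\<gamma> 0 = x0" "\<gamma> 1 = f x0" "pathin X (f \<circ> c)"
    using c \<gamma> pathin_compose[OF _ fc] by (auto simp: paths_between_def)
  note [simp] = P pathin_path_join pathin_path_reverse
  have "path_join \<gamma> (path_join (f \<circ> c) (path_reverse \<gamma>)) \<in> paths_between X x0 x0"
    by (simp add: paths_between_def)
  then have "period (induced_auto X x0 f \<gamma> C) = hol (path_join \<gamma> (path_join (f \<circ> c) (path_reverse \<gamma>)))"
    using c by (simp add: induced_auto_path_class[OF fc \<gamma>] period_path_class)
  also have "\<dots> = hol (f \<circ> c)"
    by (simp add: hol_path_join hol_path_reverse)
  also have "\<dots> = der Q f *v period C"
    using c by (simp add: hol_aff[OF f] period_path_class)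
  finally show ?thesis .
qed

end

section \<open>Plane linear algebra and infinite cyclic groups\<close>

lemma trace_fixed_vector:
  fixes A :: "real^2^2"
  assumes "det A = 1" "A *v v = v" "v \<noteq> 0"
  shows "trace A = 2"
proof -
  have *: "A $ 1 $ 1 * v $ 1 + A $ 1 $ 2 * v $ 2 = v $ 1" "A $ 2 $ 1 * v $ 1 + A $ 2 $ 2 * v $ 2 = v $ 2"
    using assms(2) by (simp_all add: vec_eq_iff matrix_vector_mult_def sum_2 forall_2)
  have d: "A $ 1 $ 1 * A $ 2 $ 2 - A $ 1 $ 2 * A $ 2 $ 1 = 1"
    using assms(1) by (simp add: det_2)
  have "(A $ 2 $ 2 - 1) * (A $ 1 $ 1 * v $ 1 + A $ 1 $ 2 * v $ 2 - v $ 1)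
      - A $ 1 $ 2 * (A $ 2 $ 1 * v $ 1 + A $ 2 $ 2 * v $ 2 - v $ 2)
      = (A $ 1 $ 1 * A $ 2 $ 2 - A $ 1 $ 2 * A $ 2 $ 1 + 1 - A $ 1 $ 1 - A $ 2 $ 2) * v $ 1"
    "(A $ 1 $ 1 - 1) * (A $ 2 $ 1 * v $ 1 + A $ 2 $ 2 * v $ 2 - v $ 2)
      - A $ 2 $ 1 * (A $ 1 $ 1 * v $ 1 + A $ 1 $ 2 * v $ 2 - v $ 1)
      = (A $ 1 $ 1 * A $ 2 $ 2 - A $ 1 $ 2 * A $ 2 $ 1 + 1 - A $ 1 $ 1 - A $ 2 $ 2) * v $ 2"
    by (simp_all add: algebra_simps)
  then have "(1 + 1 - A $ 1 $ 1 - A $ 2 $ 2) * v $ 1 = 0" "(1 + 1 - A $ 1 $ 1 - A $ 2 $ 2) * v $ 2 = 0"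
    unfolding * d by simp_all
  moreover have "v $ 1 \<noteq> 0 \<or> v $ 2 \<noteq> 0"
    using assms(3) by (auto simp: vec_eq_iff forall_2)
  ultimately show ?thesis
    by (auto simp: trace_def sum_2)
qed

text \<open>The matrix preserves areas and fixes \<open>v\<close>, so \<open>x\<close> and its image span the same area with \<open>v\<close>.\<close>

lemma shear_displacement:
  fixes A :: "real^2^2"
  assumes "det A = 1" "A *v v = v" "v \<noteq> 0"
  shows "\<exists>p. A *v x - x = p *\<^sub>R v"
proof -
  have *: "A $ 1 $ 1 * v $ 1 + A $ 1 $ 2 * v $ 2 = v $ 1" "A $ 2 $ 1 * v $ 1 + A $ 2 $ 2 * v $ 2 = v $ 2"
    using assms(2) by (simp_all add: vec_eq_iff matrix_vector_mult_def sum_2 forall_2)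
  have d: "A $ 1 $ 1 * A $ 2 $ 2 - A $ 1 $ 2 * A $ 2 $ 1 = 1"
    using assms(1) by (simp add: det_2)
  define y where "y = A *v x - x"
  have y: "y $ 1 = A $ 1 $ 1 * x $ 1 + A $ 1 $ 2 * x $ 2 - x $ 1" "y $ 2 = A $ 2 $ 1 * x $ 1 + A $ 2 $ 2 * x $ 2 - x $ 2"
    by (simp_all add: y_def matrix_vector_mult_def sum_2)
  have "v $ 1 * y $ 2 - v $ 2 * y $ 1 = (A $ 1 $ 1 * v $ 1 + A $ 1 $ 2 * v $ 2) * (y $ 2 + x $ 2)
      - (A $ 2 $ 1 * v $ 1 + A $ 2 $ 2 * v $ 2) * (y $ 1 + x $ 1) - (v $ 1 * x $ 2 - v $ 2 * x $ 1)"
    unfolding * by (simp add: algebra_simps)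
  also have "\<dots> = (A $ 1 $ 1 * A $ 2 $ 2 - A $ 1 $ 2 * A $ 2 $ 1) * (v $ 1 * x $ 2 - v $ 2 * x $ 1)
      - (v $ 1 * x $ 2 - v $ 2 * x $ 1)"
    unfolding y by (simp add: algebra_simps)
  finally have par: "v $ 1 * y $ 2 = v $ 2 * y $ 1"
    unfolding d by simp
  have "v $ 1 \<noteq> 0 \<or> v $ 2 \<noteq> 0"
    using assms(3) by (auto simp: vec_eq_iff forall_2)
  then have "y = (y $ 1 / v $ 1) *\<^sub>R v \<or> y = (y $ 2 / v $ 2) *\<^sub>R v"
    using par by (auto simp: vec_eq_iff forall_2 field_simps)
  then show ?thesis
    unfolding y_def by blast
qed

text \<open>The image in \<open>\<int>\<close> consists of the multiples of its least positive element, if there is one.\<close>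

lemma injective_integer_hom_cyclic:
  assumes G: "group G" and h: "\<And>x y. x \<in> carrier G \<Longrightarrow> y \<in> carrier G \<Longrightarrow> h (x \<otimes>\<^bsub>G\<^esub> y) = h x + (h y :: int)"
    and inj: "\<And>x. x \<in> carrier G \<Longrightarrow> h x = 0 \<Longrightarrow> x = \<one>\<^bsub>G\<^esub>"
  shows "carrier G = {\<one>\<^bsub>G\<^esub>} \<or> G \<cong> integer_group"
proof (cases "carrier G = {\<one>\<^bsub>G\<^esub>}")
  case False
  interpret group G by (rule G)
  interpret hom: group_hom G integer_group h
    using h by (simp add: group_hom_def group_hom_axioms_def G hom_def)
  have inj': "x = y" if "x \<in> carrier G" "y \<in> carrier G" "h x = h y" for x y
  proof -
    have "h (x \<otimes>\<^bsub>G\<^esub> inv\<^bsub>G\<^esub> y) = 0" using that by simp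
    then have "x \<otimes>\<^bsub>G\<^esub> inv\<^bsub>G\<^esub> y = \<one>\<^bsub>G\<^esub>" using inj that by simp
    then show ?thesis using that by (metis inv_equality inv_inv inv_closed)
  qed
  obtain x where x: "x \<in> carrier G" "x \<noteq> \<one>\<^bsub>G\<^esub>" using False one_closed by blast
  define P where "P n \<longleftrightarrow> n > 0 \<and> (\<exists>x\<in>carrier G. h x = int n)" for n :: nat
  have "P (nat \<bar>h x\<bar>)"
  proof -
    have "h (inv\<^bsub>G\<^esub> x) = - h x" using x by simp
    moreover have "h x \<noteq> 0" using x inj by blast
    ultimately show ?thesis using x(1) unfolding P_def
      by (cases "h x > 0") (force intro: bexI[of _ x] bexI[of _ "inv\<^bsub>G\<^esub> x"])+
  qed
  define n where "n = (LEAST n. P n)"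
  have "P n" unfolding n_def by (rule LeastI) fact
  then obtain z where n: "n > 0" and z: "z \<in> carrier G" "h z = int n" by (auto simp: P_def)
  have pow: "h (z [^]\<^bsub>G\<^esub> (k::int)) = int n * k" for k
    using hom.hom_int_pow[OF z(1), of k] z(2) by simp
  have dvd: "h y = int n * (h y div int n)" if y: "y \<in> carrier G" for y
  proof -
    have "h (y \<otimes>\<^bsub>G\<^esub> z [^]\<^bsub>G\<^esub> (- (h y div int n))) = h y mod int n"
      using y z(1) pow by (simp add: minus_mult_div_eq_mod[symmetric] del: int_pow_neg)
    moreover have "h y mod int n < int n" "h y mod int n \<ge> 0" using n by auto
    ultimately have "\<not> P (nat (h y mod int n)) \<longrightarrow> h y mod int n = 0"
      using y z(1) unfolding P_def
      by (auto dest!: bspec[of _ _ "y \<otimes>\<^bsub>G\<^esub> z [^]\<^bsub>G\<^esub> (- (h y div int n))"] simp del: int_pow_neg)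
    moreover have "\<not> P (nat (h y mod int n))"
      using not_less_Least[of _ P] \<open>h y mod int n < int n\<close> \<open>h y mod int n \<ge> 0\<close> unfolding n_def[symmetric]
      by (metis nat_less_iff)
    ultimately show ?thesis by (metis add.right_neutral mult_div_mod_eq)
  qed
  have "(\<lambda>k::int. z [^]\<^bsub>G\<^esub> k) \<in> iso integer_group G"
    unfolding iso_def
  proof (intro CollectI conjI)
    show "(\<lambda>k::int. z [^]\<^bsub>G\<^esub> k) \<in> hom integer_group G"
      using hom_integer_group_pow[OF z(1)] .
    show "bij_betw (\<lambda>k::int. z [^]\<^bsub>G\<^esub> k) (carrier integer_group) (carrier G)"
      unfolding bij_betw_def
    proof
      show "inj_on (\<lambda>k::int. z [^]\<^bsub>G\<^esub> k) (carrier integer_group)"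
        using pow n by (metis (no_types, lifting) inj_onI mult_left_cancel of_nat_0_eq_iff less_numeral_extra(3))
      have "y \<in> range (\<lambda>k::int. z [^]\<^bsub>G\<^esub> k)" if y: "y \<in> carrier G" for y
        using inj'[OF y, of "z [^]\<^bsub>G\<^esub> (h y div int n)"] dvd[OF y] pow[of "h y div int n"] z(1) by auto
      then show "(\<lambda>k::int. z [^]\<^bsub>G\<^esub> k) ` carrier integer_group = carrier G"
        using z(1) by auto
    qed
  qed
  then show ?thesis
    using group.iso_sym[OF group_integer_group, of G] by (auto simp: is_iso_def)
qed simp

section \<open>The affine maps in the stabiliser of a symplectic homomorphism\<close>

locale marked_origami = based_origami Q x0 for Q :: "'s origami" and x0 :: "'s point" +
  fixes g :: nat and a b :: "nat \<Rightarrow> (real \<Rightarrow> 's point) set" and \<alpha> :: "(real \<Rightarrow> 's point) set \<Rightarrow> nat word"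
  assumes symplectic: "symplectic_generators (fundamental_group (surface Q) x0) g a b"
    and genus: "g \<ge> 2"
    and \<alpha>_epi: "\<alpha> \<in> epi (fundamental_group (surface Q) x0) (free_group {..<g})"
    and \<alpha>_a: "\<And>i. i < g \<Longrightarrow> \<alpha> (a i) = \<one>\<^bsub>free_group {..<g}\<^esub>"
begin

sublocale surface_group "fundamental_group X x0" g a b
  by unfold_locales (rule symplectic)

abbreviation stabiliser :: "('s point \<Rightarrow> 's point) set" where
  "stabiliser \<equiv> carrier (aff_mod_group Q x0 g \<alpha>)"

text \<open>The difference of two cup products, each weighted with the pairing of the other, has a primitive on
  the fundamental group.\<close>

lemma cup_proportional:
  assumes hom: "real_hom \<pi> u" "real_hom \<pi> v" "real_hom \<pi> w" "real_hom \<pi> w'"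
  shows "cup (cochain u) (cochain v) * pairing g a b w w' = pairing g a b u v * cup (cochain w) (cochain w')"
proof -
  let ?\<beta> = "\<lambda>c d. pairing g a b w w' * (u c * v d) - pairing g a b u v * (w c * w' d)"
  have "bihom \<pi> ?\<beta>"
    by (intro bihom_diff bihom_scale bihom_product hom)
  moreover have "surface_sum g a b ?\<beta> = 0"
    by (simp add: surface_sum_diff surface_sum_scale)
  ultimately obtain q where "primitive \<pi> ?\<beta> q"
    by (rule primitive_exists)
  from cup_primitive[OF this]
  have "pairing g a b w w' * cup (cochain u) (cochain v) - pairing g a b u v * cup (cochain w) (cochain w') = 0"
    by (simp add: cup_def cochain_def sum_distrib_left sum_subtractf right_diff_distrib)
  then show ?thesis by (simp add: mult.commute)
qed

text \<open>The pairing of the integral classes dual to two curves that cross once is an integer.  So the cellular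
  cup product divides the pairing.\<close>

lemma fundamental_class:
  obtains k where "k \<in> \<int>"
    "\<And>u v. real_hom \<pi> u \<Longrightarrow> real_hom \<pi> v \<Longrightarrow> cup (cochain u) (cochain v) * k = pairing g a b u v"
proof -
  obtain e e' where e: "cocycle e" "integral_cochain e" "cocycle e'" "integral_cochain e'" "cup e e' = 1"
    by (rule dual_cocycles_exist)
  note w = winding_hom[OF e(1,2)] winding_hom[OF e(3,4)]
  show thesis
  proof (rule that)
    show "pairing g a b (winding_hom e) (winding_hom e') \<in> \<int>"
      unfolding surface_sum_def
      by (intro Ints_sum Ints_diff Ints_mult winding_hom_integral e) auto
    show "cup (cochain u) (cochain v) * pairing g a b (winding_hom e) (winding_hom e') = pairing g a b u v"
      if "real_hom \<pi> u" "real_hom \<pi> v" for u v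
      using cup_proportional[OF that w] cup_winding_hom[OF e(1-4)] e(5) by simp
  qed
qed

text \<open>The cellular cup product of the two coordinates of holonomy is the area of the surface.\<close>

lemma period_pairing_nonzero: "pairing g a b (\<lambda>C. period C $ 1) (\<lambda>C. period C $ 2) \<noteq> 0"
proof
  assume 0: "pairing g a b (\<lambda>C. period C $ 1) (\<lambda>C. period C $ 2) = 0"
  obtain u v where uv: "real_hom \<pi> u" "real_hom \<pi> v" "pairing g a b u v = 1"
    using integral_pair_exists[OF genus fg.one_closed] by metis
  have "cup (cochain (\<lambda>C. period C $ 1)) (cochain (\<lambda>C. period C $ 2)) = card (squares Q)"
    unfolding period_nth using cup_winding_hom[OF coord coord, of 1 2] cup_coord by simp
  with cup_proportional[OF uv(1,2) real_hom_period real_hom_period, of 1 2] 0 uv(3)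
  have "card (squares Q) = 0" by simp
  then show False using finite_squares squares_nonempty by simp
qed

text \<open>On the coordinates of holonomy the induced automorphism scales the pairing by the determinant of
  the linear part, and the scaling is the same for all classes.\<close>

lemma pairing_aff:
  assumes f: "f \<in> aff_set" and \<gamma>: "\<gamma> \<in> paths_between X x0 (f x0)" and u: "real_hom \<pi> u" and v: "real_hom \<pi> v"
  shows "pairing g a b (\<lambda>C. u (induced_auto X x0 f \<gamma> C)) (\<lambda>C. v (induced_auto X x0 f \<gamma> C)) = pairing g a b u v"
proof -
  let ?\<phi> = "induced_auto X x0 f \<gamma>" and ?A = "der Q f"
  let ?w = "\<lambda>i C. period C $ i"
  have \<phi>: "?\<phi> \<in> hom \<pi> \<pi>" by (rule induced_auto_hom[OF aff_setD(3)[OF f] \<gamma>])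
  have "period (?\<phi> C) $ i = ?A $ i $ 1 * period C $ 1 + ?A $ i $ 2 * period C $ 2" if "C \<in> carrier \<pi>" for C i
    by (simp add: period_induced_auto[OF f \<gamma> that] matrix_vector_mult_def sum_2)
  then have "pairing g a b (\<lambda>C. ?w 1 (?\<phi> C)) (\<lambda>C. ?w 2 (?\<phi> C))
      = pairing g a b (\<lambda>C. ?A $ 1 $ 1 * ?w 1 C + ?A $ 1 $ 2 * ?w 2 C) (\<lambda>C. ?A $ 2 $ 1 * ?w 1 C + ?A $ 2 $ 2 * ?w 2 C)"
    by (intro pairing_cong) simp
  also have "\<dots> = (?A $ 1 $ 1 * ?A $ 2 $ 2 - ?A $ 1 $ 2 * ?A $ 2 $ 1) * pairing g a b (?w 1) (?w 2)"
    by (simp only: pairing_add_left pairing_add_right pairing_scale_left pairing_scale_right pairing_self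
        pairing_swap[of g a b "?w 2" "?w 1"]) (simp add: algebra_simps)
  also have "?A $ 1 $ 1 * ?A $ 2 $ 2 - ?A $ 1 $ 2 * ?A $ 2 $ 1 = 1"
    using der_affine(2)[OF f] by (simp add: det_2)
  finally have "pairing g a b (\<lambda>C. ?w 1 (?\<phi> C)) (\<lambda>C. ?w 2 (?\<phi> C)) = pairing g a b (?w 1) (?w 2)" by simp
  then show ?thesis
    using pairing_endomorphism[OF \<phi> u v real_hom_period real_hom_period, of 1 2] period_pairing_nonzero by simp
qed

lemma stabiliser_iff:
  "f \<in> stabiliser \<longleftrightarrow> f \<in> aff_set \<and>
     (\<exists>\<gamma>\<in>paths_between X x0 (f x0). \<exists>w\<in>carrier (free_group {..<g}). \<forall>C\<in>carrier \<pi>.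
        \<alpha> (induced_auto X x0 f \<gamma> C) = w \<otimes>\<^bsub>free_group {..<g}\<^esub> \<alpha> C \<otimes>\<^bsub>free_group {..<g}\<^esub> inv\<^bsub>free_group {..<g}\<^esub> w)"
proof -
  have "outer_class X x0 f \<in> mod_group X x0" if "f \<in> aff_set"
    using that unfolding mod_group_def aff_set_def aff_group_def by auto
  then show ?thesis
    unfolding aff_mod_group_def mod_subgroup_def aff_set_def[symmetric]
    by (auto simp: outer_class_def)
qed

text \<open>The two facts through which the stabiliser condition is used: the classes that kill all \<open>a\<^sub>i\<close> are
  fixed, and dually the values of all classes on the \<open>a\<^sub>i\<close> are preserved.\<close>

lemma stabiliser_action:
  assumes "f \<in> stabiliser"
  obtains \<gamma> where "f \<in> aff_set" "\<gamma> \<in> paths_between X x0 (f x0)"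
    "\<And>u C. real_hom \<pi> u \<Longrightarrow> (\<forall>i<g. u (a i) = 0) \<Longrightarrow> C \<in> carrier \<pi> \<Longrightarrow> u (induced_auto X x0 f \<gamma> C) = u C"
    "\<And>v i. real_hom \<pi> v \<Longrightarrow> i < g \<Longrightarrow> v (induced_auto X x0 f \<gamma> (a i)) = v (a i)"
proof -
  obtain \<gamma> w where f: "f \<in> aff_set" and \<gamma>: "\<gamma> \<in> paths_between X x0 (f x0)" and w: "w \<in> carrier (free_group {..<g})"
    and conj: "\<And>C. C \<in> carrier \<pi> \<Longrightarrow> \<alpha> (induced_auto X x0 f \<gamma> C)
        = w \<otimes>\<^bsub>free_group {..<g}\<^esub> \<alpha> C \<otimes>\<^bsub>free_group {..<g}\<^esub> inv\<^bsub>free_group {..<g}\<^esub> w"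
    using assms unfolding stabiliser_iff by blast
  have \<phi>: "induced_auto X x0 f \<gamma> \<in> hom \<pi> \<pi>" by (rule induced_auto_hom[OF aff_setD(3)[OF f] \<gamma>])
  have triv: "u (induced_auto X x0 f \<gamma> C) = u C"
    if "real_hom \<pi> u" "\<forall>i<g. u (a i) = 0" "C \<in> carrier \<pi>" for u C
    by (rule real_hom_factors[OF \<alpha>_epi \<alpha>_a that(1) _ that(3) hom_in_carrier[OF \<phi> that(3)] w conj[OF that(3)]])
       (use that(2) in auto)
  show thesis
  proof (rule that[OF f \<gamma> triv])
    show "v (induced_auto X x0 f \<gamma> (a i)) = v (a i)" if "real_hom \<pi> v" "i < g" for v i
      by (rule lagrangian_duality[OF \<phi> that triv pairing_aff[OF f \<gamma> _ that(1)]])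
  qed
qed

lemma stabiliser_der_fixes:
  assumes "f \<in> stabiliser" "i < g"
  shows "der Q f *v period (a i) = period (a i)"
proof -
  obtain \<gamma> where f: "f \<in> aff_set" and \<gamma>: "\<gamma> \<in> paths_between X x0 (f x0)"
    and act: "\<And>v i. real_hom \<pi> v \<Longrightarrow> i < g \<Longrightarrow> v (induced_auto X x0 f \<gamma> (a i)) = v (a i)"
    using stabiliser_action[OF assms(1)] by metis
  have "period (induced_auto X x0 f \<gamma> (a i)) = period (a i)"
    using act[OF real_hom_period assms(2)] by (simp add: vec_eq_iff)
  then show ?thesis
    using period_induced_auto[OF f \<gamma> a_closed[OF assms(2)]] by simp
qed

text \<open>Were all periods parallel to \<open>v\<close>, the coordinates of holonomy would be linearly dependent and their
  pairing would vanish.\<close>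

lemma periods_span:
  fixes v :: plane
  assumes "v \<noteq> 0"
  obtains C where "C \<in> carrier \<pi>" "v $ 1 * period C $ 2 \<noteq> v $ 2 * period C $ 1"
proof (rule ccontr)
  assume "\<not> thesis"
  then have par: "v $ 1 * period C $ 2 = v $ 2 * period C $ 1" if "C \<in> carrier \<pi>" for C
    using that \<open>\<And>C. \<lbrakk>C \<in> carrier \<pi>; v $ 1 * period C $ 2 \<noteq> v $ 2 * period C $ 1\<rbrakk> \<Longrightarrow> thesis\<close> by blast
  let ?w = "\<lambda>i C. period C $ i"
  have "v $ 1 * pairing g a b (?w 1) (?w 2) = pairing g a b (?w 1) (\<lambda>C. v $ 1 * ?w 2 C)"
    by (simp add: pairing_scale_right)
  also have "\<dots> = pairing g a b (?w 1) (\<lambda>C. v $ 2 * ?w 1 C)"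
    by (intro pairing_cong) (simp add: par)
  also have "\<dots> = 0" by (simp add: pairing_scale_right pairing_self)
  finally have 1: "v $ 1 = 0" using period_pairing_nonzero by simp
  have "v $ 2 * pairing g a b (?w 1) (?w 2) = pairing g a b (\<lambda>C. v $ 2 * ?w 1 C) (?w 2)"
    by (simp add: pairing_scale_left)
  also have "\<dots> = pairing g a b (\<lambda>C. v $ 1 * ?w 2 C) (?w 2)"
    by (intro pairing_cong) (simp add: par)
  also have "\<dots> = 0" by (simp add: pairing_scale_left pairing_self)
  finally have "v $ 2 = 0" using period_pairing_nonzero by simp
  with 1 assms show False by (simp add: vec_eq_iff forall_2)
qed

lemma matrix_determined_by_periods:
  assumes "\<And>C. C \<in> carrier \<pi> \<Longrightarrow> A *v period C = B *v period C"
  shows "A = (B :: real^2^2)"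
proof -
  have "A $ i = B $ i" for i
  proof (rule ccontr)
    assume "A $ i \<noteq> B $ i"
    define v :: plane where "v = (\<chi> j. if j = 1 then A $ i $ 2 - B $ i $ 2 else - (A $ i $ 1 - B $ i $ 1))"
    have "v \<noteq> 0" using \<open>A $ i \<noteq> B $ i\<close> by (auto simp: v_def vec_eq_iff forall_2)
    then obtain C where C: "C \<in> carrier \<pi>" "v $ 1 * period C $ 2 \<noteq> v $ 2 * period C $ 1"
      by (rule periods_span)
    have "(A *v period C) $ i = (B *v period C) $ i" using assms[OF C(1)] by simp
    then show False using C(2) by (simp add: v_def matrix_vector_mult_def sum_2 algebra_simps)
  qed
  then show ?thesis by (simp add: vec_eq_iff)
qed

text \<open>If the periods of all \<open>a\<^sub>i\<close> vanish, the coordinates of holonomy are among the classes that the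
  stabiliser fixes.\<close>

lemma stabiliser_der_trivial:
  assumes f: "f \<in> stabiliser" and a0: "\<And>i. i < g \<Longrightarrow> period (a i) = 0"
  shows "der Q f = mat 1"
proof (rule matrix_determined_by_periods)
  fix C assume C: "C \<in> carrier \<pi>"
  obtain \<gamma> where f': "f \<in> aff_set" and \<gamma>: "\<gamma> \<in> paths_between X x0 (f x0)"
    and act: "\<And>u C. real_hom \<pi> u \<Longrightarrow> (\<forall>i<g. u (a i) = 0) \<Longrightarrow> C \<in> carrier \<pi> \<Longrightarrow> u (induced_auto X x0 f \<gamma> C) = u C"
    using stabiliser_action[OF f] by metis
  have "period (induced_auto X x0 f \<gamma> C) = period C"
    using act[OF real_hom_period _ C] a0 by (simp add: vec_eq_iff)
  then show "der Q f *v period C = mat 1 *v period C"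
    using period_induced_auto[OF f' \<gamma> C] by simp
qed

lemma stabiliser_trace: "f \<in> stabiliser \<Longrightarrow> trace (der Q f) = 2"
proof -
  assume f: "f \<in> stabiliser"
  then have det: "det (der Q f) = 1"
    using stabiliser_iff der_affine(2) by blast
  show ?thesis
  proof (cases "\<exists>i<g. period (a i) \<noteq> 0")
    case True
    then show ?thesis
      using trace_fixed_vector[OF det] stabiliser_der_fixes[OF f] by blast
  next
    case False
    then have "der Q f = mat 1" using stabiliser_der_trivial[OF f] by blast
    then show ?thesis by (simp add: trace_def mat_def)
  qed
qed

section \<open>Translations in the stabiliser are trivial\<close>

text \<open>Let \<open>z\<close> be the change of a class \<open>v\<close> under \<open>f\<close>, and suppose that \<open>z\<close> itself does not change.  Along
  the iterates of a loop under \<open>f\<close> the value of \<open>v\<close> then grows linearly, by \<open>z\<close> in each step.  But after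
  \<open>m\<close> steps the loop returns to itself, so \<open>z\<close> vanishes.\<close>

lemma translation_acts_trivially:
  assumes f: "f \<in> aff_set" and \<gamma>: "\<gamma> \<in> paths_between X x0 (f x0)"
    and m: "m > 0" "\<And>x. x \<in> topspace X \<Longrightarrow> (f ^^ m) x = x"
    and unip: "\<And>C. C \<in> carrier \<pi> \<Longrightarrow> z (induced_auto X x0 f \<gamma> C) = z C"
    and z: "\<And>C. C \<in> carrier \<pi> \<Longrightarrow> z C = v (induced_auto X x0 f \<gamma> C) - v C"
    and v: "real_hom \<pi> v" and C: "C \<in> carrier \<pi>"
  shows "v (induced_auto X x0 f \<gamma> C) = v C"
proof -
  let ?\<phi> = "induced_auto X x0 f \<gamma>"
  note fc = aff_setD(3)[OF f]
  have \<phi>: "?\<phi> \<in> hom \<pi> \<pi>" by (rule induced_auto_hom[OF fc \<gamma>])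
  have zhom: "real_hom \<pi> z"
    using real_hom_diff[OF real_hom_compose[OF v \<phi>] v] z by (simp add: real_hom_def)
  obtain c where c: "c \<in> paths_between X x0 x0" "C = path_class X c"
    using C by (rule fundamental_group_carrierE)
  define cj where "cj j = (f ^^ j) \<circ> c" for j
  have loop: "cj j \<in> paths_between X ((f ^^ j) x0) ((f ^^ j) x0)" for j
  proof (induction j)
    case 0
    then show ?case using c by (simp add: cj_def)
  next
    case (Suc j)
    have eq: "cj (Suc j) = f \<circ> cj j" by (auto simp: cj_def)
    show ?case
      unfolding eq funpow.simps(2) comp_apply[of f "f ^^ j"] by (rule paths_between_compose[OF Suc fc])
  qed
  have step: "u (?\<phi> (rooted (cj j))) = u (rooted (cj (Suc j)))" if "real_hom \<pi> u" for u j
  proof -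
    have "cj (Suc j) = f \<circ> cj j" by (auto simp: cj_def)
    then show ?thesis using real_hom_induced_auto_rooted[OF that fc \<gamma> loop[of j]] by simp
  qed
  have in\<pi>: "rooted (cj j) \<in> carrier \<pi>" for j by (rule rooted_in[OF loop])
  have zj: "z (rooted (cj j)) = z (rooted (cj 0))" for j
    by (induction j) (use step[OF zhom] unip in\<pi> in \<open>metis+\<close>)
  have "v (rooted (cj j)) = v (rooted (cj 0)) + j * z (rooted (cj 0))" for j :: nat
  proof (induction j)
    case (Suc j)
    have "v (rooted (cj (Suc j))) = v (rooted (cj j)) + z (rooted (cj j))"
      using step[OF v, of j] z[OF in\<pi>[of j]] by simp
    then show ?case using Suc zj[of j] by (simp add: algebra_simps)
  qed simp
  moreover have "rooted (cj m) = rooted (cj 0)"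
  proof (rule rooted_cong[symmetric], rule path_homotopic_eq)
    show "pathin X (cj 0)" using loop[of 0] by (simp add: paths_between_def)
    fix t :: real assume "t \<in> {0..1}"
    then have "c t \<in> topspace X" using c path_image_subset_topspace[of X c] by (auto simp: paths_between_def)
    then show "cj 0 t = cj m t" using m(2) by (simp add: cj_def)
  qed
  ultimately have "z (rooted (cj 0)) = 0" using m(1) by (metis add_cancel_right_right mult_eq_0_iff of_nat_0_eq_iff not_less_zero)
  moreover have "z (rooted (cj 0)) = z C"
    using real_hom_rooted_loop[OF zhom c(1)] c(2) by (simp add: cj_def)
  ultimately show ?thesis using z[OF C] by simp
qed

text \<open>The coboundary of \<open>h\<close>, an average over the powers of \<open>f\<close>, makes the cochain invariant, because the
  drifts along every orbit of \<open>f\<close> cancel.  Under \<open>f\<close> the values of \<open>h\<close> change by integers, so the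
  fractional part of \<open>h\<close> is invariant, and rounding \<open>h\<close> down makes the cochain integral while keeping
  it invariant.\<close>

lemma invariant_cocycle:
  assumes f: "f \<in> aff_set" and \<gamma>: "\<gamma> \<in> paths_between X x0 (f x0)" and deck: "deck f \<sigma>"
    and m: "m > 0" "\<And>x. x \<in> topspace X \<Longrightarrow> (f ^^ m) x = x"
    and u: "real_hom \<pi> u" and int: "\<And>C. C \<in> carrier \<pi> \<Longrightarrow> u C \<in> \<int>"
    and inv: "\<And>C. C \<in> carrier \<pi> \<Longrightarrow> u (induced_auto X x0 f \<gamma> C) = u C"
    and orbit: "(\<Sum>j<m. u (drift f \<gamma> ((f ^^ j) x0))) = 0"
  obtains \<xi> where "\<And>i s. s \<in> squares Q \<Longrightarrow> cochain u i s + coboundary \<xi> i s \<in> \<int>"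
    "\<And>i s. s \<in> squares Q \<Longrightarrow> cochain u i (\<sigma> s) + coboundary \<xi> i (\<sigma> s) = cochain u i s + coboundary \<xi> i s"
proof -
  note fc = aff_setD(3)[OF f] and ftop = aff_setD(7)[OF f]
  define \<delta> where "\<delta> x = u (drift f \<gamma> x)" for x
  have \<delta>int: "\<delta> x \<in> \<int>" if "x \<in> topspace X" for x
    unfolding \<delta>_def by (rule int[OF drift_in[OF fc \<gamma> that]])
  have pow_top: "(f ^^ j) x \<in> topspace X" if "x \<in> topspace X" for x j
    using that ftop by (induction j) auto
  have rel: "u (rooted (f \<circ> c)) = u (rooted c) + \<delta> y - \<delta> x" if c: "c \<in> paths_between X x y" for c x y
    using real_hom_induced_auto_rooted[OF u fc \<gamma> c] inv[OF rooted_in[OF c]] by (simp add: \<delta>_def)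
  have orb: "(\<Sum>j<m. \<delta> ((f ^^ j) x)) = 0" if x: "x \<in> topspace X" for x
  proof -
    obtain c where c: "c \<in> paths_between X x0 x" by (rule path_exists[OF x0 x])
    have cj: "(f ^^ j) \<circ> c \<in> paths_between X ((f ^^ j) x0) ((f ^^ j) x)" for j
    proof (induction j)
      case (Suc j)
      have eq: "f ^^ Suc j \<circ> c = f \<circ> ((f ^^ j) \<circ> c)" by auto
      show ?case
        unfolding eq unfolding funpow.simps(2) comp_apply[of f "f ^^ j"] by (rule paths_between_compose[OF Suc fc])
    qed (use c in simp)
    have steps: "u (rooted ((f ^^ n) \<circ> c)) = u (rooted c) + (\<Sum>j<n. \<delta> ((f ^^ j) x)) - (\<Sum>j<n. \<delta> ((f ^^ j) x0))" for n
    proof (induction n)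
      case (Suc n)
      have eq: "f ^^ Suc n \<circ> c = f \<circ> ((f ^^ n) \<circ> c)" by auto
      show ?case
        unfolding eq sum.lessThan_Suc using rel[OF cj[of n]] Suc by linarith
    qed simp
    have "rooted ((f ^^ m) \<circ> c) = rooted c"
    proof (rule rooted_cong[symmetric], rule path_homotopic_eq)
      show "pathin X c" using c by (simp add: paths_between_def)
      fix t :: real assume "t \<in> {0..1}"
      then have "c t \<in> topspace X" using c path_image_subset_topspace[of X c] by (auto simp: paths_between_def)
      then show "c t = ((f ^^ m) \<circ> c) t" using m(2) by simp
    qed
    then show ?thesis using steps[of m] orbit by (simp add: \<delta>_def)
  qed
  define h where "h x = (\<Sum>j<m. \<Sum>i<j. \<delta> ((f ^^ i) x)) / m" for x
  define \<xi> where "\<xi> x = real_of_int \<lfloor>h x\<rfloor>" for x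
  have hf: "h (f x) = h x - \<delta> x" if x: "x \<in> topspace X" for x
  proof -
    have "(\<Sum>i<j. \<delta> ((f ^^ i) (f x))) = (\<Sum>i<j. \<delta> ((f ^^ i) x)) + (\<delta> ((f ^^ j) x) - \<delta> x)" for j
      by (induction j) (simp_all add: funpow_swap1)
    then have "(\<Sum>j<m. \<Sum>i<j. \<delta> ((f ^^ i) (f x)))
        = (\<Sum>j<m. \<Sum>i<j. \<delta> ((f ^^ i) x)) + (\<Sum>j<m. \<delta> ((f ^^ j) x)) - m * \<delta> x"
      by (simp add: sum.distrib sum_subtractf)
    then have "h (f x) = ((\<Sum>j<m. \<Sum>i<j. \<delta> ((f ^^ i) x)) - m * \<delta> x) / m"
      by (simp add: h_def orb[OF x])
    also have "\<dots> = h x - \<delta> x" using m(1) by (simp add: h_def diff_divide_distrib)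
    finally show ?thesis .
  qed
  have \<xi>f: "\<xi> (f x) = \<xi> x - \<delta> x" if x: "x \<in> topspace X" for x
  proof -
    obtain n where n: "\<delta> x = of_int n" using \<delta>int[OF x] by (rule Ints_cases)
    show ?thesis by (simp add: \<xi>_def hf[OF x] n)
  qed
  show thesis
  proof (rule that[of \<xi>])
    fix i s assume s: "s \<in> squares Q"
    show "cochain u i s + coboundary \<xi> i s \<in> \<int>"
      unfolding cochain_def coboundary_def \<xi>_def using int[OF edge_in[OF s]] by (intro Ints_add Ints_diff) auto
    have \<sigma>: "f (pt s z) = pt (\<sigma> s) z" if "z \<in> unit_square" for z
      using deck s that by (simp add: deck_def)
    have \<sigma>s: "\<sigma> s \<in> squares Q" using deck s by (simp add: deck_def)
    have p: "f (pt s 0) = pt (\<sigma> s) 0" "f (pt (nxt Q i s) 0) = pt (nxt Q i (\<sigma> s)) 0"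
      using \<sigma>[of 0] \<sigma>[of "axis i 1"] s \<sigma>s by (simp_all add: pt_axis)
    have "rooted (f \<circ> edge i s) = rooted (edge i (\<sigma> s))"
    proof (rule rooted_cong, rule path_homotopic_eq)
      show "pathin X (f \<circ> edge i s)"
        using paths_between_compose[OF edge_path[OF s] fc, of i] by (simp add: paths_between_def)
      fix t :: real assume "t \<in> {0..1}"
      then show "(f \<circ> edge i s) t = edge i (\<sigma> s) t"
        using \<sigma>[OF linepath_in_square[of 0 "axis i 1" t]] by (simp add: edge_def seg_def)
    qed
    then have "cochain u i (\<sigma> s) = cochain u i s + \<delta> (pt (nxt Q i s) 0) - \<delta> (pt s 0)"
      using rel[OF edge_path[OF s, of i]] by (simp add: cochain_def)
    moreover have "coboundary \<xi> i (\<sigma> s) = coboundary \<xi> i s - \<delta> (pt (nxt Q i s) 0) + \<delta> (pt s 0)"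
      using \<xi>f[of "pt s 0"] \<xi>f[of "pt (nxt Q i s) 0"] s by (simp add: coboundary_def p)
    ultimately show "cochain u i (\<sigma> s) + coboundary \<xi> i (\<sigma> s) = cochain u i s + coboundary \<xi> i s"
      by simp
  qed
qed

end

text \<open>Every orbit has \<open>m\<close> elements, and the function is constant on it.\<close>

lemma sum_free_cyclic_action:
  fixes F :: "'a \<Rightarrow> real"
  assumes S: "finite S" and \<sigma>: "\<And>s. s \<in> S \<Longrightarrow> \<sigma> s \<in> S" and m: "m > 0" "\<And>s. s \<in> S \<Longrightarrow> (\<sigma> ^^ m) s = s"
    and free: "\<And>j s. 0 < j \<Longrightarrow> j < m \<Longrightarrow> s \<in> S \<Longrightarrow> (\<sigma> ^^ j) s \<noteq> s"
    and F: "\<And>s. s \<in> S \<Longrightarrow> F (\<sigma> s) = F s" "\<And>s. s \<in> S \<Longrightarrow> F s \<in> \<int>"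
  shows "\<exists>n\<in>\<int>. sum F S = m * n"
proof -
  have pow: "(\<sigma> ^^ j) s \<in> S" if "s \<in> S" for s j using that \<sigma> by (induction j) auto
  have powF: "F ((\<sigma> ^^ j) s) = F s" if "s \<in> S" for s j using that pow F(1) by (induction j) auto
  define orb where "orb s = (\<lambda>j. (\<sigma> ^^ j) s) ` {..<m}" for s
  have powm: "(\<sigma> ^^ j) s \<in> orb s" if "s \<in> S" for s j
  proof -
    have "(\<sigma> ^^ (m * q)) s = s" for q
      using that m(2) by (induction q) (simp_all add: funpow_add)
    then have "(\<sigma> ^^ j) s = (\<sigma> ^^ (j mod m)) s"
      by (metis comp_apply funpow_add mod_mult_div_eq)
    then show ?thesis using m(1) by (auto simp: orb_def)
  qed
  have orb_eq: "orb t = orb s" if s: "s \<in> S" and t: "t \<in> orb s" for s t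
  proof -
    obtain j where j: "j < m" "t = (\<sigma> ^^ j) s" using t by (auto simp: orb_def)
    have "s = (\<sigma> ^^ (m - j)) t"
      using j m(2)[OF s] by (simp add: funpow_add[symmetric, unfolded comp_def, THEN fun_cong])
    have tS: "t \<in> S" using j pow s by simp
    show ?thesis
    proof (intro equalityI subsetI)
      fix x assume "x \<in> orb t"
      then obtain i where "x = (\<sigma> ^^ i) t" by (auto simp: orb_def)
      then have "x = (\<sigma> ^^ (i + j)) s" using j by (simp add: funpow_add)
      then show "x \<in> orb s" using powm[OF s] by simp
    next
      fix x assume "x \<in> orb s"
      then obtain i where "x = (\<sigma> ^^ i) s" by (auto simp: orb_def)
      then have "x = (\<sigma> ^^ (i + (m - j))) t" using \<open>s = (\<sigma> ^^ (m - j)) t\<close> by (simp add: funpow_add)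
      then show "x \<in> orb t" using powm[OF tS] by simp
    qed
  qed
  have self: "s \<in> orb s" if "s \<in> S" for s using powm[OF that, of 0] by simp
  have card: "card (orb s) = m" if s: "s \<in> S" for s
  proof -
    have "inj_on (\<lambda>j. (\<sigma> ^^ j) s) {..<m}"
    proof (rule linorder_inj_onI)
      fix i j assume ij: "i < j" "i \<in> {..<m}" "j \<in> {..<m}"
      show "(\<sigma> ^^ i) s \<noteq> (\<sigma> ^^ j) s"
      proof
        assume "(\<sigma> ^^ i) s = (\<sigma> ^^ j) s"
        moreover have "(\<sigma> ^^ j) s = (\<sigma> ^^ (j - i)) ((\<sigma> ^^ i) s)"
          using ij(1) by (simp add: funpow_add[symmetric, unfolded comp_def, THEN fun_cong])
        moreover have "0 < j - i" "j - i < m" using ij by auto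
        ultimately show False using free[of "j - i" "(\<sigma> ^^ i) s"] pow[OF s] by metis
      qed
    qed auto
    then show ?thesis by (simp add: orb_def card_image)
  qed
  have "sum F S = (\<Sum>Y\<in>orb ` S. \<Sum>s\<in>{s \<in> S. orb s = Y}. F s)"
    using sum.group[of S "orb ` S" orb F] S by simp
  also have "\<dots> = (\<Sum>Y\<in>orb ` S. m * F (SOME s. s \<in> S \<and> orb s = Y))"
  proof (intro sum.cong refl)
    fix Y assume "Y \<in> orb ` S"
    then obtain s0 where "s0 \<in> S" "orb s0 = Y" by blast
    define s where "s = (SOME s. s \<in> S \<and> orb s = Y)"
    have s: "s \<in> S" "orb s = Y"
      unfolding s_def using someI[of "\<lambda>s. s \<in> S \<and> orb s = Y" s0] \<open>s0 \<in> S\<close> \<open>orb s0 = Y\<close> by auto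
    have "{t \<in> S. orb t = Y} = orb s"
    proof (intro equalityI subsetI)
      fix t assume "t \<in> {t \<in> S. orb t = Y}"
      then show "t \<in> orb s" using self[of t] s(2) by simp
    next
      fix t assume t: "t \<in> orb s"
      then have "t \<in> S" using pow[OF s(1)] by (auto simp: orb_def)
      then show "t \<in> {t \<in> S. orb t = Y}" using orb_eq[OF s(1) t] s(2) by simp
    qed
    moreover have "F t = F s" if "t \<in> orb s" for t
      using that powF[OF s(1)] by (auto simp: orb_def)
    ultimately have "(\<Sum>t\<in>{t \<in> S. orb t = Y}. F t) = (\<Sum>t\<in>orb s. F s)"
      by (intro sum.cong) auto
    then show "(\<Sum>t\<in>{t \<in> S. orb t = Y}. F t) = m * F (SOME s. s \<in> S \<and> orb s = Y)"
      using card[OF s(1)] by (simp add: s_def)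
  qed
  also have "\<dots> = m * (\<Sum>Y\<in>orb ` S. F (SOME s. s \<in> S \<and> orb s = Y))"
    by (simp add: sum_distrib_left)
  finally have eq: "sum F S = m * (\<Sum>Y\<in>orb ` S. F (SOME s. s \<in> S \<and> orb s = Y))" .
  have "F (SOME s. s \<in> S \<and> orb s = Y) \<in> \<int>" if Y: "Y \<in> orb ` S" for Y
  proof -
    obtain s0 where "s0 \<in> S" "orb s0 = Y" using Y by blast
    then show ?thesis using someI[of "\<lambda>s. s \<in> S \<and> orb s = Y" s0] F(2) by auto
  qed
  then have "(\<Sum>Y\<in>orb ` S. F (SOME s. s \<in> S \<and> orb s = Y)) \<in> \<int>" by (intro Ints_sum) auto
  with eq show ?thesis by blast
qed

context marked_origami
begin

text \<open>Choose integral classes with pairing 1 that vanish on the product of the drifts along an orbit.  They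
  have invariant cocycles, whose cup product is a multiple of the order \<open>m\<close> of the translation and
  divides 1.\<close>

lemma translation_trivial:
  assumes f: "f \<in> stabiliser" and der: "der Q f = mat 1"
  shows "\<And>x. x \<in> topspace X \<Longrightarrow> f x = x"
proof -
  obtain \<gamma> where aff: "f \<in> aff_set" and \<gamma>: "\<gamma> \<in> paths_between X x0 (f x0)"
    and lag: "\<And>u C. real_hom \<pi> u \<Longrightarrow> (\<forall>i<g. u (a i) = 0) \<Longrightarrow> C \<in> carrier \<pi> \<Longrightarrow> u (induced_auto X x0 f \<gamma> C) = u C"
    and act: "\<And>v i. real_hom \<pi> v \<Longrightarrow> i < g \<Longrightarrow> v (induced_auto X x0 f \<gamma> (a i)) = v (a i)"
    using stabiliser_action[OF f] by metis
  note fc = aff_setD(3)[OF aff]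
  have \<phi>: "induced_auto X x0 f \<gamma> \<in> hom \<pi> \<pi>" by (rule induced_auto_hom[OF fc \<gamma>])
  obtain \<sigma> where \<sigma>: "deck f \<sigma>" by (rule translation_deck[OF aff der])
  then have \<sigma>in: "\<sigma> s \<in> squares Q" if "s \<in> squares Q" for s using that by (simp add: deck_def)
  obtain s0 where s0: "s0 \<in> squares Q" using squares_nonempty by blast
  have "inj_on \<sigma> (squares Q)"
  proof (rule inj_onI)
    fix s t assume st: "s \<in> squares Q" "t \<in> squares Q" "\<sigma> s = \<sigma> t"
    let ?h = "(\<chi> i. 1/2) :: plane"
    have h: "?h \<in> unit_square" "\<not> corner ?h"
      using unit_Ints_iff[of "1/2"] by (auto simp: mem_unit_square corner_def)
    then have "f (pt s ?h) = f (pt t ?h)" using \<sigma> st by (simp add: deck_def)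
    then have "pt s ?h = pt t ?h"
      by (rule inj_onD[OF bij_betw_imp_inj_on[OF aff_setD(4)[OF aff]]]) (intro pt_in st h)+
    then show "s = t" by (rule pt_side_inject[OF st(1,2) h])
  qed
  then obtain n where n: "n > 0 \<and> (\<sigma> ^^ n) s0 = s0"
    using periodic_funpow[OF finite_squares _ _ s0] \<sigma>in by (metis image_subsetI)
  define m where "m = (LEAST n. n > 0 \<and> (\<sigma> ^^ n) s0 = s0)"
  have m: "m > 0" "(\<sigma> ^^ m) s0 = s0"
    using LeastI[of "\<lambda>n. n > 0 \<and> (\<sigma> ^^ n) s0 = s0", OF n] by (auto simp: m_def)
  have m\<sigma>: "(\<sigma> ^^ m) s = s" if "s \<in> squares Q" for s
    by (rule deck_fixed_square(1)[OF deck_funpow[OF \<sigma>] s0 m(2) that])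
  have mf: "(f ^^ m) x = x" if "x \<in> topspace X" for x
    by (rule deck_fixed_square(2)[OF deck_funpow[OF \<sigma>] s0 m(2) that])
  have free: "(\<sigma> ^^ j) s \<noteq> s" if j: "0 < j" "j < m" and s: "s \<in> squares Q" for j s
  proof
    assume "(\<sigma> ^^ j) s = s"
    then have "(\<sigma> ^^ j) s0 = s0" by (rule deck_fixed_square(1)[OF deck_funpow[OF \<sigma>] s _ s0])
    then show False using j not_less_Least[of j "\<lambda>n. n > 0 \<and> (\<sigma> ^^ n) s0 = s0"] by (simp add: m_def)
  qed
  have triv: "v (induced_auto X x0 f \<gamma> C) = v C" if v: "real_hom \<pi> v" and C: "C \<in> carrier \<pi>" for v C
  proof -
    let ?z = "\<lambda>C. v (induced_auto X x0 f \<gamma> C) - v C"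
    have "real_hom \<pi> ?z" by (rule real_hom_diff[OF real_hom_compose[OF v \<phi>] v])
    then have unip: "?z (induced_auto X x0 f \<gamma> C) = ?z C" if "C \<in> carrier \<pi>" for C
      using lag[of ?z] act[OF v] that by simp
    show ?thesis
      by (rule translation_acts_trivially[where z = ?z, OF aff \<gamma> m(1) mf unip refl v C])
  qed
  \<comment> \<open>The product of the drifts along the orbit of the base point, for which the order does not
    matter because it is only evaluated under homomorphisms to \<open>\<real>\<close>.\<close>
  have drifts: "\<exists>d. d \<in> carrier \<pi> \<and> (\<forall>u. real_hom \<pi> u \<longrightarrow> u d = (\<Sum>j<n. u (drift f \<gamma> ((f ^^ j) x0))))" for n
  proof (induction n)
    case 0
    then show ?case using fg.real_hom_one by (intro exI[of _ "\<one>\<^bsub>\<pi>\<^esub>"]) auto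
  next
    case (Suc n)
    then obtain d where d: "d \<in> carrier \<pi>" "\<forall>u. real_hom \<pi> u \<longrightarrow> u d = (\<Sum>j<n. u (drift f \<gamma> ((f ^^ j) x0)))" by blast
    have "(f ^^ n) x0 \<in> topspace X" using x0 aff_setD(7)[OF aff] by (induction n) auto
    then have D: "drift f \<gamma> ((f ^^ n) x0) \<in> carrier \<pi>" by (rule drift_in[OF fc \<gamma>])
    show ?case
    proof (intro exI conjI allI impI)
      show "d \<otimes>\<^bsub>\<pi>\<^esub> drift f \<gamma> ((f ^^ n) x0) \<in> carrier \<pi>" using d(1) D by simp
      show "u (d \<otimes>\<^bsub>\<pi>\<^esub> drift f \<gamma> ((f ^^ n) x0)) = (\<Sum>j<Suc n. u (drift f \<gamma> ((f ^^ j) x0)))" if u: "real_hom \<pi> u" for u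
        using d(2) u by (simp add: real_homD[OF u d(1) D])
    qed
  qed
  obtain d where d: "d \<in> carrier \<pi>" "\<forall>u. real_hom \<pi> u \<longrightarrow> u d = (\<Sum>j<m. u (drift f \<gamma> ((f ^^ j) x0)))"
    using drifts[of m] by (elim exE conjE)
  obtain u v where uv: "real_hom \<pi> u" "real_hom \<pi> v" "u d = 0" "v d = 0" "pairing g a b u v = 1"
    "\<forall>C\<in>carrier \<pi>. u C \<in> \<int>" "\<forall>C\<in>carrier \<pi>. v C \<in> \<int>"
    by (rule integral_pair_exists[OF genus d(1)]) blast
  obtain \<xi> where \<xi>: "\<And>i s. s \<in> squares Q \<Longrightarrow> cochain u i s + coboundary \<xi> i s \<in> \<int>"
    "\<And>i s. s \<in> squares Q \<Longrightarrow> cochain u i (\<sigma> s) + coboundary \<xi> i (\<sigma> s) = cochain u i s + coboundary \<xi> i s"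
    by (rule invariant_cocycle[OF aff \<gamma> \<sigma> m(1) mf uv(1) bspec[OF uv(6)] triv[OF uv(1)]]) (use d(2)[rule_format, OF uv(1)] uv(3) in auto)
  obtain \<zeta> where \<zeta>: "\<And>i s. s \<in> squares Q \<Longrightarrow> cochain v i s + coboundary \<zeta> i s \<in> \<int>"
    "\<And>i s. s \<in> squares Q \<Longrightarrow> cochain v i (\<sigma> s) + coboundary \<zeta> i (\<sigma> s) = cochain v i s + coboundary \<zeta> i s"
    by (rule invariant_cocycle[OF aff \<gamma> \<sigma> m(1) mf uv(2) bspec[OF uv(7)] triv[OF uv(2)]]) (use d(2)[rule_format, OF uv(2)] uv(4) in auto)
  define e where "e i s = cochain u i s + coboundary \<xi> i s" for i s
  define e' where "e' i s = cochain v i s + coboundary \<zeta> i s" for i s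
  define F where "F s = e 1 s * e' 2 (nxt Q 1 s) - e 2 s * e' 1 (nxt Q 2 s)" for s
  have "\<exists>n\<in>\<int>. sum F (squares Q) = real m * n"
  proof (rule sum_free_cyclic_action[OF finite_squares \<sigma>in m(1) m\<sigma> free])
    show "F (\<sigma> s) = F s" if "s \<in> squares Q" for s
      using that \<xi>(2) \<zeta>(2) by (simp add: F_def e_def e'_def deck_nxt[OF \<sigma>, symmetric])
    show "F s \<in> \<int>" if "s \<in> squares Q" for s
      using that \<xi>(1) \<zeta>(1) unfolding F_def e_def e'_def by (intro Ints_diff Ints_mult) auto
  qed
  then obtain n where n: "n \<in> \<int>" "sum F (squares Q) = real m * n" by blast
  have "sum F (squares Q) = cup (cochain u) (cochain v)"
    using cup_add_coboundaries[OF cocycle_cochain[OF uv(1)] cocycle_cochain[OF uv(2)], of \<xi> \<zeta>]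
    by (simp add: F_def e_def e'_def cup_def)
  moreover obtain k where k: "k \<in> \<int>" "cup (cochain u) (cochain v) * k = 1"
    using fundamental_class uv(1,2,5) by metis
  ultimately have "real m * n * k = 1" using n(2) by simp
  then obtain n' k' :: int where "of_int (int m * n' * k') = (1::real)"
    using n(1) k(1) by (auto elim!: Ints_cases)
  then have "int m * (n' * k') = 1" by (metis mult.assoc of_int_eq_1_iff)
  then have "int m dvd 1" by (metis dvd_triv_left)
  then have "m = 1" by simp
  then show "f x = x" if "x \<in> topspace X" for x using mf[OF that] by simp
qed

section \<open>The stabiliser is a group\<close>

lemma aff_setI:
  assumes "f \<in> extensional (topspace X)" "homeomorphic_map X X f"
    "\<And>c. c \<in> carrier (homology_group 2 X) \<Longrightarrow> hom_induced 2 X {} X {} f c = c"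
    "f ` punctured_surface Q = punctured_surface Q" "affine_with Q f A" "det A = 1"
  shows "f \<in> aff_set"
  using assms unfolding aff_set_def aff_group_def orientation_preserving_homeo_def by auto

lemma punctured_subset: "punctured_surface Q \<subseteq> topspace X"
  by (auto simp: punctured_surface_def)

lemma compose_in_aff_set:
  assumes f: "f \<in> aff_set" and h: "h \<in> aff_set"
  shows "compose (topspace X) f h \<in> aff_set" "der Q (compose (topspace X) f h) = der Q f ** der Q h"
proof -
  let ?c = "compose (topspace X) f h"
  have eq: "?c x = (f \<circ> h) x" if "x \<in> topspace X" for x using that by (simp add: compose_def)
  have aff: "affine_with Q ?c (der Q f ** der Q h)"
  proof (rule affine_with_cong[OF affine_with_compose[OF der_affine(1)[OF f] der_affine(1)[OF h] aff_setD(3)[OF h]]])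
    show "h x \<in> punctured_surface Q" if "x \<in> punctured_surface Q" for x
      using aff_setD(6)[OF h] that by blast
  qed (use eq in simp)
  show mem: "?c \<in> aff_set"
  proof (rule aff_setI[OF _ _ _ _ aff])
    show "homeomorphic_map X X ?c"
      using homeomorphic_map_compose[OF aff_setD(2)[OF h] aff_setD(2)[OF f]]
      by (rule homeomorphic_map_eq) (simp add: eq)
    show "hom_induced 2 X {} X {} ?c c = c" if c: "c \<in> carrier (homology_group 2 X)" for c
    proof -
      have "hom_induced 2 X {} X {} ?c = hom_induced 2 X {} X {} (f \<circ> h)"
        by (rule hom_induced_eq) (simp add: eq)
      then show ?thesis
        using hom_induced_compose_empty[OF aff_setD(3)[OF h] aff_setD(3)[OF f], of 2] aff_setD(5)[OF f c] aff_setD(5)[OF h c]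
        by simp
    qed
    have "?c ` punctured_surface Q = f ` h ` punctured_surface Q"
      using punctured_subset eq by (auto simp: image_image image_def subset_iff)
    then show "?c ` punctured_surface Q = punctured_surface Q"
      using aff_setD(6)[OF f] aff_setD(6)[OF h] by simp
    show "det (der Q f ** der Q h) = 1"
      using der_affine(2)[OF f] der_affine(2)[OF h] by (simp add: det_mul)
  qed (simp add: compose_def)
  show "der Q ?c = der Q f ** der Q h" by (rule der_eq[OF mem aff])
qed

lemma inverse_in_aff_set:
  assumes f: "f \<in> aff_set"
  defines "h \<equiv> restrict (inv_into (topspace X) f) (topspace X)"
  shows "h \<in> aff_set" "\<And>x. x \<in> topspace X \<Longrightarrow> f (h x) = x" "\<And>x. x \<in> topspace X \<Longrightarrow> h (f x) = x"
proof -
  have bij: "bij_betw f (topspace X) (topspace X)" by (rule aff_setD(4)[OF f])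
  show fh: "f (h x) = x" if "x \<in> topspace X" for x
    using that bij by (simp add: h_def bij_betw_inv_into_right)
  show hf: "h (f x) = x" if "x \<in> topspace X" for x
    using that bij aff_setD(7)[OF f] by (simp add: h_def bij_betw_inv_into_left)
  obtain k where k: "homeomorphic_maps X X f k"
    using aff_setD(2)[OF f] by (auto simp: homeomorphic_map_maps)
  have kh: "k x = h x" if "x \<in> topspace X" for x
  proof -
    have "k (f (h x)) = h x"
      using k that bij by (auto simp: homeomorphic_maps_def h_def bij_betw_def inv_into_into)
    then show ?thesis using fh[OF that] by simp
  qed
  have "homeomorphic_map X X k" using k homeomorphic_maps_sym homeomorphic_map_maps by blast
  then have hom: "homeomorphic_map X X h" by (rule homeomorphic_map_eq) (simp add: kh)
  then have hc: "continuous_map X X h" by (rule homeomorphic_imp_continuous_map)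
  have "invertible (der Q f)"
    using der_affine(2)[OF f] by (simp add: invertible_det_nz)
  then obtain B where inv: "B ** der Q f = mat 1"
    unfolding invertible_def by blast
  show "h \<in> aff_set"
  proof (rule aff_setI[OF _ hom])
    show "affine_with Q h B"
      by (rule affine_with_inverse[OF der_affine(1)[OF f] inv hc fh hf])
    have "det B * det (der Q f) = 1"
      using arg_cong[OF inv, of det] by (simp add: det_mul)
    then show "det B = 1" using der_affine(2)[OF f] by simp
    have "h ` punctured_surface Q = h ` f ` punctured_surface Q" using aff_setD(6)[OF f] by simp
    also have "\<dots> = punctured_surface Q"
      using hf punctured_subset by (force simp: image_image)
    finally show "h ` punctured_surface Q = punctured_surface Q" .
    show "hom_induced 2 X {} X {} h c = c" if c: "c \<in> carrier (homology_group 2 X)" for c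
    proof -
      have "hom_induced 2 X {} X {} h c = hom_induced 2 X {} X {} (h \<circ> f) c"
        using hom_induced_compose_empty[OF aff_setD(3)[OF f] hc, of 2] aff_setD(5)[OF f c] by simp
      also have "\<dots> = c"
        by (rule hom_induced_id_gen[OF continuous_map_compose[OF aff_setD(3)[OF f] hc] _ c]) (simp add: hf)
      finally show ?thesis .
    qed
  qed (simp add: h_def)
qed

lemma path_reverse_join: "c 1 = d 0 \<Longrightarrow> path_reverse (path_join c d) = path_join (path_reverse d) (path_reverse c)"
  by (auto simp: path_reverse_def path_join_def fun_eq_iff algebra_simps)

lemma induced_auto_compose:
  assumes f: "f \<in> aff_set" and h: "h \<in> aff_set" and \<gamma>: "\<gamma> \<in> paths_between X x0 (f x0)" and \<eta>: "\<eta> \<in> paths_between X x0 (h x0)"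
    and C: "C \<in> carrier \<pi>"
  shows "path_join \<gamma> (f \<circ> \<eta>) \<in> paths_between X x0 (compose (topspace X) f h x0)"
    "induced_auto X x0 (compose (topspace X) f h) (path_join \<gamma> (f \<circ> \<eta>)) C = induced_auto X x0 f \<gamma> (induced_auto X x0 h \<eta> C)"
proof -
  let ?c = "compose (topspace X) f h"
  note fc = aff_setD(3)[OF f] and hc = aff_setD(3)[OF h]
  have cc: "continuous_map X X ?c" by (rule aff_setD(3)[OF compose_in_aff_set(1)[OF f h]])
  have cx: "?c x0 = f (h x0)" using x0 by (simp add: compose_def)
  show \<theta>: "path_join \<gamma> (f \<circ> \<eta>) \<in> paths_between X x0 (?c x0)"
    unfolding cx by (rule paths_between_join[OF \<gamma> paths_between_compose[OF \<eta> fc]])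
  obtain c where c: "c \<in> paths_between X x0 x0" "C = path_class X c"
    using C by (rule fundamental_group_carrierE)
  have P: "pathin X c" "c 0 = x0" "c 1 = x0" "pathin X \<gamma>" "\<gamma> 0 = x0" "\<gamma> 1 = f x0"
    "pathin X \<eta>" "\<eta> 0 = x0" "\<eta> 1 = h x0" using c \<gamma> \<eta> by (auto simp: paths_between_def)
  have P': "pathin X (f \<circ> \<eta>)" "pathin X (h \<circ> c)" "pathin X (f \<circ> (h \<circ> c))"
    using P by (auto intro!: pathin_compose[OF _ fc] pathin_compose[OF _ hc])
  note [simp] = P P' pathin_path_join pathin_path_reverse
  let ?B = "f \<circ> \<eta>" and ?M = "f \<circ> (h \<circ> c)"
  have "path_homotopic X (?c \<circ> c) ?M"
  proof (rule path_homotopic_sym, rule path_homotopic_eq)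
    fix t :: real assume "t \<in> {0..1}"
    then have "c t \<in> topspace X" using path_image_subset_topspace[OF P(1)] by auto
    then show "?M t = (?c \<circ> c) t" by (simp add: compose_def)
  qed simp
  then have "path_homotopic X (path_join (path_join \<gamma> ?B) (path_join (?c \<circ> c) (path_reverse (path_join \<gamma> ?B))))
      (path_join (path_join \<gamma> ?B) (path_join ?M (path_join (path_reverse ?B) (path_reverse \<gamma>))))"
    using path_homotopic_ends by (subst path_reverse_join, simp) (intro path_join_cong path_homotopic_refl; simp add: cx)
  also have "path_homotopic X \<dots> (path_join \<gamma> (path_join ?B (path_join ?M (path_join (path_reverse ?B) (path_reverse \<gamma>)))))"
    by (rule path_join_assoc) simp_all
  also have "path_homotopic X \<dots> (path_join \<gamma> (path_join ?B (path_join (path_join ?M (path_reverse ?B)) (path_reverse \<gamma>))))"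
    by (intro path_join_cong path_homotopic_refl path_homotopic_sym[OF path_join_assoc]) simp_all
  also have "path_homotopic X \<dots> (path_join \<gamma> (path_join (path_join ?B (path_join ?M (path_reverse ?B))) (path_reverse \<gamma>)))"
    by (intro path_join_cong path_homotopic_refl path_homotopic_sym[OF path_join_assoc]) simp_all
  also have "path_join ?B (path_join ?M (path_reverse ?B)) = f \<circ> path_join \<eta> (path_join (h \<circ> c) (path_reverse \<eta>))"
    by (simp only: compose_path_join compose_path_reverse)
  finally have hom: "path_homotopic X (path_join (path_join \<gamma> ?B) (path_join (?c \<circ> c) (path_reverse (path_join \<gamma> ?B))))
      (path_join \<gamma> (path_join (f \<circ> path_join \<eta> (path_join (h \<circ> c) (path_reverse \<eta>))) (path_reverse \<gamma>)))" .
  have loop: "path_join \<eta> (path_join (h \<circ> c) (path_reverse \<eta>)) \<in> paths_between X x0 x0"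
    by (simp add: paths_between_def)
  show "induced_auto X x0 ?c (path_join \<gamma> (f \<circ> \<eta>)) C = induced_auto X x0 f \<gamma> (induced_auto X x0 h \<eta> C)"
    using path_class_cong[OF hom] loop
    by (simp only: c(2) induced_auto_path_class[OF cc \<theta> c(1)] induced_auto_path_class[OF hc \<eta> c(1)] induced_auto_path_class[OF fc \<gamma> loop])
qed

lemma compose_in_stabiliser:
  assumes f: "f \<in> stabiliser" and h: "h \<in> stabiliser"
  shows "compose (topspace X) f h \<in> stabiliser"
proof -
  let ?F = "free_group {..<g}"
  interpret F: group ?F by (rule group_free_group)
  obtain \<gamma> w where 1: "f \<in> aff_set" "\<gamma> \<in> paths_between X x0 (f x0)" "w \<in> carrier ?F"
    "\<And>C. C \<in> carrier \<pi> \<Longrightarrow> \<alpha> (induced_auto X x0 f \<gamma> C) = w \<otimes>\<^bsub>?F\<^esub> \<alpha> C \<otimes>\<^bsub>?F\<^esub> inv\<^bsub>?F\<^esub> w"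
    using f unfolding stabiliser_iff by blast
  obtain \<eta> v where 2: "h \<in> aff_set" "\<eta> \<in> paths_between X x0 (h x0)" "v \<in> carrier ?F"
    "\<And>C. C \<in> carrier \<pi> \<Longrightarrow> \<alpha> (induced_auto X x0 h \<eta> C) = v \<otimes>\<^bsub>?F\<^esub> \<alpha> C \<otimes>\<^bsub>?F\<^esub> inv\<^bsub>?F\<^esub> v"
    using h unfolding stabiliser_iff by blast
  have \<alpha>: "\<alpha> C \<in> carrier ?F" if "C \<in> carrier \<pi>" for C using \<alpha>_epi that by (auto simp: epi_def hom_def)
  note ind = induced_auto_compose[OF 1(1) 2(1) 1(2) 2(2)]
  have "\<alpha> (induced_auto X x0 (compose (topspace X) f h) (path_join \<gamma> (f \<circ> \<eta>)) C)
      = (w \<otimes>\<^bsub>?F\<^esub> v) \<otimes>\<^bsub>?F\<^esub> \<alpha> C \<otimes>\<^bsub>?F\<^esub> inv\<^bsub>?F\<^esub> (w \<otimes>\<^bsub>?F\<^esub> v)" if C: "C \<in> carrier \<pi>" for C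
  proof -
    have "induced_auto X x0 h \<eta> C \<in> carrier \<pi>"
      using induced_auto_hom[OF aff_setD(3)[OF 2(1)] 2(2)] C by (rule hom_in_carrier)
    then show ?thesis
      using 1(3) 2(3) \<alpha>[OF C] by (simp add: ind(2)[OF C] 1(4) 2(4) C F.inv_mult_group F.m_assoc)
  qed
  then show ?thesis
    unfolding stabiliser_iff using compose_in_aff_set(1)[OF 1(1) 2(1)] ind(1)[OF fg.one_closed] F.m_closed[OF 1(3) 2(3)] by blast
qed

lemma inverse_in_stabiliser:
  assumes f: "f \<in> stabiliser"
  shows "restrict (inv_into (topspace X) f) (topspace X) \<in> stabiliser"
proof -
  let ?F = "free_group {..<g}"
  interpret F: group ?F by (rule group_free_group)
  obtain \<gamma> w where 1: "f \<in> aff_set" "\<gamma> \<in> paths_between X x0 (f x0)" "w \<in> carrier ?F"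
    "\<And>C. C \<in> carrier \<pi> \<Longrightarrow> \<alpha> (induced_auto X x0 f \<gamma> C) = w \<otimes>\<^bsub>?F\<^esub> \<alpha> C \<otimes>\<^bsub>?F\<^esub> inv\<^bsub>?F\<^esub> w"
    using f unfolding stabiliser_iff by blast
  define k where "k = restrict (inv_into (topspace X) f) (topspace X)"
  note h = inverse_in_aff_set[OF 1(1), folded k_def]
  note fc = aff_setD(3)[OF 1(1)] and hc = aff_setD(3)[OF h(1)]
  have \<alpha>: "\<alpha> C \<in> carrier ?F" if "C \<in> carrier \<pi>" for C using \<alpha>_epi that by (auto simp: epi_def hom_def)
  define \<eta> where "\<eta> = k \<circ> path_reverse \<gamma>"
  have \<eta>: "\<eta> \<in> paths_between X x0 (k x0)"
    using paths_between_compose[OF paths_between_reverse[OF 1(2)] hc] h(3)[OF x0] by (simp add: \<eta>_def)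
  have undo: "induced_auto X x0 f \<gamma> (induced_auto X x0 k \<eta> C) = C" if C: "C \<in> carrier \<pi>" for C
  proof -
    obtain c where c: "c \<in> paths_between X x0 x0" "C = path_class X c"
      using C by (rule fundamental_group_carrierE)
    have P: "pathin X c" "c 0 = x0" "c 1 = x0" "pathin X \<gamma>" "\<gamma> 0 = x0" "\<gamma> 1 = f x0"
      using c 1(2) by (auto simp: paths_between_def)
    have P': "pathin X \<eta>" "\<eta> 0 = x0" "\<eta> 1 = k x0" "pathin X (k \<circ> c)"
      using \<eta> P(1) by (auto simp: paths_between_def intro!: pathin_compose[OF _ hc])
    note [simp] = P P' pathin_path_join pathin_path_reverse h(2)[OF x0]
    have cancel: "path_homotopic X (f \<circ> (k \<circ> p)) p" if p: "pathin X p" for p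
    proof (rule path_homotopic_sym, rule path_homotopic_eq[OF p])
      fix t :: real assume "t \<in> {0..1}"
      then have "p t \<in> topspace X" using path_image_subset_topspace[OF p] by auto
      then show "p t = (f \<circ> (k \<circ> p)) t" using h(2) by simp
    qed
    have f\<eta>: "path_homotopic X (f \<circ> \<eta>) (path_reverse \<gamma>)" unfolding \<eta>_def by (rule cancel) simp
    have f\<eta>': "path_homotopic X (path_reverse (f \<circ> \<eta>)) \<gamma>"
      using path_reverse_cong[OF f\<eta>] by simp
    have e: "(f \<circ> \<eta>) 1 = x0" "(f \<circ> (k \<circ> c)) 0 = x0" "(f \<circ> (k \<circ> c)) 1 = x0" "(f \<circ> \<eta>) 0 = f x0"
      by simp_all
    have "path_homotopic X (path_join \<gamma> (path_join (path_join (f \<circ> \<eta>) (path_join (f \<circ> (k \<circ> c)) (path_reverse (f \<circ> \<eta>)))) (path_reverse \<gamma>)))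
       (path_join \<gamma> (path_join (path_join (path_reverse \<gamma>) (path_join c \<gamma>)) (path_reverse \<gamma>)))"
      by (intro path_join_cong path_homotopic_refl f\<eta> f\<eta>' cancel) (simp_all only: path_join_ends path_reverse_ends e P simp_thms pathin_path_reverse)
    also have "path_homotopic X \<dots> (path_join \<gamma> (path_join (path_reverse \<gamma>) (path_join (path_join c \<gamma>) (path_reverse \<gamma>))))"
      by (intro path_join_cong path_homotopic_refl path_join_assoc) simp_all
    also have "path_homotopic X \<dots> (path_join (path_join \<gamma> (path_reverse \<gamma>)) (path_join (path_join c \<gamma>) (path_reverse \<gamma>)))"
      by (rule path_homotopic_sym[OF path_join_assoc]) simp_all
    also have "path_homotopic X \<dots> (path_join (\<lambda>_. \<gamma> 0) (path_join c (path_join \<gamma> (path_reverse \<gamma>))))"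
      by (intro path_join_cong path_join_reverse_right path_join_assoc) simp_all
    also have "path_homotopic X \<dots> (path_join c (path_join \<gamma> (path_reverse \<gamma>)))"
      by (rule path_join_const_left) simp_all
    also have "path_homotopic X \<dots> (path_join c (\<lambda>_. \<gamma> 0))"
      by (intro path_join_cong path_homotopic_refl path_join_reverse_right) simp_all
    also have "path_homotopic X \<dots> c"
      by (rule path_join_const_right) simp_all
    finally have hom: "path_homotopic X (path_join \<gamma> (path_join (f \<circ> path_join \<eta> (path_join (k \<circ> c) (path_reverse \<eta>))) (path_reverse \<gamma>))) c"
      by (simp only: compose_path_join compose_path_reverse)
    have loop: "path_join \<eta> (path_join (k \<circ> c) (path_reverse \<eta>)) \<in> paths_between X x0 x0"
      by (simp add: paths_between_def)
    show ?thesis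
      using path_class_cong[OF hom]
      by (simp only: c(2) induced_auto_path_class[OF hc \<eta> c(1)] induced_auto_path_class[OF fc 1(2) loop])
  qed
  have "\<alpha> (induced_auto X x0 k \<eta> C) = inv\<^bsub>?F\<^esub> w \<otimes>\<^bsub>?F\<^esub> \<alpha> C \<otimes>\<^bsub>?F\<^esub> inv\<^bsub>?F\<^esub> (inv\<^bsub>?F\<^esub> w)" if C: "C \<in> carrier \<pi>" for C
  proof -
    have D: "induced_auto X x0 k \<eta> C \<in> carrier \<pi>"
      using induced_auto_hom[OF hc \<eta>] C by (rule hom_in_carrier)
    have "\<alpha> C = w \<otimes>\<^bsub>?F\<^esub> \<alpha> (induced_auto X x0 k \<eta> C) \<otimes>\<^bsub>?F\<^esub> inv\<^bsub>?F\<^esub> w"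
      using 1(4)[OF D] undo[OF C] by simp
    then show ?thesis
      using 1(3) \<alpha>[OF D] by (simp add: F.m_assoc) (simp add: F.m_assoc[symmetric])
  qed
  then show ?thesis
    unfolding stabiliser_iff k_def[symmetric] using h(1) \<eta> F.inv_closed[OF 1(3)] by blast
qed

lemma subgroup_stabiliser: "subgroup stabiliser (BijGroup (topspace X))"
proof (rule group.subgroupI[OF group_BijGroup])
  show sub: "stabiliser \<subseteq> carrier (BijGroup (topspace X))"
    using aff_setD(1,4) by (auto simp: stabiliser_iff BijGroup_def Bij_def)
  show "f \<otimes>\<^bsub>BijGroup (topspace X)\<^esub> h \<in> stabiliser" if "f \<in> stabiliser" "h \<in> stabiliser" for f h
    using compose_in_stabiliser[OF that] sub that by (auto simp: BijGroup_def)
  show inv: "inv\<^bsub>BijGroup (topspace X)\<^esub> f \<in> stabiliser" if "f \<in> stabiliser" for f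
    using inverse_in_stabiliser[OF that] sub that by (subst inv_BijGroup) (auto simp: BijGroup_def)
  let ?id = "\<lambda>x\<in>topspace X. x"
  have id: "?id \<in> aff_set"
  proof (rule aff_setI)
    show "homeomorphic_map X X ?id"
      by (rule homeomorphic_map_eq[of X X id]) (simp_all add: homeomorphic_map_id)
    then show "hom_induced 2 X {} X {} ?id c = c" if "c \<in> carrier (homology_group 2 X)" for c
      using that by (intro hom_induced_id_gen homeomorphic_imp_continuous_map) auto
    show "?id ` punctured_surface Q = punctured_surface Q"
      using punctured_subset by (auto simp: image_def)
    show "affine_with Q ?id (mat 1)"
      by (rule affine_with_cong[OF affine_with_id]) simp
  qed simp_all
  have "?id \<in> stabiliser"
    unfolding stabiliser_iff
  proof (intro conjI id bexI ballI)
    let ?F = "free_group {..<g}"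
    interpret F: group ?F by (rule group_free_group)
    show k: "(\<lambda>_. x0) \<in> paths_between X x0 (?id x0)" using x0 by (simp add: paths_between_const)
    show "\<one>\<^bsub>?F\<^esub> \<in> carrier ?F" by simp
    fix C assume C: "C \<in> carrier \<pi>"
    then obtain c where c: "c \<in> paths_between X x0 x0" "C = path_class X c" by (rule fundamental_group_carrierE)
    have P: "pathin X c" "c 0 = x0" "c 1 = x0" using c by (auto simp: paths_between_def)
    have ic: "path_homotopic X (?id \<circ> c) c"
    proof (rule path_homotopic_sym, rule path_homotopic_eq[OF P(1)])
      fix t :: real assume "t \<in> {0..1}"
      then show "c t = (?id \<circ> c) t" using path_image_subset_topspace[OF P(1)] by auto
    qed
    have "path_homotopic X (path_join (\<lambda>_. x0) (path_join (?id \<circ> c) (\<lambda>_. x0))) (path_join (\<lambda>_. x0) (path_join c (\<lambda>_. x0)))"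
      using P x0 by (intro path_join_cong path_homotopic_refl ic) simp_all
    also have "path_homotopic X \<dots> (path_join (\<lambda>_. x0) c)"
      using P x0 by (intro path_join_cong path_homotopic_refl path_join_const_right) simp_all
    also have "path_homotopic X \<dots> c"
      using P by (intro path_join_const_left)
    finally have hom: "path_homotopic X (path_join (\<lambda>_. x0) (path_join (?id \<circ> c) (\<lambda>_. x0))) c" .
    have "induced_auto X x0 ?id (\<lambda>_. x0) C = C"
      using induced_auto_path_class[OF aff_setD(3)[OF id] k c(1)] path_class_cong[OF hom]
      by (simp only: c(2) path_reverse_def)
    moreover have "\<alpha> C \<in> carrier ?F" using \<alpha>_epi C by (auto simp: epi_def hom_def)
    ultimately show "\<alpha> (induced_auto X x0 ?id (\<lambda>_. x0) C) = \<one>\<^bsub>?F\<^esub> \<otimes>\<^bsub>?F\<^esub> \<alpha> C \<otimes>\<^bsub>?F\<^esub> inv\<^bsub>?F\<^esub> \<one>\<^bsub>?F\<^esub>"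
      by simp
  qed
  then show "stabiliser \<noteq> {}" by blast
qed

lemma aff_mod_group_eq: "aff_mod_group Q x0 g \<alpha> = (BijGroup (topspace X)) \<lparr>carrier := stabiliser\<rparr>"
  by (simp add: aff_mod_group_def aff_group_def)

lemma group_aff_mod_group: "group (aff_mod_group Q x0 g \<alpha>)"
  using subgroup.subgroup_is_group[OF subgroup_stabiliser group_BijGroup] by (simp flip: aff_mod_group_eq)

text \<open>The linear parts in the stabiliser are shears in one common direction \<open>v\<close>.  How far such a shear
  moves a fixed period \<open>x\<close> along \<open>v\<close> is additive, and integral because the moved vector is again a
  period; and the shear is determined by it.\<close>

theorem stabiliser_cyclic:
  "stabiliser = {\<one>\<^bsub>aff_mod_group Q x0 g \<alpha>\<^esub>} \<or> aff_mod_group Q x0 g \<alpha> \<cong> integer_group"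
proof -
  let ?G = "aff_mod_group Q x0 g \<alpha>"
  interpret G: group ?G by (rule group_aff_mod_group)
  have mult: "f \<otimes>\<^bsub>?G\<^esub> h = compose (topspace X) f h" if "f \<in> stabiliser" "h \<in> stabiliser" for f h
  proof -
    have "f \<otimes>\<^bsub>?G\<^esub> h = f \<otimes>\<^bsub>BijGroup (topspace X)\<^esub> h"
      by (simp add: aff_mod_group_def aff_group_def)
    moreover have "f \<in> Bij (topspace X)" "h \<in> Bij (topspace X)"
      using that subgroup.mem_carrier[OF subgroup_stabiliser] by (simp_all add: BijGroup_def)
    ultimately show ?thesis by (simp add: BijGroup_def)
  qed
  have one: "\<one>\<^bsub>?G\<^esub> = (\<lambda>x\<in>topspace X. x)" by (simp add: aff_mod_group_def aff_group_def BijGroup_def)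
  have aff: "f \<in> aff_set" if "f \<in> stabiliser" for f using that stabiliser_iff by blast
  have triv: "f = \<one>\<^bsub>?G\<^esub>" if f: "f \<in> stabiliser" and der: "der Q f = mat 1" for f
    unfolding one using translation_trivial[OF f der] aff_setD(1)[OF aff[OF f]]
    by (intro extensionalityI[of _ "topspace X"]) auto
  show ?thesis
  proof (cases "\<exists>i<g. period (a i) \<noteq> 0")
    case False
    then have "f = \<one>\<^bsub>?G\<^esub>" if "f \<in> stabiliser" for f
      using triv[OF that] stabiliser_der_trivial[OF that] by blast
    then show ?thesis using G.one_closed by blast
  next
    case True
    then obtain i0 where i0: "i0 < g" "period (a i0) \<noteq> 0" by blast
    define v where "v = period (a i0)"
    have v: "v \<noteq> 0" "\<And>f. f \<in> stabiliser \<Longrightarrow> der Q f *v v = v"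
      using i0 stabiliser_der_fixes by (auto simp: v_def)
    obtain j where j: "v $ j \<noteq> 0" using v(1) by (auto simp: vec_eq_iff)
    obtain C where C: "C \<in> carrier \<pi>" "v $ 1 * period C $ 2 \<noteq> v $ 2 * period C $ 1"
      by (rule periods_span[OF v(1)])
    define x where "x = period C"
    have shear: "\<exists>p. der Q f *v x - x = p *\<^sub>R v" if "f \<in> stabiliser" for f
      by (rule shear_displacement[OF der_affine(2)[OF aff[OF that]] v(2)[OF that] v(1)])
    define d where "d f = (der Q f *v x - x) $ j" for f
    have d_int: "d f \<in> \<int>" if f: "f \<in> stabiliser" for f
    proof -
      obtain \<gamma> where \<gamma>: "\<gamma> \<in> paths_between X x0 (f x0)" using f stabiliser_iff by blast
      have "induced_auto X x0 f \<gamma> C \<in> carrier \<pi>"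
        using induced_auto_hom[OF aff_setD(3)[OF aff[OF f]] \<gamma>] C(1) by (rule hom_in_carrier)
      then have "(der Q f *v x) $ j \<in> \<int>"
        unfolding x_def period_induced_auto[OF aff[OF f] \<gamma> C(1), symmetric] period_nth
        by (intro winding_hom_integral coord)
      moreover have "x $ j \<in> \<int>"
        unfolding x_def period_nth by (intro winding_hom_integral coord C)
      ultimately show ?thesis by (simp add: d_def)
    qed
    have d_add: "d (f \<otimes>\<^bsub>?G\<^esub> h) = d f + d h" if f: "f \<in> stabiliser" and h: "h \<in> stabiliser" for f h
    proof -
      obtain p where p: "der Q h *v x - x = p *\<^sub>R v" using shear[OF h] by blast
      then have "der Q h *v x = x + p *\<^sub>R v" by (simp add: algebra_simps)
      then have "der Q (f \<otimes>\<^bsub>?G\<^esub> h) *v x = der Q f *v (x + p *\<^sub>R v)"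
        by (simp add: mult[OF f h] compose_in_aff_set(2)[OF aff[OF f] aff[OF h]] flip: matrix_vector_mul_assoc)
      also have "\<dots> = der Q f *v x + p *\<^sub>R v"
        by (simp add: matrix_vector_right_distrib matrix_vector_mult_scaleR v(2)[OF f])
      finally show ?thesis using p by (simp add: d_def)
    qed
    have d_inj: "f = \<one>\<^bsub>?G\<^esub>" if f: "f \<in> stabiliser" and 0: "d f = 0" for f
    proof (rule triv[OF f])
      obtain p where p: "der Q f *v x - x = p *\<^sub>R v" using shear[OF f] by blast
      then have "p = 0" using 0 j by (simp add: d_def)
      then have fx: "der Q f *v x = x" using p by simp
      show "der Q f = mat 1"
      proof (rule matrix_determined_by_periods)
        fix D assume "D \<in> carrier \<pi>"
        let ?y = "period D" and ?\<Delta> = "v $ 1 * x $ 2 - v $ 2 * x $ 1"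
        have \<Delta>: "?\<Delta> \<noteq> 0" using C(2) by (simp add: x_def)
        have "?\<Delta> *\<^sub>R ?y = (?y $ 1 * x $ 2 - ?y $ 2 * x $ 1) *\<^sub>R v + (v $ 1 * ?y $ 2 - v $ 2 * ?y $ 1) *\<^sub>R x"
          by (simp add: vec_eq_iff forall_2 algebra_simps)
        then have "?\<Delta> *\<^sub>R (der Q f *v ?y) = ?\<Delta> *\<^sub>R ?y"
          by (metis (no_types, lifting) fx matrix_vector_mult_scaleR matrix_vector_right_distrib v(2)[OF f])
        then show "der Q f *v ?y = mat 1 *v ?y" using \<Delta> by simp
      qed
    qed
    define h where "h f = \<lfloor>d f\<rfloor>" for f
    have hd: "real_of_int (h f) = d f" if "f \<in> stabiliser" for f
      using d_int[OF that] by (auto simp: h_def elim!: Ints_cases)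
    show ?thesis
    proof (rule injective_integer_hom_cyclic[OF group_aff_mod_group, of h])
      fix f k assume fk: "f \<in> stabiliser" "k \<in> stabiliser"
      then have "real_of_int (h (f \<otimes>\<^bsub>?G\<^esub> k)) = real_of_int (h f + h k)"
        using hd[OF G.m_closed[OF fk]] by (simp add: hd d_add)
      then show "h (f \<otimes>\<^bsub>?G\<^esub> k) = h f + h k" by linarith
    next
      fix f assume "f \<in> stabiliser" "h f = 0"
      then show "f = \<one>\<^bsub>?G\<^esub>" using d_inj[of f] hd[of f] by simp
    qed
  qed
qed

end

theorem theorem4p8:
  fixes Q :: "'s origami" and g :: nat and x0 :: "'s point"
    and \<alpha> :: "(real \<Rightarrow> 's point) set \<Rightarrow> nat word"
  assumes "is_origami Q"
    and "genus (surface Q) = g" and "g \<ge> 2"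
    and "x0 \<in> topspace (surface Q)"
    and "symplectic_hom (surface Q) x0 g \<alpha>"
  shows "(\<forall>A \<in> der Q ` carrier (aff_mod_group Q x0 g \<alpha>). \<not> hyperbolic A) \<and>
         (carrier (aff_mod_group Q x0 g \<alpha>) = {\<one>\<^bsub>aff_mod_group Q x0 g \<alpha>\<^esub>} \<or>
          aff_mod_group Q x0 g \<alpha> \<cong> integer_group)"
proof -
  obtain a b where ab: "symplectic_generators (fundamental_group (surface Q) x0) g a b"
    "\<forall>i<g. \<alpha> (a i) = \<one>\<^bsub>free_group {..<g}\<^esub>"
    and epi: "\<alpha> \<in> epi (fundamental_group (surface Q) x0) (free_group {..<g})"
    using assms(5) by (auto simp: symplectic_hom_def)
  interpret marked_origami Q x0 g a b \<alpha>
    using assms(1,3,4) ab epi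
    by (auto simp: marked_origami_def marked_origami_axioms_def based_origami_def
        based_origami_axioms_def origami_surface_def)
  have "\<not> hyperbolic (der Q f)" if "f \<in> stabiliser" for f
    using stabiliser_trace[OF that] by (simp add: hyperbolic_def)
  then show ?thesis
    using stabiliser_cyclic by blast
qed

end
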